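(* Let $\mathrm{K}_V^{\mathbf t}$ be a complete $\mathbf t$-spread $d$-partite hypergraph with $V(\mathrm{K}_V^{\mathbf t})\subseteq[n]$ and $V=\{V_1,\dots,V_d\}$, where $|V_j|=n_j$ and $V_j=[i_j,i_j+n_j-1]$ for all $j=1,\dots,d$. Let $S$ be the ambient ring of $I(\mathrm{K}_V^{\mathbf t})$. Then $S/I(\mathrm{K}_V^{\mathbf t})$ is Cohen-Macaulay if and only if either $I(\mathrm{K}_V^{\mathbf t})$ is a principal ideal, or $n_1=\dots=n_d=s$ (for some $s$) and $i_{j+1}-i_j=t_j$ for each $j=1,\dots,d-1$.
   Context: Setting. Let $n,d\ge 1$ be integers, $[n]=\{1,\dots,n\}$, $[a,b]=\{k\in\mathbb{Z}:a\le k\le b\}$, and let $\mathbf t=(t_1,\dots,t_{d-1})$ be a vector of integers with $t_i\ge 1$ for all $i$. Let $V=\{V_1,\dots,V_d\}$ be a family of nonempty, pairwise disjoint subsets of $[n]$ such that $p<q$ whenever $p\in V_i$, $q\in V_j$ and $i<j$. A $\mathbf t$-spread edge is a set $\{k_1,\dots,k_d\}$ with $k_j\in V_j$ for $j=1,\dots,d$ and $k_j-k_{j-1}\ge t_{j-1}$ for $j=2,\dots,d$. The complete $\mathbf t$-spread $d$-partite hypergraph $\mathrm{K}_V^{\mathbf t}$ is the hypergraph with vertex set $V(\mathrm{K}_V^{\mathbf t})=V_1\cup\dots\cup V_d$ whose edges are all the $\mathbf t$-spread edges. Standing assumption: $\mathrm{K}_V^{\mathbf t}$ has no isolated vertices,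 i.e. every vertex belongs to at least one edge. Let $\mathbb{K}$ be a field. The ambient ring is $S=\mathbb{K}[x_i : i\in V(\mathrm{K}_V^{\mathbf t})]$. The edge ideal $I(\mathrm{K}_V^{\mathbf t})\subset S$ is the ideal generated by the monomials $x_{k_1}\cdots x_{k_d}$, where $\{k_1,\dots,k_d\}$ runs over the edges of $\mathrm{K}_V^{\mathbf t}$. *)

theory Defs
  imports
    "HOL-Algebra.QuotRing"
    "HOL-Library.Poly_Mapping"
    "HOL-Library.Disjoint_Sets"
    "HOL-Library.Extended_Nat"
begin

section \<open>Krull dimension, depth and Cohen-Macaulay graded rings\<close>

text \<open>A strictly increasing list of \<open>r + 1\<close> primes is a chain of length \<open>r\<close>.\<close>

definition krull_dim :: "('a, 'b) ring_scheme \<Rightarrow> enat" where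
  "krull_dim R =
     (SUP Ps \<in> {Ps. Ps \<noteq> [] \<and> (\<forall>P \<in> set Ps. primeideal P R) \<and> sorted_wrt (\<subset>) Ps}.
        enat (length Ps - 1))"

text \<open>The sequence \<open>x\<^sub>1, \<dots>, x\<^sub>r\<close> is \<open>R\<close>-regular: each term is a nonzerodivisor modulo the
  ideal generated by the preceding ones, and \<open>R / (x\<^sub>1, \<dots>, x\<^sub>r) \<noteq> 0\<close>. The nonzerodivisor
  condition is written out in terms of representatives in \<open>R\<close>.\<close>

definition regular_sequence :: "('a, 'b) ring_scheme \<Rightarrow> 'a list \<Rightarrow> bool" where
  "regular_sequence R xs \<longleftrightarrow>
     set xs \<subseteq> carrier R \<and>
     (\<forall>i < length xs. \<forall>a \<in> carrier R.
        xs ! i \<otimes>\<^bsub>R\<^esub> a \<in> Idl\<^bsub>R\<^esub> (set (take i xs)) \<longrightarrow> a \<in> Idl\<^bsub>R\<^esub> (set (take i xs))) \<and>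
     Idl\<^bsub>R\<^esub> (set xs) \<noteq> carrier R"

definition depth :: "('a, 'b) ring_scheme \<Rightarrow> 'a set \<Rightarrow> enat" where
  "depth R \<mm> =
     (SUP xs \<in> {xs. regular_sequence R xs \<and> set xs \<subseteq> \<mm>}. enat (length xs))"

text \<open>Intended for a standard graded algebra \<open>R\<close> over a field and its graded maximal ideal \<open>\<mm>\<close>
  (or a Noetherian local ring \<open>R\<close> and its maximal ideal).\<close>

definition cohen_macaulay :: "('a, 'b) ring_scheme \<Rightarrow> 'a set \<Rightarrow> bool" where
  "cohen_macaulay R \<mm> \<longleftrightarrow> depth R \<mm> = krull_dim R"


section \<open>Polynomial rings\<close>

text \<open>Monomials are exponent vectors of finite support. The ring \<open>\<bbbK>[x\<^sub>i : i \<in> X]\<close> consists of the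
  polynomials all of whose monomials involve only variables indexed by \<open>X\<close>.\<close>

type_synonym ('v, 'k) mpoly = "('v \<Rightarrow>\<^sub>0 nat) \<Rightarrow>\<^sub>0 'k"

definition var :: "'v \<Rightarrow> ('v, 'k::field) mpoly" where
  "var v = Poly_Mapping.single (Poly_Mapping.single v 1) 1"

definition mpoly_ring :: "'v set \<Rightarrow> ('v, 'k::field) mpoly ring" where
  "mpoly_ring X =
     \<lparr>carrier = {p. \<forall>m \<in> Poly_Mapping.keys p. Poly_Mapping.keys m \<subseteq> X},
      mult = (*), one = 1, zero = 0, add = (+)\<rparr>"

definition graded_maximal_ideal :: "'v set \<Rightarrow> ('v, 'k::field) mpoly set" where
  "graded_maximal_ideal X = Idl\<^bsub>mpoly_ring X\<^esub> (var ` X)"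

definition cohen_macaulay_quotient :: "'v set \<Rightarrow> ('v, 'k::field) mpoly set \<Rightarrow> bool" where
  "cohen_macaulay_quotient X I \<longleftrightarrow>
     cohen_macaulay (mpoly_ring X Quot I)
       ((\<lambda>f. I +>\<^bsub>mpoly_ring X\<^esub> f) ` graded_maximal_ideal X)"

lemma mpoly_ring_cring: "cring (mpoly_ring X :: ('v, 'k::field) mpoly ring)"
proof -
  let ?C = "{p :: ('v, 'k) mpoly. \<forall>m \<in> Poly_Mapping.keys p. Poly_Mapping.keys m \<subseteq> X}"
  have add: "p + q \<in> ?C" if "p \<in> ?C" "q \<in> ?C" for p q
    using that Poly_Mapping.keys_add[of p q] by blast
  have mult: "p * q \<in> ?C" if "p \<in> ?C" "q \<in> ?C" for p q
  proof safe
    fix m v assume "m \<in> Poly_Mapping.keys (p * q)" "v \<in> Poly_Mapping.keys m"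
    then obtain a b where "m = a + b" "a \<in> Poly_Mapping.keys p" "b \<in> Poly_Mapping.keys q"
      using keys_mult[of p q] by blast
    with \<open>v \<in> Poly_Mapping.keys m\<close> that show "v \<in> X"
      using Poly_Mapping.keys_add[of a b] by blast
  qed
  have minus: "- p \<in> ?C" if "p \<in> ?C" for p
    using that by simp
  have inv: "\<exists>q \<in> ?C. q + p = 0" if "p \<in> ?C" for p
    using minus[OF that] by (intro bexI[of _ "- p"]) auto
  let ?R = "mpoly_ring X :: ('v, 'k) mpoly ring"
  have R: "carrier ?R = ?C" "mult ?R = (*)" "one ?R = 1" "zero ?R = 0" "add ?R = (+)"
    by (simp_all add: mpoly_ring_def)
  have zero: "0 \<in> ?C" and one: "1 \<in> ?C"
    by simp_all
  show ?thesis
  proof (rule cringI)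
    show "abelian_group ?R"
      by (rule abelian_groupI; unfold R) (use add zero inv in \<open>simp_all only: ac_simps add_0 add_0_right\<close>)
    show "comm_monoid ?R"
      by (rule comm_monoidI; unfold R) (use mult one in \<open>simp_all only: ac_simps mult_1 mult_1_right\<close>)
  qed (simp add: R distrib_right)
qed


section \<open>Hypergraphs and edge ideals\<close>

record 'v hypergraph =
  verts :: "'v set"
  edges :: "'v set set"

definition no_isolated_vertices :: "'v hypergraph \<Rightarrow> bool" where
  "no_isolated_vertices H \<longleftrightarrow> (\<forall>v \<in> verts H. \<exists>e \<in> edges H. v \<in> e)"

definition edge_ideal :: "'v hypergraph \<Rightarrow> ('v, 'k::field) mpoly set" where
  "edge_ideal H = Idl\<^bsub>mpoly_ring (verts H)\<^esub> ((\<lambda>e. \<Prod>v \<in> e. var v) ` edges H)"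

text \<open>Families \<open>V\<^sub>1, \<dots>, V\<^sub>d\<close> and vectors \<open>t\<^sub>1, \<dots>, t\<^bsub>d-1\<^esub>\<close> are functions on \<open>nat\<close>, of which only
  the values at \<open>1, \<dots>, d\<close> and \<open>1, \<dots>, d - 1\<close>, respectively, are used.\<close>

definition ordered_family :: "nat \<Rightarrow> nat \<Rightarrow> (nat \<Rightarrow> nat set) \<Rightarrow> bool" where
  "ordered_family n d V \<longleftrightarrow>
     (\<forall>j \<in> {1..d}. V j \<noteq> {} \<and> V j \<subseteq> {1..n}) \<and>
     disjoint_family_on V {1..d} \<and>
     (\<forall>i \<in> {1..d}. \<forall>j \<in> {1..d}. i < j \<longrightarrow> (\<forall>p \<in> V i. \<forall>q \<in> V j. p < q))"

definition spread_edges :: "nat \<Rightarrow> (nat \<Rightarrow> nat) \<Rightarrow> (nat \<Rightarrow> nat set) \<Rightarrow> nat set set" where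
  "spread_edges d t V =
     {k ` {1..d} | k. (\<forall>j \<in> {1..d}. k j \<in> V j) \<and>
        (\<forall>j \<in> {2..d}. int (k j) - int (k (j - 1)) \<ge> int (t (j - 1)))}"

definition complete_spread_hypergraph ::
  "nat \<Rightarrow> (nat \<Rightarrow> nat) \<Rightarrow> (nat \<Rightarrow> nat set) \<Rightarrow> nat hypergraph" where
  "complete_spread_hypergraph d t V =
     \<lparr>verts = (\<Union>j \<in> {1..d}. V j), edges = spread_edges d t V\<rparr>"

end

theory Submission
  imports Defs
begin

text \<open>Let \<open>S\<close> be the polynomial ring over the vertex set \<open>X\<close>, let \<open>N = |X|\<close> and let \<open>I\<close> be the
  edge ideal. Four estimates decide the question; the first three hold for every squarefree
  monomial ideal.

  \<^item> A set \<open>C\<close> of variables that meets every edge generates a prime over \<open>I\<close>, and adjoining the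
    other variables one by one gives \<open>dim S/I \<ge> N - |C|\<close> (\<open>krull_dim_quotient_ge\<close>). Each
    \<open>V\<^sub>j\<close> is such a set, hence \<open>dim S/I \<ge> N - n\<^sub>j\<close> for all \<open>j\<close>.

  \<^item> A prime over \<open>I\<close> contains a variable from each of \<open>s\<close> disjoint edges. Modulo these variables
    there are so few monomials that any \<open>N - s + 1\<close> elements are algebraically dependent over the
    field, and such a dependence bounds the length of a chain of primes. Hence
    \<open>dim S/I \<le> N - s\<close> (\<open>krull_dim_quotient_le\<close>).

  \<^item> Dividing by a nonzerodivisor in the maximal ideal moves nonzero Koszul homology up by one degree.
    Therefore a nonzero class in degree \<open>h\<close> gives \<open>depth S/I \<le> N - h\<close>
    (\<open>depth_quotient_le\<close>). Because \<open>I\<close> is generated in degree \<open>d\<close>, a chain with coefficients of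
    degree \<open>d - 1\<close> is such a class as soon as its boundary lies in \<open>I\<close> without vanishing
    (\<open>koszul_homology_nonzeroI\<close>).

  \<^item> If the edges are the sets \<open>{x\<^bsub>1,a\<^sub>1\<^esub>, \<dots>, x\<^bsub>d,a\<^sub>d\<^esub>}\<close> with \<open>0 \<le> a\<^sub>1 \<le> \<dots> \<le> a\<^sub>d < s\<close>, then \<open>I\<close> is a
    polarization of the \<open>d\<close>-th power of the ideal \<open>(y\<^sub>0, \<dots>, y\<^bsub>s-1\<^esub>)\<close>, and the \<open>s (d - 1)\<close> differences
    \<open>x\<^bsub>l,a\<^esub> - x\<^bsub>1,a\<^esub>\<close> with \<open>l \<ge> 2\<close> form a regular sequence (\<open>staircase_depth_ge\<close>).

  Since no vertex is isolated, the first and the last elements of the intervals advance by at least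
  \<open>t\<^sub>j\<close> from \<open>V\<^sub>j\<close> to \<open>V\<^bsub>j+1\<^esub>\<close>.

  Suppose that \<open>S/I\<close> is Cohen-Macaulay. Completing an edge by the first elements of the earlier
  levels and the last elements of the later levels leaves all of \<open>V\<^sub>j\<close> free at level \<open>j\<close>. This gives a
  Koszul class in degree \<open>n\<^sub>j\<close>, so \<open>depth S/I \<le> N - n\<^sub>j\<close> for all \<open>j\<close>; compared with the lower bounds on
  the dimension this forces \<open>n\<^sub>1 = \<dots> = n\<^sub>d = s\<close>. If moreover \<open>i\<^bsub>j+1\<^esub> - i\<^sub>j > t\<^sub>j\<close> for some \<open>j\<close> and \<open>s \<ge> 2\<close>,
  then each of the last two elements of \<open>V\<^bsub>j+1\<^esub>\<close> is compatible with all of \<open>V\<^sub>j\<close>, and there is a class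
  in degree \<open>s + 1\<close>, so the depth is smaller than the dimension. If \<open>s = 1\<close> there is only one edge
  and \<open>I\<close> is principal.

  Conversely, a principal edge ideal comes from a single edge
  (\<open>principal_edge_ideal_imp_single_edge\<close>), so that all \<open>V\<^sub>j\<close> are singletons. In this case, and in the
  case of equal sizes and \<open>i\<^bsub>j+1\<^esub> - i\<^sub>j = t\<^sub>j\<close>, the edges have the staircase form above. The \<open>s\<close> constant
  sequences are disjoint edges, and depth and dimension are both equal to \<open>N - s = s (d - 1)\<close>.\<close>

section \<open>Quotient rings\<close>

context cring
begin

lemma coset_mem_image_iff:
  assumes I: "ideal I R" and J: "ideal J R" and sub: "I \<subseteq> J" and a: "a \<in> carrier R"
  shows "I +> a \<in> (+>) I ` J \<longleftrightarrow> a \<in> J"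
proof
  interpret I: ideal I R by (rule I)
  interpret J: ideal J R by (rule J)
  assume "I +> a \<in> (+>) I ` J"
  then obtain b where b: "b \<in> J" "I +> a = I +> b" by auto
  have "a \<in> I +> b" using I.a_rcos_self[OF a] b(2) by simp
  then obtain i where "i \<in> I" "a = i \<oplus> b" by (auto simp: a_r_coset_def')
  then show "a \<in> J" using b(1) sub by (auto intro: J.a_closed)
qed auto

lemma coset_eq_zero:
  assumes "ideal I R" and "r \<in> I"
  shows "I +> r = \<zero>\<^bsub>R Quot I\<^esub>"
  using assms by (simp add: FactRing_def abelian_subgroup.a_rcos_const ideal.axioms(1) ideal.axioms(2)
    abelian_subgroupI3 additive_subgroup.a_subgroup is_abelian_group)

text \<open>Ideals of \<open>R/I\<close> correspond to ideals of \<open>R\<close> that contain \<open>I\<close>. With the lemmas of this section,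
  regular sequences and chains of primes in a quotient are studied on representatives in \<open>R\<close>.\<close>

lemma mem_Idl_quotient_iff:
  assumes I: "ideal I R" and U: "U \<subseteq> carrier R" and a: "a \<in> carrier R"
  shows "I +> a \<in> Idl\<^bsub>R Quot I\<^esub> ((+>) I ` U) \<longleftrightarrow> a \<in> Idl (I \<union> U)"
proof -
  interpret I: ideal I R by (rule I)
  interpret Q: ring "R Quot I" by (rule I.quotient_is_ring)
  interpret h: ring_hom_ring R "R Quot I" "(+>) I" by (rule I.rcos_ring_hom_ring)
  have IU: "I \<union> U \<subseteq> carrier R" using I.a_subset U by auto
  let ?J = "Idl (I \<union> U)"
  have J: "ideal ?J R" by (rule genideal_ideal[OF IU])
  have sub: "I \<union> U \<subseteq> ?J" by (rule genideal_self[OF IU])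
  have imU: "(+>) I ` U \<subseteq> carrier (R Quot I)" using U by auto
  show ?thesis
  proof
    assume *: "I +> a \<in> Idl\<^bsub>R Quot I\<^esub> ((+>) I ` U)"
    have imJ: "ideal ((+>) I ` ?J) (R Quot I)" by (rule ring_ideal_imp_quot_ideal[OF I J])
    have "Idl\<^bsub>R Quot I\<^esub> ((+>) I ` U) \<subseteq> (+>) I ` ?J"
      by (rule Q.genideal_minimal[OF imJ]) (use sub in auto)
    with * have "I +> a \<in> (+>) I ` ?J" by auto
    then show "a \<in> ?J" using coset_mem_image_iff[OF I J _ a] sub by blast
  next
    assume "a \<in> ?J"
    moreover have "ideal {r \<in> carrier R. I +> r \<in> Idl\<^bsub>R Quot I\<^esub> ((+>) I ` U)} R"
      by (rule h.ideal_vimage[OF Q.genideal_ideal[OF imU]])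
    moreover have "I \<union> U \<subseteq> {r \<in> carrier R. I +> r \<in> Idl\<^bsub>R Quot I\<^esub> ((+>) I ` U)}"
    proof
      fix r assume r: "r \<in> I \<union> U"
      have "I +> r \<in> Idl\<^bsub>R Quot I\<^esub> ((+>) I ` U)"
      proof (cases "r \<in> I")
        case True
        then show ?thesis
          by (metis coset_eq_zero[OF I] Q.genideal_ideal[OF imU] additive_subgroup.zero_closed ideal.axioms(1))
      next
        case False
        then show ?thesis using r Q.genideal_self[OF imU] by auto
      qed
      then show "r \<in> {r \<in> carrier R. I +> r \<in> Idl\<^bsub>R Quot I\<^esub> ((+>) I ` U)}" using r IU by auto
    qed
    ultimately have "a \<in> {r \<in> carrier R. I +> r \<in> Idl\<^bsub>R Quot I\<^esub> ((+>) I ` U)}"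
      by (meson genideal_minimal subsetD)
    then show "I +> a \<in> Idl\<^bsub>R Quot I\<^esub> ((+>) I ` U)" by simp
  qed
qed

lemma carrier_quotient: "carrier (R Quot I) = (+>) I ` carrier R"
  by (auto simp: FactRing_def A_RCOSETS_def')

lemma regular_sequence_quotient_iff:
  assumes I: "ideal I R" and fs: "set fs \<subseteq> carrier R"
  shows "regular_sequence (R Quot I) (map ((+>) I) fs) \<longleftrightarrow>
    (\<forall>j < length fs. \<forall>a \<in> carrier R.
       fs ! j \<otimes> a \<in> Idl (I \<union> set (take j fs)) \<longrightarrow> a \<in> Idl (I \<union> set (take j fs))) \<and>
    Idl (I \<union> set fs) \<noteq> carrier R"
proof -
  interpret I: ideal I R by (rule I)
  interpret Q: ring "R Quot I" by (rule I.quotient_is_ring)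
  interpret h: ring_hom_ring R "R Quot I" "(+>) I" by (rule I.rcos_ring_hom_ring)
  have take: "set (take j (map ((+>) I) fs)) = (+>) I ` set (take j fs)" for j
    by (simp add: take_map)
  have sub: "set (take j fs) \<subseteq> carrier R" for j using fs set_take_subset by fast
  have 1: "(map ((+>) I) fs ! j \<otimes>\<^bsub>R Quot I\<^esub> (I +> a) \<in> Idl\<^bsub>R Quot I\<^esub> (set (take j (map ((+>) I) fs)))
      \<longleftrightarrow> fs ! j \<otimes> a \<in> Idl (I \<union> set (take j fs)))"
    if "j < length fs" "a \<in> carrier R" for j a
  proof -
    have c: "fs ! j \<in> carrier R" using that fs by auto
    have "map ((+>) I) fs ! j \<otimes>\<^bsub>R Quot I\<^esub> (I +> a) = I +> (fs ! j \<otimes> a)"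
      using that c by simp
    then show ?thesis
      by (metis take mem_Idl_quotient_iff[OF I sub] m_closed[OF c that(2)])
  qed
  have 2: "(I +> a \<in> Idl\<^bsub>R Quot I\<^esub> (set (take j (map ((+>) I) fs)))) \<longleftrightarrow> a \<in> Idl (I \<union> set (take j fs))"
    if "a \<in> carrier R" for j a
    unfolding take using mem_Idl_quotient_iff[OF I sub] that by simp
  have imfs: "(+>) I ` set fs \<subseteq> carrier (R Quot I)" using fs by auto
  have IU: "I \<union> set fs \<subseteq> carrier R" using I.a_subset fs by auto
  have 3: "Idl\<^bsub>R Quot I\<^esub> (set (map ((+>) I) fs)) = carrier (R Quot I) \<longleftrightarrow> Idl (I \<union> set fs) = carrier R"
  proof -
    have "Idl\<^bsub>R Quot I\<^esub> (set (map ((+>) I) fs)) = carrier (R Quot I) \<longleftrightarrow>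
       (\<forall>a\<in>carrier R. I +> a \<in> Idl\<^bsub>R Quot I\<^esub> ((+>) I ` set fs))"
      unfolding set_map
    proof -
      have "Idl\<^bsub>R Quot I\<^esub> ((+>) I ` set fs) \<subseteq> carrier (R Quot I)"
        using Q.genideal_ideal[OF imfs] by (meson additive_subgroup.a_subset ideal.axioms(1))
      then show "Idl\<^bsub>R Quot I\<^esub> ((+>) I ` set fs) = carrier (R Quot I) \<longleftrightarrow>
       (\<forall>a\<in>carrier R. I +> a \<in> Idl\<^bsub>R Quot I\<^esub> ((+>) I ` set fs))"
        unfolding carrier_quotient by blast
    qed
    also have "\<dots> \<longleftrightarrow> (\<forall>a\<in>carrier R. a \<in> Idl (I \<union> set fs))"
      using mem_Idl_quotient_iff[OF I fs] by auto
    also have "\<dots> \<longleftrightarrow> Idl (I \<union> set fs) = carrier R"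
    proof -
      have "Idl (I \<union> set fs) \<subseteq> carrier R"
        using genideal_ideal[OF IU] by (meson additive_subgroup.a_subset ideal.axioms(1))
      then show ?thesis by blast
    qed
    finally show ?thesis .
  qed
  have 4: "(\<forall>A \<in> carrier (R Quot I). Q A) \<longleftrightarrow> (\<forall>a \<in> carrier R. Q (I +> a))" for Q
    by (auto simp: carrier_quotient)
  have 5: "set (map ((+>) I) fs) \<subseteq> carrier (R Quot I)" using imfs by simp
  show ?thesis
    unfolding regular_sequence_def 3 length_map 4
    using 5 1 2 by (auto simp del: set_map)
qed

lemma primeideal_quotient_image:
  assumes I: "ideal I R" and P: "primeideal P R" and sub: "I \<subseteq> P"
  shows "primeideal ((+>) I ` P) (R Quot I)"
proof -
  interpret I: ideal I R by (rule I)
  interpret P: primeideal P R by (rule P)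
  interpret Q: cring "R Quot I" by (rule I.quotient_is_cring) (rule is_cring)
  interpret h: ring_hom_ring R "R Quot I" "(+>) I" by (rule I.rcos_ring_hom_ring)
  have imP: "ideal ((+>) I ` P) (R Quot I)" by (rule ring_ideal_imp_quot_ideal[OF I P.is_ideal])
  have mem: "I +> a \<in> (+>) I ` P \<longleftrightarrow> a \<in> P" if "a \<in> carrier R" for a
    by (rule coset_mem_image_iff[OF I P.is_ideal sub that])
  show ?thesis
  proof (rule primeidealI[OF imP Q.is_cring])
    show "carrier (R Quot I) \<noteq> (+>) I ` P"
    proof
      assume "carrier (R Quot I) = (+>) I ` P"
      then have "a \<in> P" if "a \<in> carrier R" for a
        using mem[OF that] that unfolding carrier_quotient by (metis imageI)
      then show False using P.I_notcarr P.a_subset by blast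
    qed
    fix A B assume "A \<in> carrier (R Quot I)" "B \<in> carrier (R Quot I)" and AB: "A \<otimes>\<^bsub>R Quot I\<^esub> B \<in> (+>) I ` P"
    then obtain a b where ab: "a \<in> carrier R" "b \<in> carrier R" "A = I +> a" "B = I +> b"
      by (auto simp: carrier_quotient)
    then have "I +> (a \<otimes> b) \<in> (+>) I ` P" using AB by (metis h.hom_mult)
    then show "A \<in> (+>) I ` P \<or> B \<in> (+>) I ` P"
      using ab mem P.I_prime[of a b] m_closed[of a b] by metis
  qed
qed

lemma primeideal_quotient_vimage:
  assumes I: "ideal I R" and P: "primeideal P (R Quot I)"
  shows "primeideal {r \<in> carrier R. I +> r \<in> P} R"
proof -
  interpret I: ideal I R by (rule I)
  interpret P: primeideal P "R Quot I" by (rule P)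
  interpret h: ring_hom_ring R "R Quot I" "(+>) I" by (rule I.rcos_ring_hom_ring)
  show ?thesis
  proof (rule primeidealI[OF h.ideal_vimage[OF P.is_ideal] is_cring])
    show "carrier R \<noteq> {r \<in> carrier R. I +> r \<in> P}"
      using P.I_notcarr P.a_subset by (auto simp: carrier_quotient)
  qed (use P.I_prime in auto)
qed

text \<open>Taking preimages and taking images both turn strict chains of primes into strict chains of the same
  length; for images this uses that the primes contain \<open>I\<close>.\<close>

lemma krull_dim_quotient:
  assumes I: "ideal I R"
  shows "krull_dim (R Quot I) =
    (SUP Ps \<in> {Ps. Ps \<noteq> [] \<and> (\<forall>P \<in> set Ps. primeideal P R \<and> I \<subseteq> P) \<and> sorted_wrt (\<subset>) Ps}.
        enat (length Ps - 1))"
    (is "_ = (SUP Ps \<in> ?C. _)")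
proof -
  interpret I: ideal I R by (rule I)
  let ?D = "{Ps. Ps \<noteq> [] \<and> (\<forall>P \<in> set Ps. primeideal P (R Quot I)) \<and> sorted_wrt (\<subset>) Ps}"
  let ?pull = "\<lambda>P. {r \<in> carrier R. I +> r \<in> P}"
  have 1: "\<exists>Qs \<in> ?C. length Qs = length Ps" if "Ps \<in> ?D" for Ps
  proof (intro bexI[of _ "map ?pull Ps"])
    have sub: "I \<subseteq> ?pull P" if P: "primeideal P (R Quot I)" for P
    proof
      fix r assume r: "r \<in> I"
      have "I +> r = \<zero>\<^bsub>R Quot I\<^esub>" by (rule coset_eq_zero[OF I r])
      then show "r \<in> ?pull P"
        using r P additive_subgroup.zero_closed ideal.axioms(1) primeideal.axioms(1) by fastforce
    qed
    have mono: "?pull P \<subset> ?pull P'"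
      if "primeideal P (R Quot I)" "primeideal P' (R Quot I)" "P \<subset> P'" for P P'
    proof -
      have "P' \<subseteq> carrier (R Quot I)"
        using that(2) by (meson additive_subgroup.a_subset ideal.axioms(1) primeideal.axioms(1))
      with that(3) show ?thesis by (force simp: carrier_quotient)
    qed
    have "sorted_wrt (\<lambda>P P'. ?pull P \<subset> ?pull P') Ps"
      by (rule sorted_wrt_mono_rel[of _ "(\<subset>)"]) (use that mono in auto)
    then show "map ?pull Ps \<in> ?C"
      using that sub primeideal_quotient_vimage[OF I] by (auto simp: sorted_wrt_map)
  qed simp
  have 2: "\<exists>Qs \<in> ?D. length Qs = length Ps" if "Ps \<in> ?C" for Ps
  proof (intro bexI[of _ "map ((`) ((+>) I)) Ps"])
    have mono: "(+>) I ` P \<subset> (+>) I ` P'"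
      if "primeideal P R" "primeideal P' R" "P \<subset> P'" "I \<subseteq> P" for P P'
    proof -
      have id: "ideal P R" "ideal P' R" using that primeideal.axioms(1) by auto
      note H = that
      obtain x where x: "x \<in> P'" "x \<notin> P" using H(3) by blast
      have c: "x \<in> carrier R" using x(1) id(2) by (simp add: ideal.Icarr)
      have "I +> x \<notin> (+>) I ` P" using coset_mem_image_iff[OF I id(1) H(4) c] x by simp
      moreover have "I +> x \<in> (+>) I ` P'" using x by simp
      ultimately have "(+>) I ` P \<noteq> (+>) I ` P'" by metis
      then show ?thesis using H(3) by blast
    qed
    have "sorted_wrt (\<lambda>P P'. (+>) I ` P \<subset> (+>) I ` P') Ps"
      by (rule sorted_wrt_mono_rel[of _ "(\<subset>)"]) (use that mono in auto)
    then show "map ((`) ((+>) I)) Ps \<in> ?D"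
      using that primeideal_quotient_image[OF I] by (auto simp: sorted_wrt_map)
  qed simp
  show ?thesis
    unfolding krull_dim_def
  proof (rule SUP_eq)
    fix Ps assume "Ps \<in> ?D"
    then obtain Qs where Qs: "Qs \<in> ?C" "length Qs = length Ps" using 1 by blast
    show "\<exists>Qs\<in>?C. enat (length Ps - 1) \<le> enat (length Qs - 1)"
      by (rule bexI[OF _ Qs(1)]) (simp add: Qs(2))
  next
    fix Ps assume "Ps \<in> ?C"
    then obtain Qs where Qs: "Qs \<in> ?D" "length Qs = length Ps" using 2 by blast
    show "\<exists>Qs\<in>?D. enat (length Ps - 1) \<le> enat (length Qs - 1)"
      by (rule bexI[OF _ Qs(1)]) (simp add: Qs(2))
  qed
qed

end

section \<open>Polynomials and monomial ideals\<close>

abbreviation (input) keys :: "('a \<Rightarrow>\<^sub>0 'b::zero) \<Rightarrow> 'a set" where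
  "keys \<equiv> Poly_Mapping.keys"

abbreviation (input) lookup :: "('a \<Rightarrow>\<^sub>0 'b::zero) \<Rightarrow> 'a \<Rightarrow> 'b" where
  "lookup \<equiv> Poly_Mapping.lookup"

abbreviation (input) single :: "'a \<Rightarrow> 'b::zero \<Rightarrow> 'a \<Rightarrow>\<^sub>0 'b" where
  "single \<equiv> Poly_Mapping.single"

lemma mem_mpoly_carrier: "p \<in> carrier (mpoly_ring X) \<longleftrightarrow> (\<forall>m \<in> keys p. keys m \<subseteq> X)"
  by (simp add: mpoly_ring_def)

lemma mpoly_ring_simps [simp]:
  "p \<otimes>\<^bsub>mpoly_ring X\<^esub> q = p * q" "p \<oplus>\<^bsub>mpoly_ring X\<^esub> q = p + q"
  "\<zero>\<^bsub>mpoly_ring X\<^esub> = 0" "\<one>\<^bsub>mpoly_ring X\<^esub> = 1"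
  by (simp_all add: mpoly_ring_def)

lemma mpoly_carrier_0 [simp]: "0 \<in> carrier (mpoly_ring X)"
  and mpoly_carrier_1 [simp]: "1 \<in> carrier (mpoly_ring X)"
  by (simp_all add: mem_mpoly_carrier)

lemma mpoly_carrier_add: "p \<in> carrier (mpoly_ring X) \<Longrightarrow> q \<in> carrier (mpoly_ring X) \<Longrightarrow> p + q \<in> carrier (mpoly_ring X)"
  using ring.ring_simprules(1)[OF cring.axioms(1)[OF mpoly_ring_cring[of X]], of p q] by simp

lemma mpoly_carrier_mult: "p \<in> carrier (mpoly_ring X) \<Longrightarrow> q \<in> carrier (mpoly_ring X) \<Longrightarrow> p * q \<in> carrier (mpoly_ring X)"
  using ring.ring_simprules(5)[OF cring.axioms(1)[OF mpoly_ring_cring[of X]], of p q] by simp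

lemma mpoly_carrier_uminus: "p \<in> carrier (mpoly_ring X) \<Longrightarrow> - p \<in> carrier (mpoly_ring X)"
  by (simp add: mem_mpoly_carrier)

lemma mpoly_carrier_diff: "p \<in> carrier (mpoly_ring X) \<Longrightarrow> q \<in> carrier (mpoly_ring X) \<Longrightarrow> p - q \<in> carrier (mpoly_ring X)"
  using mpoly_carrier_add[of p X "- q"] mpoly_carrier_uminus[of q X] by simp

lemma mpoly_carrier_sum: "(\<And>i. i \<in> F \<Longrightarrow> f i \<in> carrier (mpoly_ring X)) \<Longrightarrow> (\<Sum>i\<in>F. f i) \<in> carrier (mpoly_ring X)"
  by (induction F rule: infinite_finite_induct) (simp_all add: mpoly_carrier_add)

lemma mpoly_carrier_power: "p \<in> carrier (mpoly_ring X) \<Longrightarrow> p ^ k \<in> carrier (mpoly_ring X)"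
  by (induction k) (simp_all add: mpoly_carrier_mult)

lemma mpoly_carrier_single: "keys m \<subseteq> X \<Longrightarrow> single m c \<in> carrier (mpoly_ring X)"
  by (simp add: mem_mpoly_carrier)

lemma mpoly_carrier_const [simp]: "single 0 c \<in> carrier (mpoly_ring X)"
  by (simp add: mem_mpoly_carrier)

lemma mpoly_carrier_var: "v \<in> X \<Longrightarrow> var v \<in> carrier (mpoly_ring X)"
  unfolding var_def by (rule mpoly_carrier_single) simp

lemma mpoly_idealI:
  assumes "A \<subseteq> carrier (mpoly_ring X)" "0 \<in> A"
    and "\<And>a b. a \<in> A \<Longrightarrow> b \<in> A \<Longrightarrow> a + b \<in> A"
    and m: "\<And>r a. r \<in> carrier (mpoly_ring X) \<Longrightarrow> a \<in> A \<Longrightarrow> r * a \<in> A"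
  shows "ideal A (mpoly_ring X :: ('v, 'k::field) mpoly ring)"
proof -
  let ?R = "mpoly_ring X :: ('v, 'k) mpoly ring"
  interpret cring ?R by (rule mpoly_ring_cring)
  have inv: "\<ominus>\<^bsub>?R\<^esub> a = - a" if "a \<in> A" for a
  proof -
    have "- a \<in> carrier ?R" "a \<in> carrier ?R" using that assms(1) mpoly_carrier_uminus by auto
    then show ?thesis using minus_equality[of "- a" a] by simp
  qed
  have neg: "- a \<in> A" if "a \<in> A" for a
    using m[of "- 1" a] that by (simp add: mpoly_carrier_uminus)
  show ?thesis
  proof (rule idealI)
    show "subgroup A (add_monoid ?R)"
      by (rule add.subgroupI) (use assms neg inv in \<open>auto simp: a_inv_def[symmetric]\<close>)
    show "a \<otimes>\<^bsub>?R\<^esub> x \<in> A" if "a \<in> A" "x \<in> carrier ?R" for a x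
      using m[OF that(2,1)] by (simp add: mult.commute)
  qed (use m in \<open>auto intro: ring_axioms\<close>)
qed

context
  fixes A :: "('v, 'k::field) mpoly set" and X
  assumes A: "ideal A (mpoly_ring X)"
begin

lemma mpoly_ideal_subset: "a \<in> A \<Longrightarrow> a \<in> carrier (mpoly_ring X)"
  using A by (rule ideal.Icarr)

lemma mpoly_ideal_0: "0 \<in> A"
  using additive_subgroup.zero_closed[OF ideal.axioms(1)[OF A]] by simp

lemma mpoly_ideal_add: "a \<in> A \<Longrightarrow> b \<in> A \<Longrightarrow> a + b \<in> A"
  using additive_subgroup.a_closed[OF ideal.axioms(1)[OF A], of a b] by simp

lemma mpoly_ideal_mult: "r \<in> carrier (mpoly_ring X) \<Longrightarrow> a \<in> A \<Longrightarrow> r * a \<in> A"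
  using ideal.I_l_closed[OF A, of a r] by simp

lemma mpoly_ideal_uminus: "a \<in> A \<Longrightarrow> - a \<in> A"
  using mpoly_ideal_mult[of "- 1" a] by (simp add: mpoly_carrier_uminus)

lemma mpoly_ideal_diff: "a \<in> A \<Longrightarrow> b \<in> A \<Longrightarrow> a - b \<in> A"
  using mpoly_ideal_add[of a "- b"] mpoly_ideal_uminus[of b] by simp

lemma mpoly_ideal_sum: "(\<And>i. i \<in> F \<Longrightarrow> f i \<in> A) \<Longrightarrow> (\<Sum>i\<in>F. f i) \<in> A"
proof (induction F rule: infinite_finite_induct)
  case (insert x F)
  have "f x + (\<Sum>i\<in>F. f i) \<in> A" by (rule mpoly_ideal_add) (use insert in blast)+
  then show ?case using insert.hyps by simp
qed (use mpoly_ideal_0 in simp_all)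

end

lemma mpoly_sum_monomials:
  "p = (\<Sum>m \<in> keys p. single m (lookup p m))"
proof (rule poly_mapping_eqI)
  fix k
  show "lookup p k = lookup (\<Sum>m \<in> keys p. single m (lookup p m)) k"
    by (simp add: lookup_sum lookup_single when_def in_keys_iff)
qed

lemma lookup_single_times:
  fixes p :: "('v, 'k::field) mpoly"
  shows "lookup (single m c * p) (m + k) = c * lookup p k"
  by (simp add: lookup_mult lookup_single when_mult)

lemma keys_single_times:
  fixes p :: "('v, 'k::field) mpoly"
  shows "keys (single m c * p) \<subseteq> (+) m ` keys p"
  using keys_mult[of "single m c" p] by (auto split: if_splits)

lemma keys_plus_nat: "keys (a + b :: 'v \<Rightarrow>\<^sub>0 nat) = keys a \<union> keys b"
  by (auto simp: in_keys_iff lookup_add)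

text \<open>Used for sets \<open>M\<close> of exponents that are closed under adding arbitrary exponents; then this is the
  ideal spanned by the monomials with exponent in \<open>M\<close>.\<close>

definition monomial_ideal :: "'v set \<Rightarrow> ('v \<Rightarrow>\<^sub>0 nat) set \<Rightarrow> ('v, 'k::field) mpoly set" where
  "monomial_ideal X M = {p \<in> carrier (mpoly_ring X). keys p \<subseteq> M}"

lemma monomial_ideal_ideal:
  assumes "\<And>m m'. m \<in> M \<Longrightarrow> m' + m \<in> M"
  shows "ideal (monomial_ideal X M :: ('v, 'k::field) mpoly set) (mpoly_ring X)"
proof (rule mpoly_idealI)
  show "a + b \<in> monomial_ideal X M"
    if "a \<in> monomial_ideal X M" "b \<in> monomial_ideal X M" for a b :: "('v, 'k) mpoly"
    using that Poly_Mapping.keys_add[of a b] by (auto simp: monomial_ideal_def mpoly_carrier_add)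
  show "r * a \<in> monomial_ideal X M"
    if "r \<in> carrier (mpoly_ring X)" "a \<in> monomial_ideal X M" for r a :: "('v, 'k) mpoly"
    using that keys_mult[of r a] assms by (fastforce simp: monomial_ideal_def mpoly_carrier_mult)
qed (auto simp: monomial_ideal_def)

lemma monomial_ideal_subset:
  fixes A :: "('v, 'k::field) mpoly set"
  assumes A: "ideal A (mpoly_ring X)"
    and M: "\<And>m. m \<in> M \<Longrightarrow> keys m \<subseteq> X \<Longrightarrow> single m 1 \<in> A"
  shows "monomial_ideal X M \<subseteq> A"
proof
  fix p :: "('v, 'k) mpoly" assume p: "p \<in> monomial_ideal X M"
  have "(\<Sum>m \<in> keys p. single m (lookup p m)) \<in> A"
  proof (rule mpoly_ideal_sum[OF A])
    fix m assume m: "m \<in> keys p"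
    have "single 0 (lookup p m) * single m 1 \<in> A"
      by (rule mpoly_ideal_mult[OF A], simp, rule M)
        (use m p in \<open>auto simp: monomial_ideal_def mem_mpoly_carrier\<close>)
    then show "single m (lookup p m) \<in> A"
      by (simp add: mult_single)
  qed
  then show "p \<in> A" using mpoly_sum_monomials[of p] by simp
qed

text \<open>The exponent of the squarefree monomial with support \<open>e\<close>.\<close>

definition sqfree_exponent :: "'v set \<Rightarrow> 'v \<Rightarrow>\<^sub>0 nat" where
  "sqfree_exponent e = (\<Sum>v\<in>e. single v 1)"

lemma lookup_sqfree_exponent:
  "finite e \<Longrightarrow> lookup (sqfree_exponent e) v = (if v \<in> e then 1 else 0)"
  by (simp add: sqfree_exponent_def lookup_sum lookup_single when_def)

lemma keys_sqfree_exponent: "finite e \<Longrightarrow> keys (sqfree_exponent e) = e"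
  by (auto simp: in_keys_iff lookup_sqfree_exponent split: if_splits)

lemma prod_var: "(\<Prod>v\<in>e. var v) = single (sqfree_exponent e) 1"
  unfolding sqfree_exponent_def
  by (induction e rule: infinite_finite_induct) (simp_all add: var_def mult_single)

lemma le_imp_add_nat:
  fixes a b :: "'v \<Rightarrow>\<^sub>0 nat"
  assumes "\<And>v. lookup a v \<le> lookup b v"
  shows "(b - a) + a = b"
  by (rule poly_mapping_eqI) (simp add: lookup_add lookup_minus assms)

text \<open>The exponents of the monomials in the ideal generated by the edges.\<close>

definition edge_multiples :: "'v set set \<Rightarrow> ('v \<Rightarrow>\<^sub>0 nat) set" where
  "edge_multiples E = {m. \<exists>e\<in>E. e \<subseteq> keys m}"

lemma edge_multiples_ideal: "ideal (monomial_ideal X (edge_multiples E) :: ('v, 'k::field) mpoly set) (mpoly_ring X)"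
  by (rule monomial_ideal_ideal) (auto simp: edge_multiples_def keys_plus_nat)

lemma edge_ideal_eq:
  assumes fin: "\<And>e. e \<in> edges H \<Longrightarrow> finite e \<and> e \<subseteq> verts H"
  shows "edge_ideal H = (monomial_ideal (verts H) (edge_multiples (edges H)) :: ('v, 'k::field) mpoly set)"
proof
  let ?R = "mpoly_ring (verts H) :: ('v, 'k) mpoly ring"
  let ?J = "monomial_ideal (verts H) (edge_multiples (edges H)) :: ('v, 'k) mpoly set"
  let ?G = "(\<lambda>e. \<Prod>v \<in> e. var v) ` edges H :: ('v, 'k) mpoly set"
  interpret cring ?R by (rule mpoly_ring_cring)
  have G: "?G \<subseteq> carrier ?R"
    using fin by (auto simp: prod_var intro!: mpoly_carrier_single dest: keys_sqfree_exponent)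
  have I: "ideal (edge_ideal H) ?R" unfolding edge_ideal_def by (rule genideal_ideal[OF G])
  have J: "ideal ?J ?R"
    by (rule monomial_ideal_ideal) (auto simp: edge_multiples_def keys_plus_nat)
  have "?G \<subseteq> ?J"
    using G fin by (auto simp: prod_var monomial_ideal_def edge_multiples_def keys_sqfree_exponent)
  then show "edge_ideal H \<subseteq> ?J" unfolding edge_ideal_def by (rule genideal_minimal[OF J])
  show "?J \<subseteq> edge_ideal H"
  proof (rule monomial_ideal_subset[OF I])
    fix m assume m: "m \<in> edge_multiples (edges H)" and X: "keys m \<subseteq> verts H"
    then obtain e where e: "e \<in> edges H" "e \<subseteq> keys m" by (auto simp: edge_multiples_def)
    let ?e = "sqfree_exponent e"
    have "lookup ?e v \<le> lookup m v" for v
      using e fin[OF e(1)] by (auto simp: lookup_sqfree_exponent in_keys_iff Suc_le_eq)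
    then have eq: "(m - ?e) + ?e = m" by (rule le_imp_add_nat)
    have "single ?e (1::'k) \<in> edge_ideal H"
      unfolding edge_ideal_def prod_var[symmetric]
      by (rule subsetD[OF genideal_self[OF G]]) (rule imageI[OF e(1)])
    moreover have "keys (m - ?e) \<subseteq> verts H"
      using X keys_plus_nat[of "m - ?e" ?e] eq by auto
    ultimately have "single (m - ?e) 1 * single ?e (1::'k) \<in> edge_ideal H"
      by (intro mpoly_ideal_mult[OF I] mpoly_carrier_single)
    then show "single m (1::'k) \<in> edge_ideal H"
      using eq by (simp add: mult_single)
  qed
qed

section \<open>Primes generated by variables and the dimension from below\<close>

text \<open>The ideal generated by the variables in \<open>C\<close>.\<close>

definition variable_prime :: "'v set \<Rightarrow> 'v set \<Rightarrow> ('v, 'k::field) mpoly set" where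
  "variable_prime X C = monomial_ideal X {m. keys m \<inter> C \<noteq> {}}"

text \<open>Modulo this ideal every polynomial is represented by one whose monomials avoid \<open>C\<close>. Products of
  such representatives again avoid \<open>C\<close>, so primality reduces to the absence of zero divisors in the
  polynomial ring.\<close>

lemma variable_prime_prime:
  "primeideal (variable_prime X C) (mpoly_ring X :: ('v::linorder, 'k::field) mpoly ring)"
proof (rule primeidealI)
  let ?R = "mpoly_ring X :: ('v, 'k) mpoly ring"
  let ?P = "variable_prime X C :: ('v, 'k) mpoly set"
  show P: "ideal ?P ?R"
    unfolding variable_prime_def by (rule monomial_ideal_ideal) (auto simp: keys_plus_nat)
  show "cring ?R" by (rule mpoly_ring_cring)
  show "carrier ?R \<noteq> ?P"
  proof
    assume "carrier ?R = ?P"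
    then have "1 \<in> ?P" using mpoly_carrier_1[of X] by metis
    then show False by (simp add: variable_prime_def monomial_ideal_def)
  qed
  have split: "\<exists>p0 p1. p = p0 + p1 \<and> p0 \<in> carrier ?R \<and> p1 \<in> ?P \<and> (\<forall>m \<in> keys p0. keys m \<inter> C = {})"
    if p: "p \<in> carrier ?R" for p
  proof -
    let ?s = "\<lambda>M. \<Sum>m\<in>M. single m (lookup p m)"
    let ?K0 = "{m \<in> keys p. keys m \<inter> C = {}}"
    let ?K1 = "{m \<in> keys p. keys m \<inter> C \<noteq> {}}"
    have keys: "keys (?s M) \<subseteq> M" for M
      using keys_sum[of "\<lambda>m. single m (lookup p m)" M]
      by (auto split: if_splits)
    have "?s (keys p) = ?s ?K0 + ?s ?K1"
      by (subst sum.union_disjoint[symmetric]) (auto intro!: sum.cong)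
    then have "p = ?s ?K0 + ?s ?K1" using mpoly_sum_monomials[of p] by simp
    moreover have "?s ?K0 \<in> carrier ?R" "?s ?K1 \<in> carrier ?R"
      by (rule mpoly_carrier_sum, rule mpoly_carrier_single, use p in \<open>simp add: mem_mpoly_carrier\<close>)+
    moreover have "\<forall>m \<in> keys (?s ?K0). keys m \<inter> C = {}"
      using keys[of ?K0] by auto
    moreover have "keys (?s ?K1) \<subseteq> {m. keys m \<inter> C \<noteq> {}}"
      using keys[of ?K1] by auto
    ultimately show ?thesis unfolding variable_prime_def monomial_ideal_def by blast
  qed
  fix a b assume a: "a \<in> carrier ?R" and b: "b \<in> carrier ?R" and ab: "a \<otimes>\<^bsub>?R\<^esub> b \<in> ?P"
  obtain a0 a1 where a': "a = a0 + a1" "a0 \<in> carrier ?R" "a1 \<in> ?P"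
      "\<forall>m \<in> keys a0. keys m \<inter> C = {}" using split[OF a] by blast
  obtain b0 b1 where b': "b = b0 + b1" "b0 \<in> carrier ?R" "b1 \<in> ?P"
      "\<forall>m \<in> keys b0. keys m \<inter> C = {}" using split[OF b] by blast
  have "a0 * b0 = a * b - (a0 * b1 + b * a1)"
    unfolding a'(1) b'(1) by (simp add: algebra_simps)
  also have "\<dots> \<in> ?P"
    using mpoly_ideal_diff[OF P] mpoly_ideal_add[OF P] mpoly_ideal_mult[OF P a'(2) b'(3)]
      mpoly_ideal_mult[OF P b a'(3)] ab by simp
  finally have "a0 * b0 \<in> ?P" .
  moreover have "keys m \<inter> C = {}" if m: "m \<in> keys (a0 * b0)" for m
  proof -
    obtain k l where "m = k + l" "k \<in> keys a0" "l \<in> keys b0"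
      using m keys_mult[of a0 b0] by blast
    then show ?thesis using a'(4) b'(4) by (auto simp: keys_plus_nat)
  qed
  ultimately have "keys (a0 * b0) = {}"
    unfolding variable_prime_def monomial_ideal_def by blast
  then have "a0 = 0 \<or> b0 = 0" by simp
  then show "a \<in> ?P \<or> b \<in> ?P" using a' b' by auto
qed

lemma variable_prime_subset:
  fixes A :: "('v, 'k::field) mpoly set"
  assumes A: "ideal A (mpoly_ring X)" and C: "\<And>v. v \<in> C \<Longrightarrow> var v \<in> A"
  shows "variable_prime X C \<subseteq> A"
  unfolding variable_prime_def
proof (rule monomial_ideal_subset[OF A])
  fix m :: "'v \<Rightarrow>\<^sub>0 nat"
  assume "m \<in> {m. keys m \<inter> C \<noteq> {}}" and X: "keys m \<subseteq> X"
  then obtain v where v: "v \<in> keys m" "v \<in> C" by blast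
  have eq: "(m - single v 1) + single v 1 = m"
    by (rule le_imp_add_nat) (use v in \<open>auto simp: lookup_single when_def in_keys_iff\<close>)
  have "keys (m - single v 1) \<subseteq> X"
    using X keys_plus_nat[of "m - single v 1" "single v 1"] eq by auto
  then have "single (m - single v 1) 1 * var v \<in> A"
    by (intro mpoly_ideal_mult[OF A] mpoly_carrier_single C v)
  then show "single m (1::'k) \<in> A" using eq by (simp add: var_def mult_single)
qed

text \<open>Adjoining the variables outside \<open>C\<close> one at a time produces a strict chain of primes.\<close>

lemma krull_dim_quotient_ge:
  fixes I :: "('v::linorder, 'k::field) mpoly set"
  assumes X: "finite X" and C: "C \<subseteq> X" and I: "ideal I (mpoly_ring X)"
    and sub: "I \<subseteq> variable_prime X C"
  shows "krull_dim (mpoly_ring X Quot I) \<ge> enat (card X - card C)"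
proof -
  let ?P = "\<lambda>C. variable_prime X C :: ('v, 'k) mpoly set"
  obtain vs where vs: "set vs = X - C" "distinct vs"
    using finite_distinct_list[of "X - C"] X by auto
  have len: "length vs = card X - card C"
    using vs C X by (metis card_Diff_subset distinct_card finite_subset)
  let ?Ps = "map (\<lambda>k. ?P (C \<union> set (take k vs))) [0..<Suc (length vs)]"
  have strict: "?P (C \<union> set (take k vs)) \<subset> ?P (C \<union> set (take l vs))"
    if "k < l" "l < Suc (length vs)" for k l
  proof
    have "set (take k vs) \<subseteq> set (take l vs)" using that by (simp add: set_take_subset_set_take)
    then show "?P (C \<union> set (take k vs)) \<subseteq> ?P (C \<union> set (take l vs))"
      unfolding variable_prime_def monomial_ideal_def by blast
    let ?v = "vs ! k"
    have v: "?v \<in> X - C"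
      unfolding vs(1)[symmetric] by (rule nth_mem) (use that in linarith)
    have "?v \<in> set (take l vs)" using that by (auto simp: in_set_conv_nth intro!: exI[of _ k])
    then have "var ?v \<in> ?P (C \<union> set (take l vs))"
      using v by (auto simp: variable_prime_def monomial_ideal_def mpoly_carrier_var) (auto simp: var_def)
    moreover have "?v \<notin> set (take k vs)"
      using that vs(2) by (auto simp: in_set_conv_nth nth_eq_iff_index_eq)
    then have "var ?v \<notin> ?P (C \<union> set (take k vs))"
      using v by (auto simp: variable_prime_def monomial_ideal_def var_def)
    ultimately show "?P (C \<union> set (take k vs)) \<noteq> ?P (C \<union> set (take l vs))" by metis
  qed
  have 1: "sorted_wrt (\<subset>) ?Ps"
    by (auto simp del: upt_Suc simp: sorted_wrt_iff_nth_less strict)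
  have 2: "primeideal P (mpoly_ring X) \<and> I \<subseteq> P" if "P \<in> set ?Ps" for P
  proof -
    obtain k where "P = ?P (C \<union> set (take k vs))"
      using \<open>P \<in> set ?Ps\<close> by (auto simp del: upt_Suc)
    moreover have "?P C \<subseteq> ?P (C \<union> set (take k vs))"
      unfolding variable_prime_def monomial_ideal_def by blast
    ultimately show ?thesis using sub variable_prime_prime by blast
  qed
  have 3: "?Ps \<noteq> []" by simp
  have "enat (length ?Ps - 1) \<le> krull_dim (mpoly_ring X Quot I)"
    unfolding cring.krull_dim_quotient[OF mpoly_ring_cring I]
    using 1 2 3 by (intro SUP_upper) blast
  then show ?thesis using len by simp
qed

section \<open>Total degree and principal edge ideals\<close>

definition total_degree :: "('v \<Rightarrow>\<^sub>0 nat) \<Rightarrow> nat" where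
  "total_degree m = (\<Sum>v \<in> keys m. lookup m v)"

lemma total_degree_add: "total_degree (a + b) = total_degree a + total_degree b"
  unfolding total_degree_def by (rule setsum_keys_plus_distrib) auto

lemma total_degree_eq_0_iff: "total_degree m = 0 \<longleftrightarrow> m = 0"
proof
  assume "total_degree m = 0"
  then show "m = 0" by (intro poly_mapping_eqI) (auto simp: total_degree_def in_keys_iff)
qed (simp add: total_degree_def)

lemma total_degree_sqfree_exponent: "finite e \<Longrightarrow> total_degree (sqfree_exponent e) = card e"
  by (simp add: total_degree_def keys_sqfree_exponent lookup_sqfree_exponent)

lemma card_keys_le_total_degree: "card (keys m) \<le> total_degree m"
  unfolding total_degree_def card_eq_sum by (rule sum_mono) (auto simp: in_keys_iff Suc_le_eq)

lemma total_degree_edge_multiple: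
  assumes "\<And>e. e \<in> E \<Longrightarrow> finite e \<and> card e = d" and "m \<in> edge_multiples E"
  shows "d \<le> total_degree m"
proof -
  obtain e where e: "e \<in> E" "e \<subseteq> keys m" using assms(2) by (auto simp: edge_multiples_def)
  have "d \<le> card (keys m)" using assms(1)[OF e(1)] card_mono[OF _ e(2)] by simp
  also have "\<dots> \<le> total_degree m" by (rule card_keys_le_total_degree)
  finally show ?thesis .
qed

text \<open>If \<open>f\<close> has no terms of degree below that of \<open>m\<close>, then only the constant term of the cofactor can
  contribute to the coefficient at \<open>m\<close>.\<close>

lemma lookup_times_lowest_degree:
  fixes r f :: "('v, 'k::field) mpoly"
  assumes f: "\<And>k. k \<in> keys f \<Longrightarrow> total_degree m \<le> total_degree k"
  shows "lookup (r * f) m = lookup r 0 * lookup f m"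
proof -
  let ?c = "single 0 (lookup r 0)"
  have "m \<notin> keys ((r - ?c) * f)"
  proof
    assume "m \<in> keys ((r - ?c) * f)"
    then obtain a b where ab: "m = a + b" "a \<in> keys (r - ?c)" "b \<in> keys f"
      using keys_mult[of "r - ?c" f] by blast
    have "a \<noteq> 0" using ab(2) by (auto simp: in_keys_iff lookup_minus)
    then have "total_degree a > 0" using total_degree_eq_0_iff[of a] by simp
    moreover have "total_degree m = total_degree a + total_degree b" using ab(1) by (simp add: total_degree_add)
    ultimately show False using f[OF ab(3)] by simp
  qed
  then have "lookup ((r - ?c) * f) m = 0" by (simp add: in_keys_iff)
  then have "lookup (r * f) m = lookup (?c * f) m"
    by (simp add: left_diff_distrib lookup_minus)
  also have "\<dots> = lookup r 0 * lookup f m"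
    using lookup_single_times[of 0 _ f m] by simp
  finally show ?thesis .
qed

text \<open>A generator \<open>f\<close> has no terms of degree below \<open>d\<close>, so the part of degree \<open>d\<close> of any multiple of \<open>f\<close> is
  a scalar multiple of that of \<open>f\<close>. Two different monomials cannot both have this form.\<close>

lemma principal_edge_ideal_imp_single_edge:
  fixes I :: "('v, 'k::field) mpoly set"
  assumes I: "I = monomial_ideal X (edge_multiples E)"
    and E: "\<And>e. e \<in> E \<Longrightarrow> finite e \<and> card e = d \<and> e \<subseteq> X"
    and pr: "principalideal I (mpoly_ring X)"
    and e: "e \<in> E" and e': "e' \<in> E"
  shows "e = e'"
proof (rule ccontr)
  assume ne: "e \<noteq> e'"
  let ?R = "mpoly_ring X :: ('v, 'k) mpoly ring"
  interpret cring ?R by (rule mpoly_ring_cring)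
  obtain f where f: "f \<in> carrier ?R" "I = Idl\<^bsub>?R\<^esub> {f}"
    using pr principalideal.generate by blast
  then have "I = PIdl\<^bsub>?R\<^esub> f" by (simp add: cgenideal_eq_genideal)
  then have rf: "\<exists>r. p = r * f" if "p \<in> I" for p
    using that by (auto simp: cgenideal_def)
  have "f \<in> I" unfolding f(2) using genideal_self'[OF f(1)] .
  then have deg: "d \<le> total_degree k" if "k \<in> keys f" for k
    using that total_degree_edge_multiple[of E d] E by (auto simp: I monomial_ideal_def)
  have mem: "single (sqfree_exponent x) 1 \<in> I" if "x \<in> E" for x
    unfolding I monomial_ideal_def
    using E[OF that] that by (auto simp: edge_multiples_def keys_sqfree_exponent intro!: mpoly_carrier_single)
  obtain r r' where r: "single (sqfree_exponent e) 1 = r * f"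
     and r': "single (sqfree_exponent e') 1 = r' * f"
    using rf mem e e' by metis
  have low: "lookup (q * f) (sqfree_exponent x) = lookup q 0 * lookup f (sqfree_exponent x)"
    if "x \<in> E" for q x
    by (rule lookup_times_lowest_degree) (use deg E[OF that] in \<open>simp add: total_degree_sqfree_exponent\<close>)
  have "sqfree_exponent e \<noteq> sqfree_exponent e'"
    using ne keys_sqfree_exponent E e e' by metis
  then have "lookup r 0 * lookup f (sqfree_exponent e') = 0"
    using low[OF e', of r] r[symmetric] by (simp add: lookup_single)
  moreover have "lookup r 0 \<noteq> 0"
    using low[OF e, of r] r[symmetric] by auto
  moreover have "lookup f (sqfree_exponent e') \<noteq> 0"
    using low[OF e', of r'] r'[symmetric] by auto
  ultimately show False by simp
qed

section \<open>Koszul homology and the depth from above\<close>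

text \<open>The Koszul complex of a family \<open>x\<close> has basis vectors \<open>e\<^sub>T\<close>, for \<open>T \<subseteq> X\<close>; a chain is encoded by its
  coefficient function \<open>z\<close> on subsets. The sign is that of \<open>e\<^sub>v \<and> e\<^sub>T\<close> relative to the basis vector of
  \<open>insert v T\<close> with the factors in increasing order.\<close>

definition koszul_sign :: "'v::linorder \<Rightarrow> 'v set \<Rightarrow> 'a::comm_ring_1" where
  "koszul_sign v T = (- 1) ^ card {w \<in> T. w < v}"

definition koszul_diff :: "'v::linorder set \<Rightarrow> ('v \<Rightarrow> 'a) \<Rightarrow> ('v set \<Rightarrow> 'a) \<Rightarrow> 'v set \<Rightarrow> 'a::comm_ring_1" where
  "koszul_diff X x z T = (\<Sum>v\<in>X - T. koszul_sign v T * x v * z (insert v T))"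

text \<open>Exterior multiplication by \<open>\<Sum>\<^sub>v b\<^sub>v e\<^sub>v\<close>.\<close>

definition koszul_wedge :: "('v::linorder \<Rightarrow> 'a) \<Rightarrow> ('v set \<Rightarrow> 'a) \<Rightarrow> 'v set \<Rightarrow> 'a::comm_ring_1" where
  "koszul_wedge b z T = (\<Sum>v\<in>T. koszul_sign v (T - {v}) * b v * z (T - {v}))"

lemma koszul_sign_insert:
  assumes "finite T" "w \<notin> T"
  shows "(koszul_sign v (insert w T) :: 'a::comm_ring_1) = (if w < v then - koszul_sign v T else koszul_sign v T)"
proof -
  have "{u \<in> insert w T. u < v} = (if w < v then insert w {u \<in> T. u < v} else {u \<in> T. u < v})" by auto
  then show ?thesis using assms by (simp add: koszul_sign_def)
qed

lemma koszul_sign_square: "koszul_sign v T * koszul_sign v T = (1 :: 'a::comm_ring_1)"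
  by (simp add: koszul_sign_def flip: power_add)

text \<open>The terms at \<open>(v, w)\<close> and \<open>(w, v)\<close> cancel. Induction on \<open>Y\<close> avoids a division by two, so every
  characteristic is covered.\<close>

lemma antisymmetric_sum_eq_0:
  fixes F :: "'v \<Rightarrow> 'v \<Rightarrow> 'a::ab_group_add"
  assumes "finite Y" and "\<And>v w. v \<in> Y \<Longrightarrow> w \<in> Y \<Longrightarrow> v \<noteq> w \<Longrightarrow> F w v = - F v w"
  shows "(\<Sum>v\<in>Y. \<Sum>w\<in>Y - {v}. F v w) = 0"
  using assms
proof (induction Y rule: finite_induct)
  case (insert a Y)
  have "(\<Sum>w\<in>insert a Y - {v}. F v w) = F v a + (\<Sum>w\<in>Y - {v}. F v w)" if v: "v \<in> Y" for v
  proof -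
    have "insert a Y - {v} = insert a (Y - {v})" using insert.hyps v by auto
    then show ?thesis using insert.hyps by simp
  qed
  then have "(\<Sum>v\<in>Y. \<Sum>w\<in>insert a Y - {v}. F v w) = (\<Sum>v\<in>Y. F v a) + (\<Sum>v\<in>Y. \<Sum>w\<in>Y - {v}. F v w)"
    by (simp add: sum.distrib)
  also have "(\<Sum>v\<in>Y. \<Sum>w\<in>Y - {v}. F v w) = 0"
    by (rule insert.IH) (rule insert.prems, auto)
  also have "(\<Sum>v\<in>Y. F v a) = (\<Sum>v\<in>Y. - F a v)"
    by (rule sum.cong[OF refl], rule insert.prems) (use insert.hyps in auto)
  finally have *: "(\<Sum>v\<in>Y. \<Sum>w\<in>insert a Y - {v}. F v w) = - (\<Sum>v\<in>Y. F a v)"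
    by (simp add: sum_negf)
  have "insert a Y - {a} = Y" using insert.hyps by auto
  then show ?case using insert.hyps * by simp
qed simp

lemma koszul_diff_diff:
  assumes X: "finite X" and T: "T \<subseteq> X"
  shows "koszul_diff X x (koszul_diff X x z) T = 0"
proof -
  let ?F = "\<lambda>v w. koszul_sign v T * x v * (koszul_sign w (insert v T) * x w * z (insert w (insert v T)))"
  have fin: "finite T" using X T finite_subset by auto
  have "koszul_diff X x (koszul_diff X x z) T = (\<Sum>v\<in>X - T. \<Sum>w\<in>(X - T) - {v}. ?F v w)"
  proof -
    have "X - insert v T = (X - T) - {v}" for v by auto
    then show ?thesis by (simp add: koszul_diff_def sum_distrib_left)
  qed
  also have "\<dots> = 0"
  proof (rule antisymmetric_sum_eq_0)
    show "finite (X - T)" using X by simp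
    fix v w assume vw: "v \<in> X - T" "w \<in> X - T" "v \<noteq> w"
    show "?F w v = - ?F v w"
      using vw fin by (cases "v < w") (auto simp: koszul_sign_insert insert_commute)
  qed
  finally show ?thesis .
qed

text \<open>Multiplication by \<open>\<Sum>\<^sub>v b\<^sub>v x\<^sub>v\<close> is null-homotopic on the Koszul complex. The terms in which the same
  vertex is inserted and removed give the right-hand side; the mixed terms cancel in pairs because
  exchanging the two operations changes the sign.\<close>

lemma koszul_homotopy:
  assumes X: "finite X" and T: "T \<subseteq> X"
  shows "koszul_diff X x (koszul_wedge b z) T + koszul_wedge b (koszul_diff X x z) T
    = (\<Sum>v\<in>X. b v * x v) * z T"
proof -
  have fin: "finite T" using X T finite_subset by auto
  let ?G = "\<lambda>v w. x v * b w * z (insert v (T - {w}))"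
  let ?s = "koszul_sign :: 'a \<Rightarrow> 'a set \<Rightarrow> 'b"
  have 1: "?s v T * x v * koszul_wedge b z (insert v T) =
      b v * x v * z T + (\<Sum>w\<in>T. ?s v T * ?s w (insert v (T - {w})) * ?G v w)" if v: "v \<in> X - T" for v
  proof -
    have "koszul_wedge b z (insert v T) = ?s v T * b v * z T +
        (\<Sum>w\<in>T. ?s w (insert v T - {w}) * b w * z (insert v T - {w}))"
      unfolding koszul_wedge_def using v fin by simp
    also have "(\<Sum>w\<in>T. ?s w (insert v T - {w}) * b w * z (insert v T - {w}))
       = (\<Sum>w\<in>T. ?s w (insert v (T - {w})) * b w * z (insert v (T - {w})))"
      by (rule sum.cong) (use v in \<open>auto simp: insert_Diff_if\<close>)
    finally have "?s v T * x v * koszul_wedge b z (insert v T) = (?s v T * ?s v T) * (b v * x v * z T) +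
        (\<Sum>w\<in>T. ?s v T * ?s w (insert v (T - {w})) * ?G v w)"
      by (simp add: algebra_simps sum_distrib_left)
    then show ?thesis by (simp add: koszul_sign_square)
  qed
  have 2: "?s w (T - {w}) * b w * koszul_diff X x z (T - {w}) =
      b w * x w * z T + (\<Sum>v\<in>X - T. ?s w (T - {w}) * ?s v (T - {w}) * ?G v w)" if w: "w \<in> T" for w
  proof -
    have "X - (T - {w}) = insert w (X - T)" "insert w (T - {w}) = T" using w T by auto
    then have "koszul_diff X x z (T - {w}) = ?s w (T - {w}) * x w * z T +
        (\<Sum>v\<in>X - T. ?s v (T - {w}) * x v * z (insert v (T - {w})))"
      unfolding koszul_diff_def using w X by simp
    then have "?s w (T - {w}) * b w * koszul_diff X x z (T - {w}) = (?s w (T - {w}) * ?s w (T - {w})) * (b w * x w * z T) +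
        (\<Sum>v\<in>X - T. ?s w (T - {w}) * ?s v (T - {w}) * ?G v w)"
      by (simp add: algebra_simps sum_distrib_left)
    then show ?thesis by (simp add: koszul_sign_square)
  qed
  have 3: "?s v T * ?s w (insert v (T - {w})) + ?s w (T - {w}) * ?s v (T - {w}) = 0"
    if "v \<in> X - T" "w \<in> T" for v w
  proof -
    define U where "U = T - {w}"
    have U: "T = insert w U" "w \<notin> U" "finite U" "v \<notin> U" "v \<noteq> w" using that fin by (auto simp: U_def)
    show ?thesis unfolding U_def[symmetric] unfolding U(1)
      using U(2-5) by (cases "v < w") (auto simp: koszul_sign_insert)
  qed
  have "koszul_diff X x (koszul_wedge b z) T + koszul_wedge b (koszul_diff X x z) T =
      (\<Sum>v\<in>X - T. b v * x v * z T) + (\<Sum>w\<in>T. b w * x w * z T)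
      + ((\<Sum>v\<in>X - T. \<Sum>w\<in>T. ?s v T * ?s w (insert v (T - {w})) * ?G v w)
       + (\<Sum>w\<in>T. \<Sum>v\<in>X - T. ?s w (T - {w}) * ?s v (T - {w}) * ?G v w))"
    unfolding koszul_diff_def[of X x "koszul_wedge b z"] koszul_wedge_def[of b "koszul_diff X x z"]
    by (simp add: 1 2 sum.distrib)
  also have "(\<Sum>v\<in>X - T. \<Sum>w\<in>T. ?s v T * ?s w (insert v (T - {w})) * ?G v w)
       + (\<Sum>w\<in>T. \<Sum>v\<in>X - T. ?s w (T - {w}) * ?s v (T - {w}) * ?G v w)
      = (\<Sum>v\<in>X - T. \<Sum>w\<in>T. (?s v T * ?s w (insert v (T - {w})) + ?s w (T - {w}) * ?s v (T - {w})) * ?G v w)"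
    by (subst (2) sum.swap) (simp add: distrib_right flip: sum.distrib)
  also have "\<dots> = 0" by (simp add: 3)
  also have "(\<Sum>v\<in>X - T. b v * x v * z T) + (\<Sum>w\<in>T. b w * x w * z T) = (\<Sum>v\<in>X. b v * x v * z T)"
    using sum.subset_diff[OF T X, of "\<lambda>v. b v * x v * z T"] by simp
  finally show ?thesis by (simp add: sum_distrib_right)
qed

lemma koszul_diff_linear:
  "koszul_diff X x (\<lambda>T. c * z T + y T) T = c * koszul_diff X x z T + koszul_diff X x y T"
  unfolding koszul_diff_def by (simp add: distrib_left sum.distrib sum_distrib_left mult_ac)

abbreviation poly_koszul_diff :: "'v::linorder set \<Rightarrow> ('v set \<Rightarrow> ('v, 'k::field) mpoly) \<Rightarrow> 'v set \<Rightarrow> ('v, 'k) mpoly" where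
  "poly_koszul_diff X \<equiv> koszul_diff X var"

text \<open>The Koszul complex on the variables with coefficients in \<open>S/A\<close> has nonzero homology in degree \<open>i\<close>.
  Chains are given by representatives in \<open>S\<close>, so cycles and boundaries are understood modulo \<open>A\<close>. The
  bounding chain \<open>w\<close> may be inhomogeneous, which makes nonvanishing formally stronger.\<close>

definition koszul_homology_nonzero :: "'v::linorder set \<Rightarrow> ('v, 'k::field) mpoly set \<Rightarrow> nat \<Rightarrow> bool" where
  "koszul_homology_nonzero X A i \<longleftrightarrow>
     (\<exists>z. (\<forall>T. z T \<in> carrier (mpoly_ring X)) \<and> (\<forall>T. z T \<noteq> 0 \<longrightarrow> T \<subseteq> X \<and> card T = i) \<and>
        (\<forall>T \<subseteq> X. poly_koszul_diff X z T \<in> A) \<and>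
        \<not> (\<exists>w. (\<forall>T. w T \<in> carrier (mpoly_ring X)) \<and> (\<forall>T \<subseteq> X. z T - poly_koszul_diff X w T \<in> A)))"

lemma koszul_homology_nonzeroE:
  fixes A :: "('v::linorder, 'k::field) mpoly set"
  assumes "koszul_homology_nonzero X A i"
  obtains z where "\<And>T. z T \<in> carrier (mpoly_ring X)"
    and "\<And>T. z T \<noteq> 0 \<Longrightarrow> T \<subseteq> X \<and> card T = i"
    and "\<And>T. T \<subseteq> X \<Longrightarrow> poly_koszul_diff X z T \<in> A"
    and "\<And>w. (\<And>T. w T \<in> carrier (mpoly_ring X)) \<Longrightarrow> (\<And>T. T \<subseteq> X \<Longrightarrow> z T - poly_koszul_diff X w T \<in> A) \<Longrightarrow> False"
proof -
  obtain z where z: "(\<forall>T. z T \<in> carrier (mpoly_ring X)) \<and> (\<forall>T. z T \<noteq> 0 \<longrightarrow> T \<subseteq> X \<and> card T = i) \<and>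
        (\<forall>T \<subseteq> X. poly_koszul_diff X z T \<in> A) \<and>
        \<not> (\<exists>w. (\<forall>T. w T \<in> carrier (mpoly_ring X)) \<and> (\<forall>T \<subseteq> X. z T - poly_koszul_diff X w T \<in> A))"
    using assms unfolding koszul_homology_nonzero_def by (rule exE)
  show ?thesis
  proof (rule that[of z])
    show "False" if "\<And>T. w T \<in> carrier (mpoly_ring X)" "\<And>T. T \<subseteq> X \<Longrightarrow> z T - poly_koszul_diff X w T \<in> A" for w
      using conjunct2[OF conjunct2[OF conjunct2[OF z]]] that by metis
  qed (use z in simp_all)
qed

lemma koszul_sign_carrier: "koszul_sign v T \<in> carrier (mpoly_ring X)"
  unfolding koszul_sign_def by (intro mpoly_carrier_power mpoly_carrier_uminus mpoly_carrier_1)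

lemma koszul_diff_mem:
  assumes "ideal A (mpoly_ring X)" "\<And>v. v \<in> X - T \<Longrightarrow> z (insert v T) \<in> A"
  shows "poly_koszul_diff X z T \<in> A"
  unfolding koszul_diff_def
proof (rule mpoly_ideal_sum[OF assms(1)])
  fix v assume v: "v \<in> X - T"
  have "koszul_sign v T * var v \<in> carrier (mpoly_ring X)"
    by (rule mpoly_carrier_mult[OF koszul_sign_carrier mpoly_carrier_var]) (use v in simp)
  then show "koszul_sign v T * var v * z (insert v T) \<in> A"
    using assms(2)[OF v] by (rule mpoly_ideal_mult[OF assms(1)])
qed

lemma koszul_diff_carrier:
  assumes "\<And>T. z T \<in> carrier (mpoly_ring X)"
  shows "poly_koszul_diff X z T \<in> carrier (mpoly_ring X)"
  by (rule koszul_diff_mem[OF ring.oneideal[OF cring.axioms(1)[OF mpoly_ring_cring]]]) (rule assms)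

lemma koszul_wedge_mem:
  assumes "ideal A (mpoly_ring X)" "\<And>v. v \<in> T \<Longrightarrow> b v \<in> carrier (mpoly_ring X)" "\<And>v. v \<in> T \<Longrightarrow> z (T - {v}) \<in> A"
  shows "koszul_wedge b z T \<in> A"
  unfolding koszul_wedge_def
proof (rule mpoly_ideal_sum[OF assms(1)])
  fix v assume v: "v \<in> T"
  have "koszul_sign v (T - {v}) * b v \<in> carrier (mpoly_ring X)"
    by (rule mpoly_carrier_mult[OF koszul_sign_carrier assms(2)[OF v]])
  then show "koszul_sign v (T - {v}) * b v * z (T - {v}) \<in> A"
    using assms(3)[OF v] by (rule mpoly_ideal_mult[OF assms(1)])
qed

text \<open>Since \<open>f\<close> lies in the ideal of the variables, the homotopy shows that it annihilates Koszul
  homology: for a cycle \<open>z\<close> modulo \<open>A\<close>, the chain \<open>y = b \<and> z\<close> has boundary \<open>f z\<close> modulo \<open>A\<close>. Thus \<open>y\<close> is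
  a cycle modulo \<open>B = A + (f)\<close>. If \<open>y\<close> were a boundary modulo \<open>B\<close>, applying the differential would
  show that \<open>f z\<close> is \<open>f\<close> times a boundary modulo \<open>A\<close>; cancelling the nonzerodivisor \<open>f\<close>, the chain \<open>z\<close>
  would be a boundary modulo \<open>A\<close>.\<close>

lemma koszul_homology_step:
  fixes A B :: "('v::linorder, 'k::field) mpoly set"
  assumes X: "finite X" and A: "ideal A (mpoly_ring X)" and B: "ideal B (mpoly_ring X)"
    and AB: "A \<subseteq> B" "f \<in> B" "\<And>p. p \<in> B \<Longrightarrow> \<exists>u \<in> carrier (mpoly_ring X). \<exists>a \<in> A. p = f * u + a"
    and b: "\<And>v. v \<in> X \<Longrightarrow> b v \<in> carrier (mpoly_ring X)" and f: "f = (\<Sum>v\<in>X. b v * var v)"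
    and nzd: "\<And>a. a \<in> carrier (mpoly_ring X) \<Longrightarrow> f * a \<in> A \<Longrightarrow> a \<in> A"
    and H: "koszul_homology_nonzero X A i"
  shows "koszul_homology_nonzero X B (Suc i)"
proof -
  let ?R = "carrier (mpoly_ring X) :: ('v, 'k) mpoly set"
  let ?d = "poly_koszul_diff X :: _ \<Rightarrow> _ \<Rightarrow> ('v, 'k) mpoly"
  obtain z where z: "\<And>T. z T \<in> ?R" "\<And>T. z T \<noteq> 0 \<Longrightarrow> T \<subseteq> X \<and> card T = i" "\<And>T. T \<subseteq> X \<Longrightarrow> ?d z T \<in> A"
    and nb: "\<And>w. (\<And>T. w T \<in> ?R) \<Longrightarrow> (\<And>T. T \<subseteq> X \<Longrightarrow> z T - ?d w T \<in> A) \<Longrightarrow> False"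
    using koszul_homology_nonzeroE[OF H] by metis
  \<comment> \<open>cut off outside the subsets of \<open>X\<close>, where chains have to vanish\<close>
  define y where "y T = (if T \<subseteq> X then koszul_wedge b z T else 0)" for T
  have dy: "?d y T = ?d (koszul_wedge b z) T" if "T \<subseteq> X" for T
    unfolding koszul_diff_def using that by (auto simp: y_def intro!: sum.cong)
  have ydz: "?d y T + koszul_wedge b (?d z) T = f * z T" if "T \<subseteq> X" for T
    using koszul_homotopy[OF X that, of var b z] dy[OF that] f by simp
  have wA: "koszul_wedge b (?d z) T \<in> A" if "T \<subseteq> X" for T
    by (rule koszul_wedge_mem[OF A]) (use that b z(3) in blast)+
  show ?thesis unfolding koszul_homology_nonzero_def
  proof (intro exI[of _ y] conjI allI impI notI)
    have car: "ideal (carrier (mpoly_ring X :: ('v, 'k) mpoly ring)) (mpoly_ring X)"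
      using ring.oneideal cring.axioms(1)[OF mpoly_ring_cring] by blast
    show "y T \<in> ?R" for T
      unfolding y_def by (auto intro!: koszul_wedge_mem[OF car] z(1)) (use b in blast)
    show "T \<subseteq> X" if "y T \<noteq> 0" for T using that by (auto simp: y_def split: if_splits)
    show "card T = Suc i" if "y T \<noteq> 0" for T
    proof -
      have T: "T \<subseteq> X" and ne: "koszul_wedge b z T \<noteq> 0" using that by (auto simp: y_def split: if_splits)
      then obtain v where v: "v \<in> T" "z (T - {v}) \<noteq> 0"
        unfolding koszul_wedge_def by (metis (no_types, lifting) mult_zero_right sum.neutral)
      have "finite T" using T X finite_subset by auto
      then show ?thesis using z(2)[OF v(2)] v(1) by (metis card_Suc_Diff1)
    qed
    show "?d y T \<in> B" if T: "T \<subseteq> X" for T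
    proof -
      have "?d y T = z T * f - koszul_wedge b (?d z) T" using ydz[OF T] by (simp add: algebra_simps)
      also have "\<dots> \<in> B" using mpoly_ideal_diff[OF B] mpoly_ideal_mult[OF B z(1) AB(2)] wA[OF T] AB(1) by blast
      finally show ?thesis .
    qed
    assume "\<exists>w. (\<forall>T. w T \<in> ?R) \<and> (\<forall>T\<subseteq>X. y T - ?d w T \<in> B)"
    then obtain w where w: "\<And>T. w T \<in> ?R" "\<And>T. T \<subseteq> X \<Longrightarrow> y T - ?d w T \<in> B" by blast
    have "\<forall>T. \<exists>u a. T \<subseteq> X \<longrightarrow> u \<in> ?R \<and> a \<in> A \<and> y T - ?d w T = f * u + a"
      using AB(3)[OF w(2)] by blast
    then obtain u a where ua: "\<And>T. T \<subseteq> X \<Longrightarrow> u T \<in> ?R \<and> a T \<in> A \<and> y T - ?d w T = f * u T + a T"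
      by metis
    define u' where "u' T = (if T \<subseteq> X then u T else 0)" for T
    have du: "?d u' T = ?d u T" if "T \<subseteq> X" for T
      unfolding koszul_diff_def using that by (auto simp: u'_def intro!: sum.cong)
    show False
    proof (rule nb[of u'])
      show "u' T \<in> ?R" for T using ua by (simp add: u'_def)
      fix T assume T: "T \<subseteq> X"
      have "?d y T = ?d (\<lambda>T. 1 * ?d w T + (f * u T + a T)) T"
        unfolding koszul_diff_def
      proof (rule sum.cong[OF refl])
        fix v assume "v \<in> X - T"
        then have "insert v T \<subseteq> X" using T by auto
        from ua[OF this]
        have "y (insert v T) = koszul_diff X var w (insert v T) + (f * u (insert v T) + a (insert v T))"
          by (simp add: algebra_simps)
        then show "koszul_sign v T * var v * y (insert v T) = koszul_sign v T * var v *
            (1 * (\<Sum>va\<in>X - insert v T. koszul_sign va (insert v T) * var va * w (insert va (insert v T)))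
             + (f * u (insert v T) + a (insert v T)))"
          by (simp add: koszul_diff_def)
      qed
      also have "\<dots> = f * ?d u T + ?d a T"
        by (simp only: koszul_diff_linear koszul_diff_diff[OF X T]) simp
      finally have "f * (z T - ?d u' T) = ?d a T + koszul_wedge b (?d z) T"
        using ydz[OF T] du[OF T] by (simp add: algebra_simps)
      also have "\<dots> \<in> A"
        by (intro mpoly_ideal_add[OF A] wA[OF T] koszul_diff_mem[OF A]) (use ua T in auto)
      finally have "f * (z T - ?d u' T) \<in> A" .
      moreover have "z T - ?d u' T \<in> ?R"
        by (intro mpoly_carrier_diff z(1) koszul_diff_carrier) (use ua in \<open>simp add: u'_def\<close>)
      ultimately show "z T - ?d u' T \<in> A" using nzd by blast
    qed
  qed
qed

lemma koszul_homology_nonzero_le: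
  fixes A :: "('v::linorder, 'k::field) mpoly set"
  assumes X: "finite X" and A: "ideal A (mpoly_ring X)" and H: "koszul_homology_nonzero X A i"
  shows "i \<le> card X"
proof (rule ccontr)
  assume "\<not> i \<le> card X"
  then have "\<not> (T \<subseteq> X \<and> card T = i)" for T using card_mono[OF X] by auto
  then have no: "\<not> (T \<subseteq> X \<and> card T = i)" for T by blast
  from H show False
  proof (rule koszul_homology_nonzeroE)
    fix z :: "'v set \<Rightarrow> ('v, 'k) mpoly"
    assume supp: "\<And>T. z T \<noteq> 0 \<Longrightarrow> T \<subseteq> X \<and> card T = i"
      and nb: "\<And>w. (\<And>T. w T \<in> carrier (mpoly_ring X)) \<Longrightarrow>
        (\<And>T. T \<subseteq> X \<Longrightarrow> z T - poly_koszul_diff X w T \<in> A) \<Longrightarrow> False"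
    have "z T = 0" for T using supp no by blast
    then show False
      using nb[of "\<lambda>_. 0"] mpoly_ideal_0[OF A] by (simp add: koszul_diff_def)
  qed
qed

lemma graded_maximal_ideal_mem:
  assumes X: "finite X" and f: "f \<in> graded_maximal_ideal X"
  shows "\<exists>b. (\<forall>v\<in>X. b v \<in> carrier (mpoly_ring X)) \<and> f = (\<Sum>v\<in>X. b v * var v :: ('v, 'k::field) mpoly)"
proof -
  let ?R = "mpoly_ring X :: ('v, 'k) mpoly ring"
  let ?M = "{f. \<exists>b. (\<forall>v\<in>X. b v \<in> carrier ?R) \<and> f = (\<Sum>v\<in>X. b v * var v)}"
  interpret cring ?R by (rule mpoly_ring_cring)
  have "ideal ?M ?R"
  proof (rule mpoly_idealI)
    show "?M \<subseteq> carrier ?R" by (auto intro!: mpoly_carrier_sum mpoly_carrier_mult mpoly_carrier_var)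
    show "0 \<in> ?M" by (auto intro!: exI[of _ "\<lambda>_. 0"])
    fix f g assume "f \<in> ?M" "g \<in> ?M"
    then obtain b c where "\<forall>v\<in>X. b v \<in> carrier ?R" "\<forall>v\<in>X. c v \<in> carrier ?R"
      "f = (\<Sum>v\<in>X. b v * var v)" "g = (\<Sum>v\<in>X. c v * var v)" by blast
    then show "f + g \<in> ?M"
      by (auto intro!: exI[of _ "\<lambda>v. b v + c v"] simp: mpoly_carrier_add distrib_right sum.distrib)
  next
    fix r g assume "r \<in> carrier ?R" "g \<in> ?M"
    then obtain c where "\<forall>v\<in>X. c v \<in> carrier ?R" "g = (\<Sum>v\<in>X. c v * var v)" by blast
    with \<open>r \<in> carrier ?R\<close> show "r * g \<in> ?M"
      by (auto intro!: exI[of _ "\<lambda>v. r * c v"] simp: mpoly_carrier_mult sum_distrib_left mult.assoc)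
  qed
  moreover have "var ` X \<subseteq> ?M"
  proof
    fix g :: "('v, 'k) mpoly" assume "g \<in> var ` X"
    then obtain v where v: "v \<in> X" "g = var v" by blast
    have "g = (\<Sum>w\<in>X. (if w = v then 1 else 0) * var w)"
      using v X by (simp add: if_distrib[of "\<lambda>c. c * _"] cong: if_cong)
    then show "g \<in> ?M" by (auto intro!: exI[of _ "\<lambda>w. if w = v then 1 else 0"])
  qed
  ultimately have "graded_maximal_ideal X \<subseteq> ?M" unfolding graded_maximal_ideal_def by (rule genideal_minimal)
  then show ?thesis using f by blast
qed

text \<open>Each member of a regular sequence in the maximal ideal raises the degree of nonzero homology by one,
  and there are no nonzero chains in degrees above \<open>card X\<close>.\<close>

theorem depth_quotient_le:
  fixes I :: "('v::linorder, 'k::field) mpoly set"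
  assumes X: "finite X" and I: "ideal I (mpoly_ring X)" and H: "koszul_homology_nonzero X I i"
  shows "depth (mpoly_ring X Quot I) ((+>\<^bsub>mpoly_ring X\<^esub>) I ` graded_maximal_ideal X) \<le> enat (card X - i)"
proof -
  let ?R = "mpoly_ring X :: ('v, 'k) mpoly ring"
  let ?m = "graded_maximal_ideal X :: ('v, 'k) mpoly set"
  interpret cring ?R by (rule mpoly_ring_cring)
  have "length xs + i \<le> card X"
    if xs: "regular_sequence (?R Quot I) xs" "set xs \<subseteq> (+>\<^bsub>?R\<^esub>) I ` ?m" for xs
  proof -
    obtain fs where fs: "xs = map ((+>\<^bsub>?R\<^esub>) I) fs" and fs2: "set fs \<subseteq> ?m"
    proof -
      have "xs \<in> map ((+>\<^bsub>?R\<^esub>) I) ` lists ?m"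
        using xs(2) unfolding lists_image[symmetric] by auto
      then show ?thesis using that by (auto simp: in_lists_conv_set)
    qed
    have varX: "var ` X \<subseteq> carrier ?R" by (auto intro: mpoly_carrier_var)
    have "?m \<subseteq> carrier ?R"
      unfolding graded_maximal_ideal_def
      by (rule additive_subgroup.a_subset[OF ideal.axioms(1)[OF genideal_ideal[OF varX]]])
    then have fsR: "set fs \<subseteq> carrier ?R" using fs2 by blast
    let ?A = "\<lambda>j. Idl\<^bsub>?R\<^esub> (I \<union> set (take j fs))"
    have sub: "I \<union> set (take j fs) \<subseteq> carrier ?R" for j
      using ideal.Icarr[OF I] fsR set_take_subset[of j fs] by blast
    have A: "ideal (?A j) ?R" for j by (rule genideal_ideal[OF sub])
    have nzd: "a \<in> ?A j" if "j < length fs" "a \<in> carrier ?R" "fs ! j * a \<in> ?A j" for j a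
      using xs(1) that unfolding fs regular_sequence_quotient_iff[OF I fsR] by simp
    have "koszul_homology_nonzero X (?A j) (j + i)" if "j \<le> length fs" for j
      using that
    proof (induction j)
      case 0
      have "?A 0 = I" using genideal_minimal[OF I] genideal_self[OF sub[of 0]] by auto
      then show ?case using H by simp
    next
      case (Suc j)
      let ?f = "fs ! j"
      have fm: "?f \<in> ?m" using Suc.prems fs2 by (simp add: subset_iff)
      obtain b where b: "\<forall>v\<in>X. b v \<in> carrier ?R" "?f = (\<Sum>v\<in>X. b v * var v)"
        using graded_maximal_ideal_mem[OF X fm] by blast
      have take: "set (take (Suc j) fs) = insert ?f (set (take j fs))"
        using Suc.prems by (simp add: take_Suc_conv_app_nth)
      have fR: "?f \<in> carrier ?R" using Suc.prems fsR by (simp add: subset_iff)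
      let ?B = "{?f * u + a | u a. u \<in> carrier ?R \<and> a \<in> ?A j}"
      have BI: "?f * u + a \<in> ?B" if "u \<in> carrier ?R" "a \<in> ?A j" for u a
        using that by blast
      have B: "ideal ?B ?R"
      proof (rule mpoly_idealI)
        show "?B \<subseteq> carrier ?R"
          using fR mpoly_ideal_subset[OF A] by (auto intro!: mpoly_carrier_add mpoly_carrier_mult)
        show "0 \<in> ?B" using mpoly_ideal_0[OF A] by (auto intro!: exI[of _ 0])
        fix p q assume "p \<in> ?B" "q \<in> ?B"
        then obtain u a u' a' where "u \<in> carrier ?R" "a \<in> ?A j" "u' \<in> carrier ?R" "a' \<in> ?A j"
          "p = ?f * u + a" "q = ?f * u' + a'" by blast
        then show "p + q \<in> ?B"
          using BI[of "u + u'" "a + a'"] mpoly_ideal_add[OF A]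
          by (simp add: mpoly_carrier_add algebra_simps)
      next
        fix r p assume r: "r \<in> carrier ?R" and "p \<in> ?B"
        then obtain u a where "u \<in> carrier ?R" "a \<in> ?A j" "p = ?f * u + a" by blast
        then have "r * p = ?f * (r * u) + r * a" "r * u \<in> carrier ?R" "r * a \<in> ?A j"
          using mpoly_carrier_mult[OF r] mpoly_ideal_mult[OF A r]
          by (simp_all add: distrib_left mult.left_commute)
        then show "r * p \<in> ?B" using BI[of "r * u" "r * a"] by simp
      qed
      have "I \<union> set (take (Suc j) fs) \<subseteq> ?B"
      proof
        fix p assume "p \<in> I \<union> set (take (Suc j) fs)"
        then consider "p = ?f" | "p \<in> ?A j" using take genideal_self[OF sub[of j]] by blast
        then show "p \<in> ?B"
        proof cases
          case 1
          then show ?thesis using BI[OF mpoly_carrier_1 mpoly_ideal_0[OF A]] by simp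
        next
          case 2
          then show ?thesis using BI[OF mpoly_carrier_0] by simp
        qed
      qed
      then have AB: "?A (Suc j) \<subseteq> ?B" by (rule genideal_minimal[OF B])
      have "koszul_homology_nonzero X (?A (Suc j)) (Suc (j + i))"
      proof (rule koszul_homology_step[OF X A A])
        show "?A j \<subseteq> ?A (Suc j)"
          by (rule genideal_minimal[OF A]) (use genideal_self[OF sub[of "Suc j"]] take in blast)
        show "?f \<in> ?A (Suc j)" using genideal_self[OF sub[of "Suc j"]] take by blast
        show "\<exists>u\<in>carrier ?R. \<exists>a\<in>?A j. p = ?f * u + a" if "p \<in> ?A (Suc j)" for p
          using AB that by blast
        show "b v \<in> carrier ?R" if "v \<in> X" for v using b that by blast
        show "?f = (\<Sum>v\<in>X. b v * var v)" by (rule b(2))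
        show "a \<in> ?A j" if "a \<in> carrier ?R" "?f * a \<in> ?A j" for a
          using nzd[of j a] that Suc.prems by simp
        show "koszul_homology_nonzero X (?A j) (j + i)" using Suc by simp
      qed
      then show ?case by simp
    qed
    from this[of "length fs"] have "length fs + i \<le> card X"
      using koszul_homology_nonzero_le[OF X A] by blast
    then show ?thesis by (simp add: fs)
  qed
  then have "length xs \<le> card X - i"
    if "regular_sequence (?R Quot I) xs" "set xs \<subseteq> (+>\<^bsub>?R\<^esub>) I ` ?m" for xs
    using that by fastforce
  then show ?thesis unfolding depth_def by (intro SUP_least) simp
qed

text \<open>If \<open>z = \<partial>w + a\<close> with coefficients of \<open>a\<close> in \<open>I\<close>, then \<open>\<partial>z = \<partial>a\<close>, and all terms of \<open>\<partial>a\<close> have degree at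
  least \<open>d + 1\<close>. One term of degree at most \<open>d\<close> in \<open>\<partial>z\<close> therefore shows that the class of \<open>z\<close> is nonzero.\<close>

lemma koszul_homology_nonzeroI:
  fixes I :: "('v::linorder, 'k::field) mpoly set"
  assumes X: "finite X" and I: "ideal I (mpoly_ring X)"
    and deg: "\<And>a m. a \<in> I \<Longrightarrow> m \<in> keys a \<Longrightarrow> d \<le> total_degree m"
    and z: "\<And>T. z T \<in> carrier (mpoly_ring X)" "\<And>T. z T \<noteq> 0 \<Longrightarrow> T \<subseteq> X \<and> card T = i"
      "\<And>T. T \<subseteq> X \<Longrightarrow> poly_koszul_diff X z T \<in> I"
    and T: "T \<subseteq> X" "m \<in> keys (poly_koszul_diff X z T)" "total_degree m \<le> d"
  shows "koszul_homology_nonzero X I i"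
  unfolding koszul_homology_nonzero_def
proof (intro exI[of _ z] conjI allI impI notI)
  assume "\<exists>w. (\<forall>T. w T \<in> carrier (mpoly_ring X)) \<and> (\<forall>T\<subseteq>X. z T - poly_koszul_diff X w T \<in> I)"
  then obtain w where w: "\<And>T. w T \<in> carrier (mpoly_ring X)" "\<And>T. T \<subseteq> X \<Longrightarrow> z T - poly_koszul_diff X w T \<in> I"
    by blast
  \<comment> \<open>the part of \<open>z\<close> with coefficients in \<open>I\<close>; it has the same boundary as \<open>z\<close>\<close>
  define a where "a T = z T - poly_koszul_diff X w T" for T
  have "poly_koszul_diff X z T = poly_koszul_diff X (\<lambda>T. 1 * poly_koszul_diff X w T + a T) T"
    by (simp add: a_def)
  also have "\<dots> = poly_koszul_diff X a T"
    by (simp only: koszul_diff_linear koszul_diff_diff[OF X T(1)]) simp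
  finally have "m \<in> keys (poly_koszul_diff X a T)" using T(2) by simp
  then obtain v where v: "v \<in> X - T" "m \<in> keys (koszul_sign v T * var v * a (insert v T))"
    unfolding koszul_diff_def using keys_sum[of "\<lambda>v. koszul_sign v T * var v * a (insert v T)" "X - T"] by blast
  moreover have "koszul_sign v T * var v * a (insert v T) = koszul_sign v T * a (insert v T) * var v"
    by (simp add: mult_ac)
  ultimately obtain k l where kl: "m = k + l" "k \<in> keys (koszul_sign v T * a (insert v T))"
      "l \<in> keys (var v :: ('v, 'k) mpoly)"
    using keys_mult[of "koszul_sign v T * a (insert v T)" "var v"] by auto
  have "koszul_sign v T * a (insert v T) \<in> I"
    by (rule mpoly_ideal_mult[OF I koszul_sign_carrier]) (use w(2) v(1) T(1) in \<open>simp add: a_def\<close>)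
  then have "d \<le> total_degree k" using deg kl(2) by blast
  moreover have "total_degree l = 1" using kl(3) by (simp add: var_def total_degree_def)
  ultimately show False using T(3) kl(1) by (simp add: total_degree_add)
qed (use z in simp_all)

lemma koszul_sign_cases: "koszul_sign v T = (1 :: 'a::comm_ring_1) \<or> koszul_sign v T = (- 1 :: 'a)"
  unfolding koszul_sign_def by (cases "even (card {w \<in> T. w < v})") simp_all

lemma keys_koszul_sign_times:
  fixes p :: "('v::linorder, 'k::field) mpoly"
  shows "keys (koszul_sign v T * p) = keys p"
  using koszul_sign_cases[of v T] by (metis keys_minus mult_1 mult_minus1)

lemma edge_ideal_degree:
  assumes E: "\<And>e. e \<in> E \<Longrightarrow> finite e \<and> card e = d" and a: "a \<in> monomial_ideal X (edge_multiples E)"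
    and m: "m \<in> keys a"
  shows "d \<le> total_degree m"
  by (rule total_degree_edge_multiple[of E d m]) (use E a m in \<open>auto simp: monomial_ideal_def\<close>)

text \<open>The class is that of \<open>x\<^sup>F e\<^sub>A\<close>: its boundary has the coefficients \<open>\<plusminus> x\<^sub>v x\<^sup>F\<close> with \<open>v \<in> A\<close>, which are edge
  monomials of degree \<open>d\<close>.\<close>

lemma koszul_homology_nonzero_star:
  fixes X :: "'v::linorder set" and E :: "'v set set"
  defines "I \<equiv> monomial_ideal X (edge_multiples E) :: ('v, 'k::field) mpoly set"
  assumes X: "finite X" and E: "\<And>e. e \<in> E \<Longrightarrow> finite e \<and> card e = d"
    and A: "A \<subseteq> X" "A \<noteq> {}" and F: "F \<subseteq> X" "Suc (card F) = d"
    and edge: "\<And>v. v \<in> A \<Longrightarrow> insert v F \<in> E"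
  shows "koszul_homology_nonzero X I (card A)"
proof -
  let ?R = "mpoly_ring X :: ('v, 'k) mpoly ring"
  define g where "g = (single (sqfree_exponent F) 1 :: ('v, 'k) mpoly)"
  have fin: "finite F" using X F(1) finite_subset by auto
  have I: "ideal I ?R" unfolding I_def by (rule edge_multiples_ideal)
  have gR: "g \<in> carrier ?R" unfolding g_def by (rule mpoly_carrier_single) (use F fin in \<open>simp add: keys_sqfree_exponent\<close>)
  have vg: "var v * g = single (single v 1 + sqfree_exponent F) 1" for v
    by (simp add: g_def var_def mult_single)
  have vgI: "var v * g \<in> I" if "v \<in> A" for v
    unfolding vg I_def monomial_ideal_def
    using edge[OF that] that A(1) F(1) fin
    by (auto simp: edge_multiples_def keys_plus_nat keys_sqfree_exponent intro!: mpoly_carrier_single)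
  define z where "z T = (if T = A then g else 0)" for T
  obtain v0 where v0: "v0 \<in> A" using A(2) by blast
  show ?thesis
  proof (rule koszul_homology_nonzeroI[OF X I, of d z])
    show "d \<le> total_degree m" if "a \<in> I" "m \<in> keys a" for a m
      using edge_ideal_degree[of E d a X m] E that by (simp add: I_def)
    show "z T \<in> carrier ?R" for T using gR by (simp add: z_def)
    show "T \<subseteq> X \<and> card T = card A" if "z T \<noteq> 0" for T using that A(1) by (auto simp: z_def split: if_splits)
    show "poly_koszul_diff X z T \<in> I" if "T \<subseteq> X" for T
      unfolding koszul_diff_def
    proof (rule mpoly_ideal_sum[OF I])
      fix v assume "v \<in> X - T"
      show "koszul_sign v T * var v * z (insert v T) \<in> I"
      proof (cases "insert v T = A")
        case True
        then have "var v * g \<in> I" by (intro vgI) auto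
        then have "koszul_sign v T * (var v * g) \<in> I" by (rule mpoly_ideal_mult[OF I koszul_sign_carrier])
        then show ?thesis using True by (simp add: z_def mult.assoc)
      next
        case False
        then show ?thesis using mpoly_ideal_0[OF I] by (simp add: z_def)
      qed
    qed
    \<comment> \<open>only \<open>e\<^sub>A\<close> contributes to the boundary at \<open>A - {v0}\<close>\<close>
    let ?T = "A - {v0}"
    show "?T \<subseteq> X" using A(1) by auto
    have "poly_koszul_diff X z ?T = (\<Sum>v\<in>{v0}. koszul_sign v ?T * var v * z (insert v ?T))"
      unfolding koszul_diff_def
      by (rule sum.mono_neutral_right) (use X v0 A(1) in \<open>auto simp: z_def\<close>)
    also have "\<dots> = koszul_sign v0 ?T * (var v0 * g)"
      using v0 by (simp add: z_def insert_absorb mult.assoc)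
    finally have "keys (poly_koszul_diff X z ?T) = keys (var v0 * g)"
      by (simp add: keys_koszul_sign_times)
    then show "single v0 1 + sqfree_exponent F \<in> keys (poly_koszul_diff X z ?T)"
      by (simp add: vg)
    show "total_degree (single v0 1 + sqfree_exponent F) \<le> d"
      unfolding total_degree_add total_degree_sqfree_exponent[OF fin] using F(2) by (simp add: total_degree_def)
  qed
qed

text \<open>The class is, up to sign, that of \<open>x\<^sup>F e\<^sub>A \<and> \<partial>(e\<^sub>b \<and> e\<^bsub>b'\<^esub>)\<close>. Its boundary is \<open>x\<^sup>F \<partial>e\<^sub>A \<and> \<partial>(e\<^sub>b \<and> e\<^bsub>b'\<^esub>)\<close> up to
  sign, with the edge monomials \<open>x\<^sub>v x\<^sub>b x\<^sup>F\<close> and \<open>x\<^sub>v x\<^bsub>b'\<^esub> x\<^sup>F\<close> as coefficients. Placing \<open>b\<close> and \<open>b'\<close> after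
  all of \<open>A\<close> gives both the same sign relative to \<open>e\<^sub>A\<close>.\<close>

lemma koszul_homology_nonzero_double_star:
  fixes X :: "'v::linorder set" and E :: "'v set set"
  defines "I \<equiv> monomial_ideal X (edge_multiples E) :: ('v, 'k::field) mpoly set"
  assumes X: "finite X" and E: "\<And>e. e \<in> E \<Longrightarrow> finite e \<and> card e = d"
    and A: "A \<subseteq> X" "A \<noteq> {}" and b: "b \<in> X" "b' \<in> X" "b < b'" "\<And>a. a \<in> A \<Longrightarrow> a < b"
    and F: "F \<subseteq> X" "Suc (Suc (card F)) = d"
    and edge: "\<And>v. v \<in> A \<Longrightarrow> insert v (insert b F) \<in> E" "\<And>v. v \<in> A \<Longrightarrow> insert v (insert b' F) \<in> E"
  shows "koszul_homology_nonzero X I (Suc (card A))"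
proof -
  let ?R = "mpoly_ring X :: ('v, 'k) mpoly ring"
  define g where "g = (single (sqfree_exponent F) 1 :: ('v, 'k) mpoly)"
  have fin: "finite F" "finite A" using X F(1) A(1) finite_subset by auto
  have I: "ideal I ?R" unfolding I_def by (rule edge_multiples_ideal)
  have bA: "b \<notin> A" "b' \<notin> A" "b \<noteq> b'" using b(3,4) by force+
  have vg: "var v * (var c * g) =
      single (single v 1 + (single c 1 + sqfree_exponent F)) 1" for v c
    by (simp add: g_def var_def mult_single)
  have gR: "g \<in> carrier ?R" unfolding g_def by (rule mpoly_carrier_single) (use F fin in \<open>simp add: keys_sqfree_exponent\<close>)
  have cgR: "var c * g \<in> carrier ?R" if "c \<in> X" for c
    by (rule mpoly_carrier_mult[OF mpoly_carrier_var[OF that] gR])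
  have vgI: "var v * (var c * g) \<in> I" if "v \<in> A" "c \<in> X" "insert v (insert c F) \<in> E" for v c
    unfolding vg I_def monomial_ideal_def
    using that A(1) F(1) fin
    by (auto simp: edge_multiples_def keys_plus_nat keys_sqfree_exponent intro!: mpoly_carrier_single bexI[of _ "insert v (insert c F)"])
  define z where "z T = (if T = insert b' A then var b * g else if T = insert b A then - (var b' * g) else 0)" for T
  have zb': "z (insert b' A) = var b * g" by (simp add: z_def)
  have zb: "z (insert b A) = - (var b' * g)" using bA by (auto simp: z_def)
  have sgn: "koszul_sign b A = (koszul_sign b' A :: ('v, 'k) mpoly)"
  proof -
    have "{w \<in> A. w < b} = A" "{w \<in> A. w < b'} = A" using b(3,4) by (auto dest: less_trans)
    then show ?thesis by (simp add: koszul_sign_def)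
  qed
  obtain v0 where v0: "v0 \<in> A" using A(2) by blast
  show ?thesis
  proof (rule koszul_homology_nonzeroI[OF X I, of d z])
    show "d \<le> total_degree m" if "a \<in> I" "m \<in> keys a" for a m
      using edge_ideal_degree[of E d a X m] E that by (simp add: I_def)
    show "z T \<in> carrier ?R" for T using cgR[OF b(1)] cgR[OF b(2)] by (simp add: z_def mpoly_carrier_uminus)
    show "T \<subseteq> X \<and> card T = Suc (card A)" if "z T \<noteq> 0" for T
      using that A(1) b bA fin by (auto simp: z_def split: if_splits)
    show "poly_koszul_diff X z T \<in> I" if T: "T \<subseteq> X" for T
    proof (cases "T = A")
      case True
      have "poly_koszul_diff X z A = (\<Sum>v\<in>{b, b'}. koszul_sign v A * var v * z (insert v A))"
        unfolding koszul_diff_def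
        by (rule sum.mono_neutral_right) (use X b bA in \<open>auto simp: z_def\<close>)
      also have "\<dots> = 0" using bA(3) by (simp add: zb zb' sgn)
      finally show ?thesis using True mpoly_ideal_0[OF I] by simp
    next
      case False
      show ?thesis unfolding koszul_diff_def
      proof (rule mpoly_ideal_sum[OF I])
        fix v assume v: "v \<in> X - T"
        have vA: "v \<in> A" if "insert v T = insert c A" "c \<notin> A" for c
          using that v False by (metis DiffD2 insertCI insertE insert_ident)
        consider "insert v T = insert b' A" | "insert v T = insert b A" | "z (insert v T) = 0"
          unfolding z_def by metis
        then show "koszul_sign v T * var v * z (insert v T) \<in> I"
        proof cases
          case 1
          have "koszul_sign v T * (var v * (var b * g)) \<in> I"
            using vA[OF 1 bA(2)] edge(1) by (intro mpoly_ideal_mult[OF I koszul_sign_carrier] vgI b)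
          then show ?thesis by (simp add: 1 zb' mult.assoc)
        next
          case 2
          have "koszul_sign v T * (var v * (var b' * g)) \<in> I"
            using vA[OF 2 bA(1)] edge(2) by (intro mpoly_ideal_mult[OF I koszul_sign_carrier] vgI b)
          then show ?thesis using mpoly_ideal_uminus[OF I] by (simp add: 2 zb mult.assoc)
        next
          case 3
          then show ?thesis using mpoly_ideal_0[OF I] by simp
        qed
      qed
    qed
    \<comment> \<open>only the basis vector of \<open>insert b' A\<close> contributes to the boundary at this set\<close>
    let ?T = "insert b' (A - {v0})"
    show "?T \<subseteq> X" using A(1) b by auto
    have ins: "insert v0 ?T = insert b' A" using v0 by auto
    have v0T: "v0 \<in> X - ?T" using v0 A(1) bA by auto
    have "poly_koszul_diff X z ?T = (\<Sum>v\<in>{v0}. koszul_sign v ?T * var v * z (insert v ?T))"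
      unfolding koszul_diff_def
    proof (rule sum.mono_neutral_right)
      show "\<forall>v\<in>X - ?T - {v0}. koszul_sign v ?T * var v * z (insert v ?T) = 0"
      proof
        fix v assume v: "v \<in> X - ?T - {v0}"
        have "insert v ?T \<noteq> insert b' A" using v v0 bA by auto
        moreover have "insert v ?T \<noteq> insert b A" using bA by auto
        ultimately show "koszul_sign v ?T * var v * z (insert v ?T) = 0" by (simp add: z_def)
      qed
    qed (use X v0T in auto)
    also have "\<dots> = koszul_sign v0 ?T * (var v0 * (var b * g))"
      by (simp add: ins zb' mult.assoc)
    finally have "keys (poly_koszul_diff X z ?T) = keys (var v0 * (var b * g))"
      by (simp add: keys_koszul_sign_times)
    then show "single v0 1 + (single b 1 + sqfree_exponent F) \<in> keys (poly_koszul_diff X z ?T)"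
      by (simp add: vg)
    show "total_degree (single v0 1 + (single b 1 + sqfree_exponent F)) \<le> d"
      unfolding total_degree_add total_degree_sqfree_exponent[OF fin(1)] using F(2) by (simp add: total_degree_def)
  qed
qed

section \<open>Algebraic dependence and the dimension from above\<close>

text \<open>Elimination of one unknown for each equation.\<close>

lemma homogeneous_system_nontrivial_solution:
  fixes M :: "'e \<Rightarrow> 'u \<Rightarrow> 'k::field"
  assumes "finite E" "finite U" "card E < card U"
  shows "\<exists>c. (\<exists>u\<in>U. c u \<noteq> 0) \<and> (\<forall>e\<in>E. (\<Sum>u\<in>U. c u * M e u) = 0)"
  using assms
proof (induction E arbitrary: U M rule: finite_induct)
  case empty
  then obtain u where "u \<in> U" by fastforce
  then show ?case by (intro exI[of _ "\<lambda>_. 1"]) auto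
next
  case (insert e E)
  show ?case
  proof (cases "\<forall>u\<in>U. M e u = 0")
    case True
    have "card E < card U" using insert.prems insert.hyps by simp
    from insert.IH[OF insert.prems(1) this, of M] obtain c where
      "\<exists>u\<in>U. c u \<noteq> 0" "\<forall>e\<in>E. (\<Sum>u\<in>U. c u * M e u) = 0" by blast
    with True show ?thesis by (intro exI[of _ c]) simp
  next
    case False
    then obtain p where p: "p \<in> U" "M e p \<noteq> 0" by blast
    let ?U = "U - {p}"
    let ?M = "\<lambda>e' u. M e' u - M e' p * M e u / M e p"
    have "card E < card ?U" using insert.prems insert.hyps p by simp
    from insert.IH[OF _ this, of ?M] insert.prems obtain c where
      c: "\<exists>u\<in>?U. c u \<noteq> 0" "\<And>e'. e' \<in> E \<Longrightarrow> (\<Sum>u\<in>?U. c u * ?M e' u) = 0" by auto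
    define q where "q = (\<Sum>u\<in>?U. c u * M e u)"
    \<comment> \<open>the eliminated unknown \<open>p\<close> is determined by the equation \<open>e\<close>\<close>
    define c' where "c' = c(p := - q / M e p)"
    have split: "(\<Sum>u\<in>U. c' u * M e' u) = - q / M e p * M e' p + (\<Sum>u\<in>?U. c u * M e' u)" for e'
    proof -
      have "(\<Sum>u\<in>U. c' u * M e' u) = c' p * M e' p + (\<Sum>u\<in>?U. c' u * M e' u)"
        by (rule sum.remove[OF insert.prems(1) p(1)])
      also have "(\<Sum>u\<in>?U. c' u * M e' u) = (\<Sum>u\<in>?U. c u * M e' u)"
        by (rule sum.cong) (auto simp: c'_def)
      finally show ?thesis by (simp add: c'_def)
    qed
    have "(\<Sum>u\<in>U. c' u * M e u) = 0" using split[of e] p by (simp add: q_def)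
    moreover have "(\<Sum>u\<in>U. c' u * M e' u) = 0" if "e' \<in> E" for e'
    proof -
      have "0 = (\<Sum>u\<in>?U. c u * M e' u - (M e' p / M e p) * (c u * M e u))"
        using c(2)[OF that] by (simp add: algebra_simps)
      also have "\<dots> = (\<Sum>u\<in>?U. c u * M e' u) - (M e' p / M e p) * q"
        by (simp add: q_def sum_subtractf sum_distrib_left)
      finally show ?thesis using split[of e'] by simp
    qed
    moreover have "\<exists>u\<in>U. c' u \<noteq> 0" using c(1) by (auto simp: c'_def)
    ultimately show ?thesis by (intro exI[of _ c']) simp
  qed
qed

fun power_product :: "'a::comm_monoid_mult list \<Rightarrow> nat list \<Rightarrow> 'a" where
  "power_product (f # fs) (j # js) = f ^ j * power_product fs js"
| "power_product _ _ = 1"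

definition exponent_lists :: "nat \<Rightarrow> nat \<Rightarrow> nat list set" where
  "exponent_lists B r = {js. set js \<subseteq> {..B} \<and> length js = r}"

lemma finite_exponent_lists [simp]: "finite (exponent_lists B r)"
  unfolding exponent_lists_def by (rule finite_lists_length_eq) simp

lemma card_exponent_lists: "card (exponent_lists B r) = (B + 1) ^ r"
  unfolding exponent_lists_def by (subst card_lists_length_eq) simp_all

text \<open>The value at \<open>fs\<close> of the polynomial over the field with coefficients \<open>c\<close> and all exponents at most
  \<open>B\<close>.\<close>

definition power_combination ::
    "nat \<Rightarrow> (nat list \<Rightarrow> 'k::field) \<Rightarrow> ('v, 'k) mpoly list \<Rightarrow> ('v, 'k) mpoly" where
  "power_combination B c fs =
     (\<Sum>js \<in> exponent_lists B (length fs). single 0 (c js) * power_product fs js)"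

lemma power_combination_Nil: "power_combination B c [] = single 0 (c [])"
proof -
  have "exponent_lists B 0 = {[]}" by (auto simp: exponent_lists_def)
  then show ?thesis by (simp add: power_combination_def)
qed

lemma power_combination_Cons:
  "power_combination B c (f # fs) =
     (\<Sum>j\<le>B. f ^ j * power_combination B (\<lambda>js. c (j # js)) fs)"
proof -
  have "exponent_lists B (Suc (length fs)) = (\<lambda>(j, js). j # js) ` ({..B} \<times> exponent_lists B (length fs))"
    by (auto simp: exponent_lists_def image_iff length_Suc_conv)
  moreover have "inj_on (\<lambda>(j, js). j # js) ({..B} \<times> exponent_lists B (length fs))"
    by (auto simp: inj_on_def)
  ultimately have "power_combination B c (f # fs) =
     (\<Sum>(j, js) \<in> {..B} \<times> exponent_lists B (length fs). single 0 (c (j # js)) * (f ^ j * power_product fs js))"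
    unfolding power_combination_def
    by (simp add: sum.reindex case_prod_unfold)
  also have "\<dots> = (\<Sum>j\<le>B. \<Sum>js \<in> exponent_lists B (length fs). f ^ j * (single 0 (c (j # js)) * power_product fs js))"
    by (simp add: sum.cartesian_product[symmetric] mult.left_commute)
  finally show ?thesis by (simp add: power_combination_def sum_distrib_left)
qed

lemma power_product_carrier:
  "set fs \<subseteq> carrier (mpoly_ring X) \<Longrightarrow> power_product fs js \<in> carrier (mpoly_ring X)"
  by (induction fs js rule: power_product.induct) (auto intro: mpoly_carrier_mult mpoly_carrier_power)

lemma power_combination_carrier:
  "set fs \<subseteq> carrier (mpoly_ring X) \<Longrightarrow> power_combination B c fs \<in> carrier (mpoly_ring X)"
  unfolding power_combination_def
  by (intro mpoly_carrier_sum mpoly_carrier_mult mpoly_carrier_const power_product_carrier)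

lemma power_combination_eq_0:
  "(\<And>js. js \<in> exponent_lists B (length fs) \<Longrightarrow> c js = 0) \<Longrightarrow> power_combination B c fs = 0"
  by (simp add: power_combination_def)

lemma mpoly_prime_mult:
  assumes "primeideal P (mpoly_ring X)" "a \<in> carrier (mpoly_ring X)" "b \<in> carrier (mpoly_ring X)" "a * b \<in> P"
  shows "a \<in> P \<or> b \<in> P"
  using primeideal.I_prime[OF assms(1,2,3)] assms(4) by simp

lemma mpoly_prime_proper:
  assumes P: "primeideal P (mpoly_ring X)" shows "1 \<notin> P"
proof
  assume "1 \<in> P"
  then have "P = carrier (mpoly_ring X)"
    using ideal.one_imp_carrier[OF primeideal.axioms(1)[OF P]] by simp
  then show False using primeideal.I_notcarr[OF P] by simp
qed

lemma mpoly_prime_power: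
  assumes P: "primeideal P (mpoly_ring X)" and f: "f \<in> carrier (mpoly_ring X)" "f ^ j \<in> P"
  shows "f \<in> P"
  using f(2)
proof (induction j)
  case 0
  then show ?case using mpoly_prime_proper[OF P] by simp
next
  case (Suc j)
  then show ?case using mpoly_prime_mult[OF P f(1) mpoly_carrier_power[OF f(1), of j]] by auto
qed

text \<open>Elements that witness the strict inclusions of a chain of primes satisfy no polynomial relation over
  the field modulo the smallest prime. Order a relation by the powers of the first element \<open>f\<close> and let
  \<open>j\<close> be the least power that occurs. The factor \<open>f\<^sup>j\<close> is not in the first prime \<open>P\<close> and can be removed;
  the rest is \<open>G\<^sub>j\<close> plus a multiple of \<open>f\<close>, so \<open>G\<^sub>j\<close>, a relation between the other elements, lies in the
  next prime.\<close>

lemma prime_chain_independent: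
  fixes fs :: "('v, 'k::field) mpoly list"
  assumes "length Ps = Suc (length fs)"
    and "\<And>P. P \<in> set Ps \<Longrightarrow> primeideal P (mpoly_ring X)"
    and "\<And>i. i < length fs \<Longrightarrow> Ps ! i \<subseteq> Ps ! Suc i \<and> fs ! i \<in> Ps ! Suc i - Ps ! i"
    and "power_combination B c fs \<in> hd Ps"
    and "js \<in> exponent_lists B (length fs)"
  shows "c js = 0"
  using assms
proof (induction fs arbitrary: Ps c js)
  case Nil
  then obtain P where Ps: "Ps = [P]" by (auto simp: length_Suc_conv)
  have P: "primeideal P (mpoly_ring X)" using Nil.prems(2) Ps by simp
  have js: "js = []" using Nil.prems(5) by (simp add: exponent_lists_def)
  show ?case
  proof (rule ccontr)
    assume "c js \<noteq> 0"
    then have ne: "c [] \<noteq> 0" by (simp add: js)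
    have "single 0 (inverse (c [])) * single 0 (c []) \<in> P"
      using Nil.prems(4) Ps
      by (intro mpoly_ideal_mult[OF primeideal.axioms(1)[OF P]]) (simp_all add: power_combination_Nil)
    then have "1 \<in> P" using ne by (simp add: mult_single single_one)
    then show False using mpoly_prime_proper[OF P] by simp
  qed
next
  case (Cons f fs)
  obtain P Q Ps' where Ps: "Ps = P # Q # Ps'" using Cons.prems(1) by (auto simp: length_Suc_conv)
  have P: "primeideal P (mpoly_ring X)" and Q: "primeideal Q (mpoly_ring X)"
    using Cons.prems(2) Ps by auto
  have PQ: "P \<subseteq> Q" "f \<in> Q" "f \<notin> P" using Cons.prems(3)[of 0] Ps by auto
  have Qi: "ideal Q (mpoly_ring X)" by (rule primeideal.axioms(1)[OF Q])
  have fR: "f \<in> carrier (mpoly_ring X)" using mpoly_ideal_subset[OF Qi PQ(2)] .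
  have fsR: "set fs \<subseteq> carrier (mpoly_ring X)"
  proof
    fix g assume "g \<in> set fs"
    then obtain i where i: "i < length fs" "g = fs ! i" by (auto simp: in_set_conv_nth)
    then have "g \<in> Ps ! Suc (Suc i)" using Cons.prems(3)[of "Suc i"] by simp
    moreover have "Ps ! Suc (Suc i) \<in> set Ps" using i Cons.prems(1) by (intro nth_mem) simp
    ultimately show "g \<in> carrier (mpoly_ring X)"
      using mpoly_ideal_subset primeideal.axioms(1) Cons.prems(2) by blast
  qed
  let ?G = "\<lambda>j. power_combination B (\<lambda>js. c (j # js)) fs"
  have GR: "?G j \<in> carrier (mpoly_ring X)" for j by (rule power_combination_carrier[OF fsR])
  have main: "\<forall>js \<in> exponent_lists B (length fs). c (j # js) = 0" if "j \<le> B" for j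
    using that
  proof (induction j rule: less_induct)
    case (less j)
    have G0: "?G j' = 0" if "j' < j" for j'
      by (rule power_combination_eq_0) (use less that in auto)
    \<comment> \<open>after removing \<open>f\<^sup>j\<close>, the terms with higher powers of \<open>f\<close> are \<open>f\<close> times \<open>?H\<close>\<close>
    let ?H = "\<Sum>j'\<in>{Suc j..B}. f ^ (j' - Suc j) * ?G j'"
    have HR: "?H \<in> carrier (mpoly_ring X)"
      by (intro mpoly_carrier_sum mpoly_carrier_mult mpoly_carrier_power fR GR)
    have "power_combination B c (f # fs) = (\<Sum>j'\<le>B. f ^ j' * ?G j')"
      by (rule power_combination_Cons)
    also have "\<dots> = (\<Sum>j'\<in>{j..B}. f ^ j' * ?G j')"
      by (rule sum.mono_neutral_right) (auto simp: G0)
    also have "\<dots> = f ^ j * ?G j + (\<Sum>j'\<in>{Suc j..B}. f ^ j' * ?G j')"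
      using less.prems by (simp add: sum.atLeast_Suc_atMost)
    also have "(\<Sum>j'\<in>{Suc j..B}. f ^ j' * ?G j') = (\<Sum>j'\<in>{Suc j..B}. f ^ j * (f * (f ^ (j' - Suc j) * ?G j')))"
    proof (rule sum.cong[OF refl])
      fix j' assume "j' \<in> {Suc j..B}"
      then have "j' = j + (1 + (j' - Suc j))" by simp
      then have "f ^ j' = f ^ j * (f * f ^ (j' - Suc j))" by (metis power_add power_one_right)
      then show "f ^ j' * ?G j' = f ^ j * (f * (f ^ (j' - Suc j) * ?G j'))" by (simp only: mult.assoc)
    qed
    also have "f ^ j * ?G j + \<dots> = f ^ j * (?G j + f * ?H)"
      by (simp only: sum_distrib_left[symmetric] distrib_left)
    finally have "f ^ j * (?G j + f * ?H) \<in> P" using Cons.prems(4) Ps by simp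
    then have "?G j + f * ?H \<in> P"
      using mpoly_prime_mult[OF P mpoly_carrier_power[OF fR] mpoly_carrier_add[OF GR mpoly_carrier_mult[OF fR HR]]]
        mpoly_prime_power[OF P fR] PQ(3) by blast
    then have "?G j + f * ?H \<in> Q" using PQ(1) by blast
    moreover have "?H * f \<in> Q" by (rule mpoly_ideal_mult[OF Qi HR PQ(2)])
    ultimately have "?G j \<in> Q"
      using mpoly_ideal_diff[OF Qi, of "?G j + f * ?H" "?H * f"] by (simp add: mult.commute)
    then have GQ: "?G j \<in> hd (Q # Ps')" by simp
    show ?case
    proof
      fix js assume js: "js \<in> exponent_lists B (length fs)"
      show "c (j # js) = 0"
      proof (rule Cons.IH[OF _ _ _ GQ js])
        show "length (Q # Ps') = Suc (length fs)" using Cons.prems(1) Ps by simp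
        show "primeideal P (mpoly_ring X)" if "P \<in> set (Q # Ps')" for P
          using Cons.prems(2) Ps that by auto
        show "(Q # Ps') ! i \<subseteq> (Q # Ps') ! Suc i \<and> fs ! i \<in> (Q # Ps') ! Suc i - (Q # Ps') ! i"
          if "i < length fs" for i
          using Cons.prems(3)[of "Suc i"] Ps that by simp
      qed
    qed
  qed
  obtain j js' where "js = j # js'" "j \<le> B" "js' \<in> exponent_lists B (length fs)"
    using Cons.prems(5) by (auto simp: exponent_lists_def length_Suc_conv)
  then show ?case using main by blast
qed

text \<open>The degree in each single variable is bounded, which makes the monomials under consideration easy to
  count.\<close>

definition exponents_le :: "nat \<Rightarrow> ('v, 'k::field) mpoly \<Rightarrow> bool" where
  "exponents_le N p \<longleftrightarrow> (\<forall>m \<in> keys p. \<forall>v. lookup m v \<le> N)"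

lemma exponents_le_mult:
  assumes "exponents_le N p" "exponents_le N' q"
  shows "exponents_le (N + N') (p * q)"
  unfolding exponents_le_def
proof (intro ballI allI)
  fix m v assume "m \<in> keys (p * q)"
  then obtain a b where "m = a + b" "a \<in> keys p" "b \<in> keys q"
    using keys_mult[of p q] by blast
  with assms show "lookup m v \<le> N + N'"
    by (simp add: exponents_le_def lookup_add add_mono)
qed

lemma exponents_le_power: "exponents_le N p \<Longrightarrow> exponents_le (k * N) (p ^ k)"
proof (induction k)
  case (Suc k)
  then show ?case using exponents_le_mult[of N p "k * N" "p ^ k"] by simp
qed (simp add: exponents_le_def)

lemma exponents_le_mono: "exponents_le N p \<Longrightarrow> N \<le> N' \<Longrightarrow> exponents_le N' p"
  unfolding exponents_le_def using order_trans by blast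

lemma exponents_le_power_product:
  assumes "\<And>f. f \<in> set fs \<Longrightarrow> exponents_le e f" "js \<in> exponent_lists B (length fs)"
  shows "exponents_le (e * B * length fs) (power_product fs js)"
  using assms
proof (induction fs arbitrary: js)
  case Nil
  then show ?case by (simp add: exponents_le_def)
next
  case (Cons f fs)
  obtain j js' where js: "js = j # js'" "j \<le> B" "js' \<in> exponent_lists B (length fs)"
    using Cons.prems(2) by (auto simp: exponent_lists_def length_Suc_conv)
  have "exponents_le (e * B) (f ^ j)"
    by (rule exponents_le_mono[OF exponents_le_power[of e]]) (use Cons.prems js in \<open>auto simp: mult.commute\<close>)
  from exponents_le_mult[OF this Cons.IH[of js']] Cons.prems(1) js show ?case by simp
qed

lemma exponents_le_exists: "\<exists>N. \<forall>p \<in> set ps. exponents_le N p"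
proof (induction ps)
  case (Cons p ps)
  then obtain N where N: "\<forall>p \<in> set ps. exponents_le N p" by blast
  let ?N = "\<Sum>m\<in>keys p. total_degree m"
  have "lookup m v \<le> ?N" if "m \<in> keys p" for m v
  proof -
    have "lookup m v \<le> total_degree m"
    proof (cases "v \<in> keys m")
      case True
      then show ?thesis unfolding total_degree_def by (intro member_le_sum) auto
    qed (simp add: in_keys_iff)
    also have "\<dots> \<le> ?N" using that by (intro member_le_sum) auto
    finally show ?thesis .
  qed
  then have "exponents_le ?N p" by (simp add: exponents_le_def)
  then have "exponents_le (N + ?N) p" by (rule exponents_le_mono) simp
  moreover have "\<forall>q \<in> set ps. exponents_le (N + ?N) q" using N exponents_le_mono le_add1 by blast
  ultimately show ?case by (intro exI[of _ "N + ?N"]) simp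
qed simp

lemma monomials_finite_card:
  fixes N :: nat
  assumes W: "finite W"
  defines "M \<equiv> {m :: 'v \<Rightarrow>\<^sub>0 nat. keys m \<subseteq> W \<and> (\<forall>v. lookup m v \<le> N)}"
  shows "finite M" and "card M \<le> (N + 1) ^ card W"
proof -
  let ?F = "PiE W (\<lambda>_. {..N})"
  have inj: "inj_on (\<lambda>m. restrict (lookup m) W) M"
  proof (rule inj_onI)
    fix m m' assume m: "m \<in> M" "m' \<in> M" "restrict (lookup m) W = restrict (lookup m') W"
    show "m = m'"
    proof (rule poly_mapping_eqI)
      fix v
      show "lookup m v = lookup m' v"
      proof (cases "v \<in> W")
        case True
        then show ?thesis using fun_cong[OF m(3), of v] by simp
      next
        case False
        then have "v \<notin> keys m" "v \<notin> keys m'" using m(1,2) by (auto simp: M_def)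
        then show ?thesis by (simp add: in_keys_iff)
      qed
    qed
  qed
  have sub: "(\<lambda>m. restrict (lookup m) W) ` M \<subseteq> ?F" by (auto simp: M_def)
  have fin: "finite ?F" using W by (intro finite_PiE) auto
  show "finite M" using inj_on_finite[OF inj sub fin] .
  show "card M \<le> (N + 1) ^ card W"
    using card_inj_on_le[OF inj sub fin] W by (simp add: card_PiE)
qed

text \<open>A longer chain would supply \<open>r + 1\<close> independent elements, where \<open>r\<close> is the number of variables
  outside \<open>C\<close>. Their power products with exponents at most \<open>B\<close> number \<open>(B + 1)\<^bsup>r+1\<^esup>\<close>, whereas modulo \<open>C\<close>
  the number of monomials in them grows only like \<open>B\<^sup>r\<close>; for large \<open>B\<close> a linear relation exists.\<close>

lemma prime_chain_length_le:
  fixes Ps :: "('v, 'k::field) mpoly set list"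
  assumes X: "finite X" and C: "C \<subseteq> X"
    and Ps: "Ps \<noteq> []" "\<And>P. P \<in> set Ps \<Longrightarrow> primeideal P (mpoly_ring X)" "sorted_wrt (\<subset>) Ps"
    and sub: "variable_prime X C \<subseteq> hd Ps"
  shows "length Ps - 1 \<le> card X - card C"
proof (rule ccontr)
  define r where "r = card X - card C"
  assume "\<not> length Ps - 1 \<le> card X - card C"
  then have len: "Suc (Suc r) \<le> length Ps" by (simp add: r_def)
  define Qs where "Qs = take (Suc (Suc r)) Ps"
  have lenQ: "length Qs = Suc (Suc r)" using len by (simp add: Qs_def)
  have Q: "primeideal Q (mpoly_ring X)" if "Q \<in> set Qs" for Q
    using Ps(2) that set_take_subset[of "Suc (Suc r)" Ps] by (auto simp: Qs_def)
  have strict: "Qs ! i \<subset> Qs ! Suc i" if "i < Suc r" for i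
    using Ps(3) that len by (simp add: Qs_def sorted_wrt_iff_nth_less)
  have hdQ: "hd Qs = hd Ps" using Ps(1) by (simp add: Qs_def)
  define fs where "fs = map (\<lambda>i. SOME f. f \<in> Qs ! Suc i - Qs ! i) [0..<Suc r]"
  have lenf: "length fs = Suc r" by (simp add: fs_def)
  have fs: "fs ! i \<in> Qs ! Suc i - Qs ! i" if "i < Suc r" for i
  proof -
    have "\<exists>f. f \<in> Qs ! Suc i - Qs ! i" using strict[OF that] by blast
    then have "(SOME f. f \<in> Qs ! Suc i - Qs ! i) \<in> Qs ! Suc i - Qs ! i" by (rule someI_ex)
    then show ?thesis using that by (simp add: fs_def del: upt_Suc)
  qed
  have fsR: "set fs \<subseteq> carrier (mpoly_ring X)"
  proof
    fix g assume "g \<in> set fs"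
    then obtain i where i: "i < Suc r" "g = fs ! i" using lenf by (auto simp: in_set_conv_nth)
    have "Qs ! Suc i \<in> set Qs" using i lenQ by (intro nth_mem) simp
    then show "g \<in> carrier (mpoly_ring X)"
      using fs[OF i(1)] i(2) mpoly_ideal_subset[OF primeideal.axioms(1)[OF Q]] by blast
  qed
  obtain e where e: "\<forall>f \<in> set fs. exponents_le e f" using exponents_le_exists by blast
  \<comment> \<open>this \<open>B\<close> makes the number \<open>(N + 1)\<^sup>r\<close> of monomials smaller than the number \<open>(B + 1)\<^bsup>r+1\<^esup>\<close> of power products\<close>
  define B where "B = (e * Suc r + 1) ^ r"
  define N where "N = e * B * Suc r"
  define M where "M = {m :: 'v \<Rightarrow>\<^sub>0 nat. keys m \<subseteq> X - C \<and> (\<forall>v. lookup m v \<le> N)}"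
  have W: "finite (X - C)" "card (X - C) = r" using X C by (auto simp: r_def card_Diff_subset finite_subset)
  have "card M \<le> (N + 1) ^ r" using monomials_finite_card(2)[OF W(1)] W(2) by (simp add: M_def)
  also have "\<dots> \<le> ((e * Suc r + 1) * (B + 1)) ^ r"
    by (rule power_mono) (simp_all add: N_def algebra_simps)
  also have "\<dots> = B * (B + 1) ^ r" by (simp only: power_mult_distrib B_def)
  also have "\<dots> < (B + 1) ^ Suc r" by simp
  finally have "card M < card (exponent_lists B (Suc r))" by (simp add: card_exponent_lists)
  moreover have "finite M" using monomials_finite_card(1)[OF W(1)] by (simp add: M_def)
  ultimately obtain c where c: "\<exists>js \<in> exponent_lists B (Suc r). c js \<noteq> 0"
    "\<And>m. m \<in> M \<Longrightarrow> (\<Sum>js \<in> exponent_lists B (Suc r). c js * lookup (power_product fs js) m) = 0"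
    using homogeneous_system_nontrivial_solution[of M "exponent_lists B (Suc r)"
        "\<lambda>m js. lookup (power_product fs js) m"] by auto
  let ?g = "power_combination B c fs"
  have coeff: "lookup ?g m = (\<Sum>js \<in> exponent_lists B (Suc r). c js * lookup (power_product fs js) m)" for m
  proof -
    have "lookup (single 0 a * p) m = a * lookup p m" for a and p :: "('v, 'k) mpoly"
      using lookup_single_times[of 0 a p m] by simp
    then show ?thesis by (simp add: power_combination_def lookup_sum lenf)
  qed
  have "keys m \<inter> C \<noteq> {}" if m: "m \<in> keys ?g" for m
  proof
    assume "keys m \<inter> C = {}"
    moreover have "keys m \<subseteq> X"
      using m power_combination_carrier[OF fsR] by (auto simp: mem_mpoly_carrier)
    moreover have "lookup m v \<le> N" for v
    proof -
      have "lookup ?g m \<noteq> 0" using m by (simp add: in_keys_iff)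
      then obtain js where js: "js \<in> exponent_lists B (Suc r)" "lookup (power_product fs js) m \<noteq> 0"
        unfolding coeff by (metis (no_types, lifting) mult_zero_right sum.neutral)
      then have "exponents_le N (power_product fs js)"
        unfolding N_def using exponents_le_power_product[of fs e js B] e lenf by simp
      then show ?thesis using js(2) by (simp add: exponents_le_def in_keys_iff)
    qed
    ultimately have "m \<in> M" by (auto simp: M_def)
    then have "lookup ?g m = 0" using coeff c(2) by simp
    then show False using m by (simp add: in_keys_iff)
  qed
  then have "?g \<in> variable_prime X C"
    using power_combination_carrier[OF fsR] by (auto simp: variable_prime_def monomial_ideal_def)
  then have g: "?g \<in> hd Qs" using sub hdQ by auto
  have "c js = 0" if "js \<in> exponent_lists B (Suc r)" for js
    by (rule prime_chain_independent[OF _ Q _ g]) (use lenQ lenf strict fs that in auto)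
  then show False using c(1) by blast
qed

lemma prime_contains_factor:
  assumes P: "primeideal P (mpoly_ring X)" and e: "finite e" "e \<subseteq> X" and m: "(\<Prod>v\<in>e. var v) \<in> P"
  shows "\<exists>v\<in>e. var v \<in> P"
  using e m
proof (induction e rule: finite_induct)
  case empty
  then show ?case using mpoly_prime_proper[OF P] by simp
next
  case (insert v e)
  have "(\<Prod>v\<in>e. var v) \<in> carrier (mpoly_ring X)"
    unfolding prod_var using insert by (intro mpoly_carrier_single) (simp add: keys_sqfree_exponent)
  then show ?case
    using mpoly_prime_mult[OF P mpoly_carrier_var[of v X], of "\<Prod>v\<in>e. var v"] insert by auto
qed

text \<open>A prime over \<open>I\<close> contains a variable from each of the \<open>s\<close> disjoint edges, hence a prime generated by
  \<open>s\<close> variables.\<close>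

theorem krull_dim_quotient_le:
  fixes I :: "('v, 'k::field) mpoly set"
  assumes X: "finite X" and I: "I = monomial_ideal X (edge_multiples E)"
    and E: "\<And>e. e \<in> E \<Longrightarrow> e \<subseteq> X"
    and g: "\<And>a. a < s \<Longrightarrow> g a \<in> E" "\<And>a b. a < s \<Longrightarrow> b < s \<Longrightarrow> a \<noteq> b \<Longrightarrow> g a \<inter> g b = {}"
  shows "krull_dim (mpoly_ring X Quot I) \<le> enat (card X - s)"
proof -
  have idI: "ideal I (mpoly_ring X)"
    unfolding I by (rule monomial_ideal_ideal) (auto simp: edge_multiples_def keys_plus_nat)
  have "length Ps - 1 \<le> card X - s"
    if Ps: "Ps \<noteq> []" "\<forall>P \<in> set Ps. primeideal P (mpoly_ring X) \<and> I \<subseteq> P" "sorted_wrt (\<subset>) Ps" for Ps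
  proof -
    let ?P = "hd Ps"
    have P: "primeideal ?P (mpoly_ring X)" "I \<subseteq> ?P" using Ps by auto
    have "\<exists>v\<in>g a. var v \<in> ?P" if a: "a < s" for a
    proof (rule prime_contains_factor[OF P(1)])
      have e: "g a \<in> E" "g a \<subseteq> X" using a g(1) E by auto
      show "g a \<subseteq> X" "finite (g a)" using e(2) X finite_subset by auto
      then have "(\<Prod>v\<in>g a. var v) \<in> I"
        using e by (auto simp: I prod_var monomial_ideal_def edge_multiples_def keys_sqfree_exponent intro!: mpoly_carrier_single)
      then show "(\<Prod>v\<in>g a. var v) \<in> ?P" using P(2) by blast
    qed
    then obtain h where h: "\<And>a. a < s \<Longrightarrow> h a \<in> g a \<and> var (h a) \<in> ?P" by metis
    have inj: "inj_on h {..<s}"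
    proof (rule inj_onI)
      fix a b assume "a \<in> {..<s}" "b \<in> {..<s}" "h a = h b"
      then show "a = b" using h[of a] h[of b] g(2)[of a b] by auto
    qed
    let ?C = "h ` {..<s}"
    have CX: "?C \<subseteq> X" using h g(1) E by blast
    have "length Ps - 1 \<le> card X - card ?C"
    proof (rule prime_chain_length_le[OF X CX Ps(1) _ Ps(3)])
      show "primeideal P (mpoly_ring X)" if "P \<in> set Ps" for P using Ps(2) that by blast
      show "variable_prime X ?C \<subseteq> ?P"
        by (rule variable_prime_subset[OF primeideal.axioms(1)[OF P(1)]]) (use h in auto)
    qed
    then show ?thesis using card_image[OF inj] by simp
  qed
  then show ?thesis
    unfolding cring.krull_dim_quotient[OF mpoly_ring_cring idI] by (intro SUP_least) auto
qed

section \<open>Identification of variables and the depth from below\<close>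

definition subst_exponent :: "('v \<Rightarrow> 'v) \<Rightarrow> ('v \<Rightarrow>\<^sub>0 nat) \<Rightarrow> 'v \<Rightarrow>\<^sub>0 nat" where
  "subst_exponent \<rho> m = (\<Sum>v \<in> keys m. single (\<rho> v) (lookup m v))"

definition subst_mpoly :: "('v \<Rightarrow> 'v) \<Rightarrow> ('v, 'k::field) mpoly \<Rightarrow> ('v, 'k) mpoly" where
  "subst_mpoly \<rho> p = (\<Sum>m \<in> keys p. single (subst_exponent \<rho> m) (lookup p m))"

lemma subst_exponent_add: "subst_exponent \<rho> (a + b) = subst_exponent \<rho> a + subst_exponent \<rho> b"
  unfolding subst_exponent_def by (rule setsum_keys_plus_distrib) (simp_all add: single_add)

lemma subst_exponent_0 [simp]: "subst_exponent \<rho> 0 = 0"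
  by (simp add: subst_exponent_def)

lemma subst_exponent_single [simp]: "subst_exponent \<rho> (single v k) = single (\<rho> v) k"
  by (simp add: subst_exponent_def)

lemma subst_exponent_sum: "subst_exponent \<rho> (\<Sum>i\<in>F. f i) = (\<Sum>i\<in>F. subst_exponent \<rho> (f i))"
  by (induction F rule: infinite_finite_induct) (simp_all add: subst_exponent_add)

lemma keys_subst_exponent: "keys (subst_exponent \<rho> m) \<subseteq> \<rho> ` keys m"
  unfolding subst_exponent_def
  using keys_sum[of "\<lambda>v. single (\<rho> v) (lookup m v)" "keys m"]
  by (auto split: if_splits)

lemma subst_mpoly_add: "subst_mpoly \<rho> (p + q) = subst_mpoly \<rho> p + subst_mpoly \<rho> q"
  unfolding subst_mpoly_def by (rule setsum_keys_plus_distrib) (simp_all add: single_add)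

lemma subst_mpoly_0 [simp]: "subst_mpoly \<rho> 0 = 0"
  by (simp add: subst_mpoly_def)

lemma subst_mpoly_single [simp]:
  "subst_mpoly \<rho> (single m c) = single (subst_exponent \<rho> m) c"
  by (simp add: subst_mpoly_def)

lemma subst_mpoly_sum: "subst_mpoly \<rho> (\<Sum>i\<in>F. f i) = (\<Sum>i\<in>F. subst_mpoly \<rho> (f i))"
  by (induction F rule: infinite_finite_induct) (simp_all add: subst_mpoly_add)

lemma subst_mpoly_diff: "subst_mpoly \<rho> (p - q) = subst_mpoly \<rho> p - subst_mpoly \<rho> q"
  using subst_mpoly_add[of \<rho> "p - q" q] by simp

lemma subst_mpoly_var: "subst_mpoly \<rho> (var v) = var (\<rho> v)"
  by (simp add: var_def)

lemma subst_mpoly_mult: "subst_mpoly \<rho> (p * q) = subst_mpoly \<rho> p * subst_mpoly \<rho> q"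
proof -
  let ?t = "\<lambda>p m. single m (lookup p m)"
  have "p * q = (\<Sum>m\<in>keys p. ?t p m) * (\<Sum>n\<in>keys q. ?t q n)"
    using mpoly_sum_monomials[of p] mpoly_sum_monomials[of q] by simp
  also have "\<dots> = (\<Sum>m\<in>keys p. \<Sum>n\<in>keys q. ?t p m * ?t q n)"
    by (rule sum_product)
  finally have "subst_mpoly \<rho> (p * q) = (\<Sum>m\<in>keys p. \<Sum>n\<in>keys q.
      single (subst_exponent \<rho> m) (lookup p m) *
      single (subst_exponent \<rho> n) (lookup q n))"
    by (simp add: subst_mpoly_sum mult_single subst_exponent_add)
  also have "\<dots> = subst_mpoly \<rho> p * subst_mpoly \<rho> q"
    unfolding subst_mpoly_def by (rule sum_product[symmetric])
  finally show ?thesis .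
qed

lemma keys_subst_mpoly: "keys (subst_mpoly \<rho> p) \<subseteq> subst_exponent \<rho> ` keys p"
  unfolding subst_mpoly_def
  using keys_sum[of "\<lambda>m. single (subst_exponent \<rho> m) (lookup p m)" "keys p"]
  by (auto split: if_splits)

lemma subst_mpoly_carrier:
  assumes "\<rho> ` X \<subseteq> X" "p \<in> carrier (mpoly_ring X)"
  shows "subst_mpoly \<rho> p \<in> carrier (mpoly_ring X)"
  unfolding mem_mpoly_carrier
proof
  fix m assume "m \<in> keys (subst_mpoly \<rho> p)"
  then obtain k where "k \<in> keys p" "m = subst_exponent \<rho> k" using keys_subst_mpoly by blast
  then show "keys m \<subseteq> X"
    using keys_subst_exponent[of \<rho> k] assms unfolding mem_mpoly_carrier by blast
qed

text \<open>The variables of a monomial can be replaced one after the other, each step changing it by a multiple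
  of a difference in \<open>A\<close>.\<close>

lemma diff_subst_mpoly_mem:
  fixes A :: "('v, 'k::field) mpoly set"
  assumes A: "ideal A (mpoly_ring X)" and \<rho>: "\<rho> ` X \<subseteq> X"
    and v: "\<And>v. v \<in> X \<Longrightarrow> var v - var (\<rho> v) \<in> A" and p: "p \<in> carrier (mpoly_ring X)"
  shows "p - subst_mpoly \<rho> p \<in> A"
proof -
  have mono: "single m 1 - single (subst_exponent \<rho> m) 1 \<in> A"
    if "keys m \<subseteq> X" for m
    using that
  proof (induction "total_degree m" arbitrary: m rule: less_induct)
    case less
    show ?case
    proof (cases "m = 0")
      case True
      then show ?thesis using mpoly_ideal_0[OF A] by simp
    next
      case False
      then have "keys m \<noteq> {}" by simp
      then obtain v where vm: "v \<in> keys m" by blast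
      define k where "k = m - single v 1"
      have "(m - single v 1) + single v 1 = m"
        by (rule le_imp_add_nat) (use vm in \<open>auto simp: lookup_single when_def in_keys_iff\<close>)
      then have eq: "m = single v 1 + k"
        by (simp add: k_def add.commute)
      have "total_degree m = Suc (total_degree k)" unfolding eq total_degree_add by (simp add: total_degree_def)
      moreover have kX: "keys k \<subseteq> X" and vX: "v \<in> X"
        using less.prems vm unfolding eq by (auto simp: keys_plus_nat)
      ultimately have IH: "single k 1 - single (subst_exponent \<rho> k) 1 \<in> A"
        using less.hyps by simp
      let ?hk = "single (subst_exponent \<rho> k) (1::'k)"
      have hk: "?hk \<in> carrier (mpoly_ring X)"
        by (rule mpoly_carrier_single) (use keys_subst_exponent[of \<rho> k] \<rho> kX in blast)
      have "single m 1 = var v * single k (1::'k)"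
        by (simp add: eq var_def mult_single)
      moreover have "single (subst_exponent \<rho> m) 1 = var (\<rho> v) * ?hk"
        by (simp add: eq subst_exponent_add var_def mult_single)
      ultimately have "single m 1 - single (subst_exponent \<rho> m) 1 =
          var v * (single k 1 - ?hk) + ?hk * (var v - var (\<rho> v))"
        by (simp add: algebra_simps)
      also have "\<dots> \<in> A"
        by (rule mpoly_ideal_add[OF A mpoly_ideal_mult[OF A mpoly_carrier_var[OF vX] IH] mpoly_ideal_mult[OF A hk v[OF vX]]])
      finally show ?thesis .
    qed
  qed
  have "p - subst_mpoly \<rho> p = (\<Sum>m\<in>keys p. single m (lookup p m))
     - (\<Sum>m\<in>keys p. single (subst_exponent \<rho> m) (lookup p m))"
    using mpoly_sum_monomials[of p] by (simp add: subst_mpoly_def)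
  also have "\<dots> = (\<Sum>m\<in>keys p. single 0 (lookup p m) *
      (single m 1 - single (subst_exponent \<rho> m) 1))"
    by (simp add: sum_subtractf right_diff_distrib mult_single)
  also have "\<dots> \<in> A"
    by (intro mpoly_ideal_sum[OF A] mpoly_ideal_mult[OF A] mpoly_carrier_const mono)
      (use p in \<open>simp add: mem_mpoly_carrier\<close>)
  finally show ?thesis .
qed

lemma lookup_var_times:
  fixes p :: "('v, 'k::field) mpoly"
  shows "lookup (var v * p) m =
    (if lookup m v = 0 then 0 else lookup p (m - single v 1))"
proof (cases "lookup m v = 0")
  case True
  have "m \<notin> keys (var v * p)"
  proof
    assume "m \<in> keys (var v * p)"
    then obtain k where "m = single v 1 + k"
      using keys_single_times[of "single v 1" 1 p] by (auto simp: var_def)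
    then show False using True by (simp add: lookup_add)
  qed
  then show ?thesis using True by (simp add: in_keys_iff)
next
  case False
  have "(m - single v 1) + single v 1 = m"
    by (rule le_imp_add_nat) (use False in \<open>auto simp: lookup_single when_def\<close>)
  then have "m = single v 1 + (m - single v 1)"
    by (simp add: add.commute)
  then have "lookup (var v * p) m =
      lookup (var v * p) (single v 1 + (m - single v 1))" by simp
  also have "\<dots> = lookup p (m - single v 1)"
    unfolding var_def lookup_single_times by simp
  finally show ?thesis using False by simp
qed

text \<open>A criterion for \<open>x\<^sub>z - x\<^sub>y\<close> to be a nonzerodivisor modulo the monomial ideal of \<open>M\<close>. The assumption
  \<open>reduced\<close> says that the generators have degree at most one in \<open>x\<^sub>z\<close>, and \<open>colon\<close> says that no monomial
  outside the ideal is multiplied into it by both variables. Among the terms of \<open>F\<close> outside \<open>M\<close>, one of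
  largest degree in \<open>x\<^sub>z\<close> has a multiple by \<open>x\<^sub>z\<close> that cannot cancel outside \<open>M\<close>, so this multiple lies
  in \<open>M\<close>. By \<open>reduced\<close> the degree is zero; then the multiple by \<open>x\<^sub>y\<close> cannot cancel either and lies in
  \<open>M\<close> as well, contradicting \<open>colon\<close>.\<close>

lemma var_diff_nonzerodivisor_monomial:
  fixes F :: "('v, 'k::field) mpoly"
  assumes up: "\<And>m m'. m \<in> M \<Longrightarrow> m' + m \<in> M" and yz: "y \<noteq> z"
    and reduced: "\<And>m. lookup m z \<noteq> 0 \<Longrightarrow> m + single z 1 \<in> M \<Longrightarrow> m \<in> M"
    and colon: "\<And>m. m + single y 1 \<in> M \<Longrightarrow> m + single z 1 \<in> M \<Longrightarrow> m \<in> M"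
    and F: "keys ((var z - var y) * F) \<subseteq> M"
  shows "keys F \<subseteq> M"
proof (rule ccontr)
  let ?z = "single z (1::nat)" and ?y = "single y (1::nat)"
  define B where "B = keys F - M"
  assume "\<not> keys F \<subseteq> M"
  then have B: "finite B" "B \<noteq> {}" by (auto simp: B_def)
  have "Max ((\<lambda>m. lookup m z) ` B) \<in> (\<lambda>m. lookup m z) ` B"
    using B by (intro Max_in) auto
  then obtain m where m: "m \<in> B" and mmax: "Max ((\<lambda>m. lookup m z) ` B) = lookup m z"
    by auto
  have max: "lookup k z \<le> lookup m z" if "k \<in> B" for k
    unfolding mmax[symmetric] using that B by (intro Max_ge) auto
  have Fm: "lookup F m \<noteq> 0" "m \<notin> M" using m by (auto simp: B_def in_keys_iff)
  have coeff: "lookup (var z * F) k = lookup (var y * F) k" if "k \<notin> M" for k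
  proof -
    have "k \<notin> keys ((var z - var y) * F)" using F that by blast
    then show ?thesis by (simp add: in_keys_iff left_diff_distrib lookup_minus)
  qed
  have mz: "m + ?z \<in> M"
  proof (rule ccontr)
    assume no: "m + ?z \<notin> M"
    \<comment> \<open>the only other term of \<open>F\<close> that can cancel the one at \<open>m\<close>; its degree in \<open>z\<close> is larger by one\<close>
    let ?k = "m + ?z - ?y"
    have "lookup (var z * F) (m + ?z) = lookup F m"
      by (simp add: lookup_var_times lookup_add)
    then have *: "lookup (var y * F) (m + ?z) \<noteq> 0" using coeff[OF no] Fm by simp
    then have ne: "lookup (m + ?z) y \<noteq> 0" and k: "lookup F ?k \<noteq> 0"
      by (auto simp: lookup_var_times split: if_splits)
    have eq: "?k + ?y = m + ?z"
      by (rule le_imp_add_nat) (use ne in \<open>auto simp: lookup_single when_def\<close>)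
    have "?k \<notin> M" using up[of ?k ?y] no eq by (metis add.commute)
    then have "?k \<in> B" using k by (simp add: B_def in_keys_iff)
    moreover have "lookup ?k z = Suc (lookup m z)"
      using yz by (simp add: lookup_minus lookup_add lookup_single when_def)
    ultimately show False using max[of ?k] by simp
  qed
  have z0: "lookup m z = 0" using reduced[OF _ mz] Fm(2) by blast
  have "m + ?y \<in> M"
  proof (rule ccontr)
    assume no: "m + ?y \<notin> M"
    have "lookup (m + ?y) z = 0"
      using z0 yz by (simp add: lookup_add lookup_single when_def)
    then have "lookup (var z * F) (m + ?y) = 0" by (simp add: lookup_var_times)
    moreover have "lookup (var y * F) (m + ?y) = lookup F m"
      by (simp add: lookup_var_times lookup_add)
    ultimately show False using coeff[OF no] Fm(1) by simp
  qed
  then show False using colon mz Fm(2) by blast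
qed

definition collapse :: "('v \<Rightarrow> 'v) \<Rightarrow> 'v set \<Rightarrow> 'v \<Rightarrow> 'v" where
  "collapse y Z v = (if v \<in> Z then y v else v)"

text \<open>The exponents of the monomials in the ideal generated by the images of the edge monomials under the
  substitution \<open>\<rho>\<close>.\<close>

definition collapsed_multiples :: "('v \<Rightarrow> 'v) \<Rightarrow> 'v set set \<Rightarrow> ('v \<Rightarrow>\<^sub>0 nat) set" where
  "collapsed_multiples \<rho> E = {m. \<exists>e\<in>E. \<forall>w. lookup (subst_exponent \<rho> (sqfree_exponent e)) w \<le> lookup m w}"

lemma collapsed_multiples_up: "m \<in> collapsed_multiples \<rho> E \<Longrightarrow> m' + m \<in> collapsed_multiples \<rho> E"
  unfolding collapsed_multiples_def by (fastforce simp: lookup_add intro: trans_le_add2)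

text \<open>Dividing by the first \<open>j\<close> differences identifies variables: a polynomial lies in the ideal generated
  by \<open>I\<close> and these differences if and only if its image under the substitution lies in the monomial
  ideal generated by the images of the edge monomials. So the preceding criterion applies at each
  stage.\<close>

theorem depth_quotient_ge:
  fixes I :: "('v::linorder, 'k::field) mpoly set"
  assumes I: "I = monomial_ideal X (edge_multiples E)"
    and E: "\<And>e. e \<in> E \<Longrightarrow> finite e \<and> e \<subseteq> X \<and> e \<noteq> {}"
    and zs: "distinct zs" "set zs \<subseteq> X" and y: "\<And>z. z \<in> set zs \<Longrightarrow> y z \<in> X - set zs"
    and reduced: "\<And>j m. j < length zs \<Longrightarrow> lookup m (zs ! j) \<noteq> 0 \<Longrightarrow>
        m + single (zs ! j) 1 \<in> collapsed_multiples (collapse y (set (take j zs))) E \<Longrightarrow>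
        m \<in> collapsed_multiples (collapse y (set (take j zs))) E"
    and colon: "\<And>j m. j < length zs \<Longrightarrow>
        m + single (y (zs ! j)) 1 \<in> collapsed_multiples (collapse y (set (take j zs))) E \<Longrightarrow>
        m + single (zs ! j) 1 \<in> collapsed_multiples (collapse y (set (take j zs))) E \<Longrightarrow>
        m \<in> collapsed_multiples (collapse y (set (take j zs))) E"
  shows "depth (mpoly_ring X Quot I) ((+>\<^bsub>mpoly_ring X\<^esub>) I ` graded_maximal_ideal X) \<ge> enat (length zs)"
proof -
  let ?R = "mpoly_ring X :: ('v, 'k) mpoly ring"
  interpret cring ?R by (rule mpoly_ring_cring)
  define \<theta> where "\<theta> z = (var z - var (y z) :: ('v, 'k) mpoly)" for z
  define fs where "fs = map \<theta> zs"
  have idI: "ideal I ?R"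
    unfolding I by (rule monomial_ideal_ideal) (auto simp: edge_multiples_def keys_plus_nat)
  have \<theta>R: "\<theta> z \<in> carrier ?R" if "z \<in> set zs" for z
    unfolding \<theta>_def using that zs(2) y[OF that] by (intro mpoly_carrier_diff mpoly_carrier_var) auto
  have fsR: "set fs \<subseteq> carrier ?R" using \<theta>R by (auto simp: fs_def)
  have edge: "single (sqfree_exponent e) 1 \<in> I" if "e \<in> E" for e
    unfolding I monomial_ideal_def using E[OF that] that
    by (auto simp: edge_multiples_def keys_sqfree_exponent intro!: mpoly_carrier_single)
  have mem: "f \<in> Idl\<^bsub>?R\<^esub> (I \<union> set (take j fs)) \<longleftrightarrow>
      keys (subst_mpoly (collapse y (set (take j zs))) f) \<subseteq> collapsed_multiples (collapse y (set (take j zs))) E"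
    if f: "f \<in> carrier ?R" for f j
  proof -
    let ?Z = "set (take j zs)"
    let ?\<rho> = "collapse y ?Z"
    let ?M = "collapsed_multiples ?\<rho> E"
    have Z: "?Z \<subseteq> set zs" by (rule set_take_subset)
    have \<rho>X: "?\<rho> ` X \<subseteq> X" using y Z by (auto simp: collapse_def)
    have fsj: "set (take j fs) = \<theta> ` ?Z" by (simp add: fs_def take_map)
    have sub: "I \<union> set (take j fs) \<subseteq> carrier ?R"
      using mpoly_ideal_subset[OF idI] fsR set_take_subset[of j fs] by blast
    let ?A = "Idl\<^bsub>?R\<^esub> (I \<union> set (take j fs))"
    have A: "ideal ?A ?R" by (rule genideal_ideal[OF sub])
    have subA: "I \<union> set (take j fs) \<subseteq> ?A" by (rule genideal_self[OF sub])
    let ?K = "{f \<in> carrier ?R. keys (subst_mpoly ?\<rho> f) \<subseteq> ?M}"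
    have K: "ideal ?K ?R"
    proof (rule mpoly_idealI)
      show "a + b \<in> ?K" if "a \<in> ?K" "b \<in> ?K" for a b
        using that Poly_Mapping.keys_add[of "subst_mpoly ?\<rho> a" "subst_mpoly ?\<rho> b"]
        by (auto simp: mpoly_carrier_add subst_mpoly_add)
      show "r * a \<in> ?K" if r: "r \<in> carrier ?R" and a: "a \<in> ?K" for r a
      proof -
        have "keys (subst_mpoly ?\<rho> r * subst_mpoly ?\<rho> a) \<subseteq> ?M"
        proof
          fix m assume "m \<in> keys (subst_mpoly ?\<rho> r * subst_mpoly ?\<rho> a)"
          then obtain k l where "m = k + l" "l \<in> keys (subst_mpoly ?\<rho> a)"
            using keys_mult[of "subst_mpoly ?\<rho> r" "subst_mpoly ?\<rho> a"] by blast
          then show "m \<in> ?M" using a collapsed_multiples_up by blast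
        qed
        then show ?thesis using r a by (simp add: mpoly_carrier_mult subst_mpoly_mult)
      qed
    qed auto
    have IK: "I \<subseteq> ?K"
    proof
      fix p assume p: "p \<in> I"
      have "keys (subst_mpoly ?\<rho> p) \<subseteq> ?M"
      proof
        fix m assume "m \<in> keys (subst_mpoly ?\<rho> p)"
        then obtain k where k: "k \<in> keys p" "m = subst_exponent ?\<rho> k" using keys_subst_mpoly by blast
        then obtain e where e: "e \<in> E" "e \<subseteq> keys k"
          using p by (auto simp: I monomial_ideal_def edge_multiples_def)
        have "(k - sqfree_exponent e) + sqfree_exponent e = k"
          by (rule le_imp_add_nat) (use e E[OF e(1)] in \<open>auto simp: lookup_sqfree_exponent in_keys_iff Suc_le_eq\<close>)
        then have "m = subst_exponent ?\<rho> (k - sqfree_exponent e) + subst_exponent ?\<rho> (sqfree_exponent e)"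
          using k(2) by (simp flip: subst_exponent_add)
        then show "m \<in> ?M"
          unfolding collapsed_multiples_def using e(1) by (auto simp: lookup_add intro!: bexI[of _ e])
      qed
      then show "p \<in> ?K" using mpoly_ideal_subset[OF idI p] by simp
    qed
    have \<theta>K: "set (take j fs) \<subseteq> ?K"
    proof
      fix p assume "p \<in> set (take j fs)"
      then obtain z where z: "z \<in> ?Z" "p = \<theta> z" using fsj by auto
      then have "?\<rho> z = y z" "?\<rho> (y z) = y z" using y Z by (auto simp: collapse_def)
      then have "subst_mpoly ?\<rho> p = 0" by (simp add: z(2) \<theta>_def subst_mpoly_diff subst_mpoly_var)
      then show "p \<in> ?K" using \<theta>R z Z by auto
    qed
    have AK: "?A \<subseteq> ?K" by (rule genideal_minimal[OF K]) (use IK \<theta>K in blast)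
    have varA: "var v - var (?\<rho> v) \<in> ?A" if "v \<in> X" for v
    proof (cases "v \<in> ?Z")
      case True
      then have "\<theta> v \<in> ?A" using subA fsj by blast
      then show ?thesis using True by (simp add: \<theta>_def collapse_def)
    next
      case False
      then show ?thesis using mpoly_ideal_0[OF A] by (simp add: collapse_def)
    qed
    have MA: "monomial_ideal X ?M \<subseteq> ?A"
    proof (rule monomial_ideal_subset[OF A])
      fix m :: "'v \<Rightarrow>\<^sub>0 nat"
      assume m: "m \<in> ?M" and mX: "keys m \<subseteq> X"
      then obtain e where e: "e \<in> E" and le: "\<And>w. lookup (subst_exponent ?\<rho> (sqfree_exponent e)) w \<le> lookup m w"
        by (auto simp: collapsed_multiples_def)
      let ?e = "single (sqfree_exponent e) (1::'k)"
      let ?he = "subst_exponent ?\<rho> (sqfree_exponent e)"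
      have eA: "?e \<in> ?A" using edge[OF e] subA by blast
      have "?e - subst_mpoly ?\<rho> ?e \<in> ?A"
        by (rule diff_subst_mpoly_mem[OF A \<rho>X varA mpoly_ideal_subset[OF A eA]])
      then have "?e - (?e - subst_mpoly ?\<rho> ?e) \<in> ?A" using mpoly_ideal_diff[OF A eA] by blast
      then have heA: "single ?he 1 \<in> ?A" by simp
      have eq: "(m - ?he) + ?he = m" by (rule le_imp_add_nat) (rule le)
      have "keys (m - ?he) \<subseteq> X" using mX keys_plus_nat[of "m - ?he" ?he] eq by auto
      then have "single (m - ?he) 1 * single ?he 1 \<in> ?A"
        by (intro mpoly_ideal_mult[OF A _ heA] mpoly_carrier_single)
      then show "single m 1 \<in> ?A" using eq by (simp add: mult_single)
    qed
    show ?thesis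
    proof
      assume "f \<in> ?A"
      then show "keys (subst_mpoly ?\<rho> f) \<subseteq> ?M" using AK by blast
    next
      assume "keys (subst_mpoly ?\<rho> f) \<subseteq> ?M"
      then have "subst_mpoly ?\<rho> f \<in> ?A"
        using MA subst_mpoly_carrier[OF \<rho>X f] by (auto simp: monomial_ideal_def)
      then have "(f - subst_mpoly ?\<rho> f) + subst_mpoly ?\<rho> f \<in> ?A"
        by (intro mpoly_ideal_add[OF A] diff_subst_mpoly_mem[OF A \<rho>X varA f])
      then show "f \<in> ?A" by simp
    qed
  qed
  have "regular_sequence (?R Quot I) (map ((+>\<^bsub>?R\<^esub>) I) fs)"
    unfolding regular_sequence_quotient_iff[OF idI fsR]
  proof (intro conjI allI impI ballI)
    fix j a assume j: "j < length fs" and a: "a \<in> carrier ?R"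
      and fa: "fs ! j \<otimes>\<^bsub>?R\<^esub> a \<in> Idl\<^bsub>?R\<^esub> (I \<union> set (take j fs))"
    have jz: "j < length zs" using j by (simp add: fs_def)
    let ?Z = "set (take j zs)"
    let ?\<rho> = "collapse y ?Z"
    let ?z = "zs ! j"
    have zin: "?z \<in> set zs" using jz by simp
    have "?z \<notin> ?Z" using zs(1) jz by (auto simp: in_set_conv_nth nth_eq_iff_index_eq)
    then have z\<rho>: "?\<rho> ?z = ?z" by (simp add: collapse_def)
    have y\<rho>: "?\<rho> (y ?z) = y ?z" using y[OF zin] set_take_subset[of j zs] by (auto simp: collapse_def)
    have fj: "fs ! j = \<theta> ?z" using jz by (simp add: fs_def)
    have "\<theta> ?z * a \<in> carrier ?R" by (rule mpoly_carrier_mult[OF \<theta>R[OF zin] a])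
    then have "keys (subst_mpoly ?\<rho> (\<theta> ?z * a)) \<subseteq> collapsed_multiples ?\<rho> E"
      using fa mem fj by simp
    then have "keys ((var ?z - var (y ?z)) * subst_mpoly ?\<rho> a) \<subseteq> collapsed_multiples ?\<rho> E"
      by (simp add: subst_mpoly_mult \<theta>_def subst_mpoly_diff subst_mpoly_var z\<rho> y\<rho>)
    then have "keys (subst_mpoly ?\<rho> a) \<subseteq> collapsed_multiples ?\<rho> E"
    proof (rule var_diff_nonzerodivisor_monomial[rotated -1])
      show "y ?z \<noteq> ?z" using y[OF zin] zin by auto
    qed (use collapsed_multiples_up reduced[OF jz] colon[OF jz] in blast)+
    then show "a \<in> Idl\<^bsub>?R\<^esub> (I \<union> set (take j fs))" using mem[OF a] by simp
  next
    show "Idl\<^bsub>?R\<^esub> (I \<union> set fs) \<noteq> carrier ?R"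
    proof
      assume "Idl\<^bsub>?R\<^esub> (I \<union> set fs) = carrier ?R"
      then have "1 \<in> Idl\<^bsub>?R\<^esub> (I \<union> set (take (length zs) fs))"
        using mpoly_carrier_1[of X] by (simp add: fs_def)
      then have "keys (subst_mpoly (collapse y (set zs)) (1 :: ('v, 'k) mpoly)) \<subseteq> collapsed_multiples (collapse y (set zs)) E"
        using mem[OF mpoly_carrier_1, of "length zs"] by simp
      moreover have "subst_mpoly (collapse y (set zs)) 1 = (1 :: ('v, 'k) mpoly)"
        using subst_mpoly_single[of _ 0 "1::'k"] by (simp add: single_one)
      ultimately have "0 \<in> collapsed_multiples (collapse y (set zs)) E" by simp
      then obtain e where e: "e \<in> E"
        "\<And>w. lookup (subst_exponent (collapse y (set zs)) (sqfree_exponent e)) w = 0"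
        by (auto simp: collapsed_multiples_def)
      obtain v where v: "v \<in> e" using E[OF e(1)] by blast
      have "(\<Sum>u\<in>e. lookup (single (collapse y (set zs) u) (1::nat)) (collapse y (set zs) v)) = 0"
        using e(2)[of "collapse y (set zs) v"]
        by (simp add: sqfree_exponent_def subst_exponent_sum lookup_sum)
      then have "\<forall>u\<in>e. lookup (single (collapse y (set zs) u) (1::nat)) (collapse y (set zs) v) = 0"
        using E[OF e(1)] by (subst (asm) sum_eq_0_iff) auto
      then show False using v by auto
    qed
  qed
  moreover have "set (map ((+>\<^bsub>?R\<^esub>) I) fs) \<subseteq> (+>\<^bsub>?R\<^esub>) I ` graded_maximal_ideal X"
  proof -
    have vX: "var ` X \<subseteq> carrier ?R" by (auto intro: mpoly_carrier_var)
    have m: "ideal (graded_maximal_ideal X :: ('v, 'k) mpoly set) ?R"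
      unfolding graded_maximal_ideal_def by (rule genideal_ideal[OF vX])
    have vm: "var v \<in> (graded_maximal_ideal X :: ('v, 'k) mpoly set)" if "v \<in> X" for v
      unfolding graded_maximal_ideal_def using genideal_self[OF vX] that by blast
    have "\<theta> z \<in> graded_maximal_ideal X" if "z \<in> set zs" for z
      unfolding \<theta>_def using that zs(2) y[OF that] by (intro mpoly_ideal_diff[OF m] vm) auto
    then show ?thesis by (auto simp: fs_def)
  qed
  ultimately have "enat (length (map ((+>\<^bsub>?R\<^esub>) I) fs)) \<le>
      depth (?R Quot I) ((+>\<^bsub>?R\<^esub>) I ` graded_maximal_ideal X)"
    unfolding depth_def by (intro SUP_upper) blast
  then show ?thesis by (simp add: fs_def)
qed

section \<open>Staircase edges\<close>

definition staircase :: "nat \<Rightarrow> nat \<Rightarrow> (nat \<Rightarrow> nat) \<Rightarrow> bool" where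
  "staircase d s a \<longleftrightarrow> (\<forall>l\<in>{1..d}. a l < s) \<and> (\<forall>l\<in>{1..d}. \<forall>l'\<in>{1..d}. l \<le> l' \<longrightarrow> a l \<le> a l')"

text \<open>Here \<open>x l a\<close> is the vertex at position \<open>a\<close> of level \<open>l\<close>.\<close>

definition staircase_edges :: "nat \<Rightarrow> nat \<Rightarrow> (nat \<Rightarrow> nat \<Rightarrow> 'v) \<Rightarrow> 'v set set" where
  "staircase_edges d s x = {(\<lambda>l. x l (a l)) ` {1..d} | a. staircase d s a}"

context
  fixes d s :: nat and x :: "nat \<Rightarrow> nat \<Rightarrow> 'v"
  assumes inj: "\<And>l l' a a'. l \<in> {1..d} \<Longrightarrow> l' \<in> {1..d} \<Longrightarrow> a < s \<Longrightarrow> a' < s \<Longrightarrow> x l a = x l' a' \<Longrightarrow> l = l' \<and> a = a'"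
begin

text \<open>One stage of an identification of every vertex \<open>x l a\<close> with \<open>x 1 a\<close>: it is complete for the levels
  below \<open>l0\<close>, has not begun above \<open>l0\<close>, and at level \<open>l0\<close> the position \<open>a0\<close> is about to be treated. The
  variable of \<open>x l a\<close> currently stands for \<open>R l a\<close>.\<close>

context
  fixes R :: "nat \<Rightarrow> nat \<Rightarrow> 'v" and l0 a0 :: nat
  assumes l0: "l0 \<in> {2..d}" and a0: "a0 < s"
    and below: "\<And>l a. l \<in> {1..d} \<Longrightarrow> a < s \<Longrightarrow> l < l0 \<Longrightarrow> R l a = x 1 a"
    and above: "\<And>l a. l \<in> {1..d} \<Longrightarrow> a < s \<Longrightarrow> l0 < l \<Longrightarrow> R l a = x l a"
    and at: "\<And>a. a < s \<Longrightarrow> R l0 a = x l0 a \<or> R l0 a = x 1 a" and at0: "R l0 a0 = x l0 a0"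
begin

lemma one_neq_level: "a < s \<Longrightarrow> a' < s \<Longrightarrow> l \<in> {2..d} \<Longrightarrow> x l a \<noteq> x 1 a'"
  using inj[of l 1 a a'] by auto

lemma staircase_degree_current:
  assumes a: "staircase d s a"
  shows "(\<Sum>l\<in>{1..d}. if R l (a l) = x l0 a0 then 1 else 0 :: nat) = (if a l0 = a0 then 1 else 0)"
proof -
  have as: "a l < s" if "l \<in> {1..d}" for l using a that by (simp add: staircase_def)
  have l0d: "l0 \<in> {1..d}" using l0 by auto
  have "R l (a l) = x l0 a0 \<longleftrightarrow> l = l0 \<and> a l0 = a0" if l: "l \<in> {1..d}" for l
  proof (cases l l0 rule: linorder_cases)
    case less
    then show ?thesis using below[OF l as[OF l] less] one_neq_level[OF a0 as[OF l] l0] by auto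
  next
    case equal
    then show ?thesis
      using at[OF as[OF l0d]] at0 one_neq_level[OF a0 as[OF l0d] l0] inj[OF l0d l0d as[OF l0d] a0] by metis
  next
    case greater
    then show ?thesis using above[OF l as[OF l] greater] inj[OF l l0d as[OF l] a0] by auto
  qed
  then have "(\<Sum>l\<in>{1..d}. if R l (a l) = x l0 a0 then 1 else 0 :: nat) = (\<Sum>l\<in>{1..d}. if l = l0 then (if a l0 = a0 then 1 else 0) else 0)"
    by (intro sum.cong) auto
  also have "\<dots> = (if a l0 = a0 then 1 else 0)" using l0d by simp
  finally show ?thesis .
qed

text \<open>The heart of the regularity proof, where \<open>G a\<close> is the exponent of the generator of \<open>a\<close> at the current
  stage. Suppose that \<open>M\<close> is divisible by no generator, but becomes divisible by that of \<open>a\<close> after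
  multiplication with \<open>x 1 a0\<close> and by that of \<open>b\<close> after multiplication with \<open>x l0 a0\<close>. Then \<open>b\<close> takes the
  value \<open>a0\<close> at level \<open>l0\<close>, while \<open>a\<close> takes it at an earlier level and exceeds it at level \<open>l0\<close>. Following
  \<open>b\<close> below \<open>l0\<close> and \<open>a\<close> from \<open>l0\<close> on is again a staircase, and its generator divides \<open>M\<close>: the two parts
  involve different variables, with positions at most \<open>a0\<close> and above \<open>a0\<close>.\<close>

lemma staircase_exchange:
  fixes M :: "'v \<Rightarrow> nat"
  defines "G \<equiv> \<lambda>a w. (\<Sum>l\<in>{1..d}. if R l (a l) = w then 1 else 0 :: nat)"
  assumes a: "staircase d s a" and b: "staircase d s b"
    and Ga: "\<And>w. G a w \<le> M w + (if w = x 1 a0 then 1 else 0)"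
    and Gb: "\<And>w. G b w \<le> M w + (if w = x l0 a0 then 1 else 0)"
  shows "\<exists>c. staircase d s c \<and> (\<forall>w. G c w \<le> M w)"
proof (rule ccontr)
  assume no: "\<not> ?thesis"
  have as: "a l < s" "b l < s" if "l \<in> {1..d}" for l using a b that by (simp_all add: staircase_def)
  have amono: "a l \<le> a l'" "b l \<le> b l'" if "l \<in> {1..d}" "l' \<in> {1..d}" "l \<le> l'" for l l'
    using a b that by (simp_all add: staircase_def)
  have l0d: "l0 \<in> {1..d}" and one: "1 \<in> {1..d}" using l0 by auto
  have ne: "x l0 a0 \<noteq> x 1 a0" by (rule one_neq_level[OF a0 a0 l0])
  have Gz: "G c (x l0 a0) = (if c l0 = a0 then 1 else 0)" if "staircase d s c" for c
    unfolding G_def by (rule staircase_degree_current[OF that])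
  obtain w where "G b w > M w" using no b by (auto simp: not_le)
  then have "w = x l0 a0" "G b w > M w" using Gb[of w] by (auto split: if_splits)
  then have bz: "b l0 = a0" and Mz: "M (x l0 a0) = 0" using Gz[OF b] by (auto split: if_splits)
  have az: "a l0 \<noteq> a0" using Ga[of "x l0 a0"] Gz[OF a] Mz ne by auto
  obtain w where "G a w > M w" using no a by (auto simp: not_le)
  then have "w = x 1 a0" "G a w > M w" using Ga[of w] by (auto split: if_splits)
  then have "G a (x 1 a0) \<noteq> 0" by auto
  then have "\<exists>l\<in>{1..d}. (if R l (a l) = x 1 a0 then 1 else 0 :: nat) \<noteq> 0"
    unfolding G_def using sum.not_neutral_contains_not_neutral by blast
  then obtain l where l: "l \<in> {1..d}" "R l (a l) = x 1 a0" by (auto split: if_splits)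
  have "l \<le> l0"
  proof (rule ccontr)
    assume "\<not> l \<le> l0"
    then have "l > l0" by simp
    then show False using l above[OF l(1) as(1)[OF l(1)]] one_neq_level[OF as(1)[OF l(1)] a0, of l] l0 by auto
  qed
  moreover have "l \<noteq> l0"
    using l at[OF as(1)[OF l0d]] one_neq_level[OF as(1)[OF l0d] a0 l0] inj[OF one one as(1)[OF l0d] a0] az by metis
  ultimately have ll0: "l < l0" by simp
  then have "a l = a0" using below[OF l(1) as(1)[OF l(1)]] l(2) inj[OF one one as(1)[OF l(1)] a0] by metis
  then have gt: "a l0 > a0" using amono(1)[OF l(1) l0d] ll0 az by simp
  define c where "c l = (if l < l0 then b l else a l)" for l
  have blow: "b l \<le> a0" if "l \<in> {1..d}" "l < l0" for l using amono(2)[OF that(1) l0d] that(2) bz by simp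
  have ahigh: "a l > a0" if "l \<in> {1..d}" "l0 \<le> l" for l using amono(1)[OF l0d that] gt by simp
  have c: "staircase d s c"
    unfolding staircase_def
  proof (intro conjI ballI impI)
    show "c l < s" if "l \<in> {1..d}" for l using as[OF that] by (simp add: c_def)
    show "c l \<le> c l'" if "l \<in> {1..d}" "l' \<in> {1..d}" "l \<le> l'" for l l'
      using amono[OF that] blow[OF that(1)] ahigh[OF that(2)] that(3) by (fastforce simp: c_def)
  qed
  have splitd: "(\<Sum>l\<in>{1..d}. f l) = (\<Sum>l\<in>{1..<l0}. f l) + (\<Sum>l\<in>{l0..d}. f l)" for f :: "nat \<Rightarrow> nat"
  proof -
    have "{1..d} = {1..<l0} \<union> {l0..d}" using l0 by auto
    then show ?thesis by (simp add: sum.union_disjoint ivl_disj_int)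
  qed
  have "G c w \<le> M w" for w
  proof (cases "\<exists>g\<le>a0. w = x 1 g")
    case True
    then obtain g where g: "g \<le> a0" "w = x 1 g" by blast
    have gs: "g < s" using g a0 by simp
    have "R l (c l) \<noteq> w" if l: "l \<in> {l0..d}" for l
    proof -
      have ld: "l \<in> {1..d}" and l2: "l \<in> {2..d}" using l l0 by auto
      have cl: "c l = a l" using l by (simp add: c_def)
      show ?thesis
      proof (cases "l = l0")
        case True
        then show ?thesis
          using at[OF as(1)[OF l0d]] one_neq_level[OF as(1)[OF l0d] gs l0] inj[OF one one as(1)[OF l0d] gs] gt g cl by auto
      next
        case False
        then show ?thesis
          using above[OF ld as(1)[OF ld]] one_neq_level[OF as(1)[OF ld] gs l2] l g cl by auto
      qed
    qed
    then have "G c w = (\<Sum>l\<in>{1..<l0}. if R l (c l) = w then 1 else 0)"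
      unfolding G_def splitd by simp
    also have "\<dots> = (\<Sum>l\<in>{1..<l0}. if R l (b l) = w then 1 else 0)"
      by (rule sum.cong) (auto simp: c_def)
    also have "\<dots> \<le> G b w" unfolding G_def splitd by simp
    also have "\<dots> \<le> M w" using Gb[of w] one_neq_level[OF a0 gs l0] g(2) by auto
    finally show ?thesis .
  next
    case False
    have "R l (c l) \<noteq> w" if l: "l \<in> {1..<l0}" for l
    proof -
      have ld: "l \<in> {1..d}" using l l0 by auto
      have "R l (c l) = x 1 (b l)" using below[OF ld as(2)[OF ld]] l by (simp add: c_def)
      then show ?thesis using False blow[OF ld] l by auto
    qed
    then have "G c w = (\<Sum>l\<in>{l0..d}. if R l (c l) = w then 1 else 0)"
      unfolding G_def splitd by simp
    also have "\<dots> = (\<Sum>l\<in>{l0..d}. if R l (a l) = w then 1 else 0)"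
      by (rule sum.cong) (auto simp: c_def)
    also have "\<dots> \<le> G a w" unfolding G_def splitd by simp
    also have "\<dots> \<le> M w" using Ga[of w] False by auto
    finally show ?thesis .
  qed
  then show False using no c by blast
qed

end

lemma lookup_subst_staircase_edge:
  assumes a: "staircase d s a"
  shows "lookup (subst_exponent \<rho> (sqfree_exponent ((\<lambda>l. x l (a l)) ` {1..d}))) w
    = (\<Sum>l\<in>{1..d}. if \<rho> (x l (a l)) = w then 1 else 0)"
proof -
  have "inj_on (\<lambda>l. x l (a l)) {1..d}"
  proof (rule inj_onI)
    fix l l' assume "l \<in> {1..d}" "l' \<in> {1..d}" "x l (a l) = x l' (a l')"
    then show "l = l'" using inj[of l l' "a l" "a l'"] a by (simp add: staircase_def)
  qed
  then have "sqfree_exponent ((\<lambda>l. x l (a l)) ` {1..d}) = (\<Sum>l\<in>{1..d}. single (x l (a l)) 1)"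
    unfolding sqfree_exponent_def by (simp add: sum.reindex)
  then show ?thesis by (simp add: subst_exponent_sum lookup_sum lookup_single when_def del: One_nat_def)
qed

lemma mem_collapsed_multiples_staircase:
  "k \<in> collapsed_multiples \<rho> (staircase_edges d s x) \<longleftrightarrow>
    (\<exists>a. staircase d s a \<and> (\<forall>w. (\<Sum>l\<in>{1..d}. if \<rho> (x l (a l)) = w then 1 else 0) \<le> lookup k w))"
proof -
  have "k \<in> collapsed_multiples \<rho> (staircase_edges d s x) \<longleftrightarrow>
    (\<exists>a. staircase d s a \<and> (\<forall>w. lookup (subst_exponent \<rho> (sqfree_exponent ((\<lambda>l. x l (a l)) ` {1..d}))) w \<le> lookup k w))"
    unfolding collapsed_multiples_def staircase_edges_def by blast
  then show ?thesis by (simp only: lookup_subst_staircase_edge cong: conj_cong)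
qed

lemma card_staircase_vertices: "card (\<Union>l\<in>{1..d}. x l ` {..<s}) = d * s"
proof -
  have "(\<Union>l\<in>{1..d}. x l ` {..<s}) = (\<lambda>(l, a). x l a) ` ({1..d} \<times> {..<s})" by auto
  moreover have "inj_on (\<lambda>(l, a). x l a) ({1..d} \<times> {..<s})" using inj by (auto simp: inj_on_def)
  ultimately show ?thesis by (simp add: card_image)
qed

end

text \<open>The vertices of level \<open>l\<close> are identified with those of level one, for \<open>l = 2, \<dots>, d\<close> in turn and by
  increasing position within each level.\<close>

theorem staircase_depth_ge:
  fixes x :: "nat \<Rightarrow> nat \<Rightarrow> 'v::linorder"
  assumes inj: "\<And>l l' a a'. l \<in> {1..d} \<Longrightarrow> l' \<in> {1..d} \<Longrightarrow> a < s \<Longrightarrow> a' < s \<Longrightarrow> x l a = x l' a' \<Longrightarrow> l = l' \<and> a = a'"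
    and X: "X = (\<Union>l\<in>{1..d}. x l ` {..<s})" and d: "d \<ge> 1"
    and I: "I = (monomial_ideal X (edge_multiples (staircase_edges d s x)) :: ('v, 'k::field) mpoly set)"
  shows "depth (mpoly_ring X Quot I) ((+>\<^bsub>mpoly_ring X\<^esub>) I ` graded_maximal_ideal X) \<ge> enat (s * (d - 1))"
proof -
  have multiples_iff: "k \<in> collapsed_multiples \<rho> (staircase_edges d s x) \<longleftrightarrow>
    (\<exists>a. staircase d s a \<and> (\<forall>w. (\<Sum>l\<in>{1..d}. if \<rho> (x l (a l)) = w then 1 else 0) \<le> lookup k w))" for k \<rho>
    by (rule mem_collapsed_multiples_staircase) (rule inj)
  \<comment> \<open>all vertices of the levels from two on, ordered by level and then by position\<close>
  define zs where "zs = map (\<lambda>j. x (2 + j div s) (j mod s)) [0..<s * (d - 1)]"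
  \<comment> \<open>the vertex of level one at the same position\<close>
  define y where "y v = x 1 (SOME a. a < s \<and> (\<exists>l\<in>{1..d}. v = x l a))" for v
  have y: "y (x l a) = x 1 a" if "l \<in> {1..d}" "a < s" for l a
  proof -
    have "(SOME a'. a' < s \<and> (\<exists>l'\<in>{1..d}. x l a = x l' a')) = a"
      by (rule some_equality) (use that inj in blast)+
    then show ?thesis by (simp add: y_def)
  qed
  have len: "length zs = s * (d - 1)" by (simp add: zs_def)
  have idx: "2 + j div s \<in> {2..d}" "j mod s < s" if "j < s * (d - 1)" for j
  proof -
    have "j div s < d - 1" using that by (simp add: less_mult_imp_div_less mult.commute)
    then show "2 + j div s \<in> {2..d}" by auto
    have "s \<noteq> 0" using that by (cases "s = 0") auto
    then show "j mod s < s" by simp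
  qed
  have nth: "zs ! j = x (2 + j div s) (j mod s)" if "j < s * (d - 1)" for j
    using that by (simp add: zs_def)
  have Zmem: "x l a \<in> set (take j zs) \<longleftrightarrow> 2 \<le> l \<and> (l - 2) * s + a < j"
    if j: "j \<le> s * (d - 1)" and l: "l \<in> {1..d}" and a: "a < s" for j l a
  proof -
    have set: "set (take j zs) = (\<lambda>k. x (2 + k div s) (k mod s)) ` {0..<j}"
      using j by (simp add: zs_def take_map take_upt)
    show ?thesis
    proof
      assume "x l a \<in> set (take j zs)"
      then obtain k where k: "k < j" "x l a = x (2 + k div s) (k mod s)" unfolding set by auto
      have ks: "k < s * (d - 1)" using k(1) j by simp
      have "l = 2 + k div s \<and> a = k mod s"
        using idx[OF ks] by (intro inj[OF l _ a _ k(2)]) auto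
      then show "2 \<le> l \<and> (l - 2) * s + a < j" using k(1) by simp
    next
      assume *: "2 \<le> l \<and> (l - 2) * s + a < j"
      let ?k = "(l - 2) * s + a"
      have "2 + ?k div s = l" "?k mod s = a" using a * by auto
      then have "x l a = x (2 + ?k div s) (?k mod s)" by simp
      then show "x l a \<in> set (take j zs)" unfolding set by (rule image_eqI) (use * in simp)
    qed
  qed
  have zsX: "\<exists>l\<in>{2..d}. \<exists>a<s. z = x l a" if "z \<in> set zs" for z
    using that idx by (fastforce simp: zs_def)
  have yzs: "y z \<in> X - set zs" if z: "z \<in> set zs" for z
  proof -
    obtain l a where la: "l \<in> {2..d}" "a < s" "z = x l a" using zsX[OF z] by blast
    then have yz: "y z = x 1 a" using y[of l a] by simp
    have "x 1 a \<notin> set (take (s * (d - 1)) zs)" using Zmem[of "s * (d - 1)" 1 a] la d by auto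
    then have "x 1 a \<notin> set zs" using len by simp
    moreover have "x 1 a \<in> X" unfolding X using la(2) d by force
    ultimately show ?thesis by (simp add: yz)
  qed
  have R: "2 + j div s \<in> {2..d}" "j mod s < s"
    "\<And>l a. l \<in> {1..d} \<Longrightarrow> a < s \<Longrightarrow> l < 2 + j div s \<Longrightarrow> collapse y (set (take j zs)) (x l a) = x 1 a"
    "\<And>l a. l \<in> {1..d} \<Longrightarrow> a < s \<Longrightarrow> 2 + j div s < l \<Longrightarrow> collapse y (set (take j zs)) (x l a) = x l a"
    "\<And>a. a < s \<Longrightarrow> collapse y (set (take j zs)) (x (2 + j div s) a) = x (2 + j div s) a \<or>
        collapse y (set (take j zs)) (x (2 + j div s) a) = x 1 a"
    "collapse y (set (take j zs)) (x (2 + j div s) (j mod s)) = x (2 + j div s) (j mod s)"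
    if j: "j < s * (d - 1)" for j
  proof -
    have jle: "j \<le> s * (d - 1)" using j by simp
    let ?l0 = "2 + j div s"
    have l0: "?l0 \<in> {1..d}" using idx(1)[OF j] by auto
    have jdm: "j = (?l0 - 2) * s + j mod s" by simp
    show "?l0 \<in> {2..d}" "j mod s < s" by (rule idx[OF j])+
    show "collapse y (set (take j zs)) (x l a) = x 1 a" if la: "l \<in> {1..d}" "a < s" "l < ?l0" for l a
    proof (cases "l = 1")
      case True
      then show ?thesis using y[OF la(1,2)] by (simp add: collapse_def)
    next
      case False
      then have l2: "2 \<le> l" using la(1) by auto
      have "(l - 2) * s + a < (l - 2 + 1) * s" using la(2) by simp
      also have "\<dots> \<le> (?l0 - 2) * s" by (rule mult_le_mono1) (use la(3) l2 in linarith)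
      also have "\<dots> \<le> j" using jdm by linarith
      finally have "x l a \<in> set (take j zs)" using Zmem[OF jle la(1,2)] l2 by simp
      then show ?thesis using y[OF la(1,2)] by (simp add: collapse_def)
    qed
    show "collapse y (set (take j zs)) (x l a) = x l a" if la: "l \<in> {1..d}" "a < s" "?l0 < l" for l a
    proof -
      have "(?l0 - 2 + 1) * s = (?l0 - 2) * s + s" by simp
      then have "j < (?l0 - 2 + 1) * s" using jdm idx(2)[OF j] by linarith
      also have "\<dots> \<le> (l - 2) * s" by (rule mult_le_mono1) (use la(3) in linarith)
      finally have "x l a \<notin> set (take j zs)" using Zmem[OF jle la(1,2)] by simp
      then show ?thesis by (simp add: collapse_def)
    qed
    show "collapse y (set (take j zs)) (x ?l0 a) = x ?l0 a \<or> collapse y (set (take j zs)) (x ?l0 a) = x 1 a"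
      if "a < s" for a using y[OF l0 that] by (simp add: collapse_def)
    have "x ?l0 (j mod s) \<notin> set (take j zs)" using Zmem[OF jle l0 idx(2)[OF j]] jdm by simp
    then show "collapse y (set (take j zs)) (x ?l0 (j mod s)) = x ?l0 (j mod s)" by (simp add: collapse_def)
  qed
  have "enat (length zs) \<le> depth (mpoly_ring X Quot I) ((+>\<^bsub>mpoly_ring X\<^esub>) I ` graded_maximal_ideal X)"
  proof (rule depth_quotient_ge[OF I, of zs y])
    show "finite e \<and> e \<subseteq> X \<and> e \<noteq> {}" if e: "e \<in> staircase_edges d s x" for e
    proof -
      obtain a where "e = (\<lambda>l. x l (a l)) ` {1..d}" "staircase d s a" using e by (auto simp: staircase_edges_def)
      then show ?thesis using d by (auto simp: X staircase_def)
    qed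
    show "distinct zs"
    proof -
      have "inj_on (\<lambda>j. x (2 + j div s) (j mod s)) {0..<s * (d - 1)}"
      proof (rule inj_onI)
        fix j k assume jk: "j \<in> {0..<s * (d - 1)}" "k \<in> {0..<s * (d - 1)}"
          "x (2 + j div s) (j mod s) = x (2 + k div s) (k mod s)"
        have j: "j < s * (d - 1)" and k: "k < s * (d - 1)" using jk by auto
        have "2 + j div s = 2 + k div s \<and> j mod s = k mod s"
          by (rule inj[OF _ _ _ _ jk(3)]) (use idx[OF j] idx[OF k] in auto)
        then show "j = k" by (metis add_left_cancel div_mult_mod_eq)
      qed
      then show ?thesis unfolding zs_def by (simp add: distinct_map)
    qed
    show "set zs \<subseteq> X" unfolding X using zsX by force
    show "y z \<in> X - set zs" if "z \<in> set zs" for z by (rule yzs[OF that])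
    fix j :: nat and m :: "'v \<Rightarrow>\<^sub>0 nat"
    assume "j < length zs"
    then have j: "j < s * (d - 1)" by (simp add: len)
    let ?\<rho> = "collapse y (set (take j zs))"
    let ?R = "\<lambda>l a. ?\<rho> (x l a)"
    note RR = R[OF j]
    let ?l0 = "2 + j div s" and ?a0 = "j mod s"
    have l0: "?l0 \<in> {1..d}" using RR(1) by auto
    {
      assume ne: "lookup m (zs ! j) \<noteq> 0"
        and mem: "m + single (zs ! j) 1 \<in> collapsed_multiples ?\<rho> (staircase_edges d s x)"
      then obtain a where a: "staircase d s a"
        "\<And>w. (\<Sum>l\<in>{1..d}. if ?R l (a l) = w then 1 else 0) \<le> lookup (m + single (zs ! j) 1) w"
        unfolding multiples_iff by blast
      have "(\<Sum>l\<in>{1..d}. if ?R l (a l) = w then 1 else 0) \<le> lookup m w" for w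
      proof (cases "w = zs ! j")
        case True
        have "(\<Sum>l\<in>{1..d}. if ?R l (a l) = x ?l0 ?a0 then 1 else 0 :: nat) = (if a ?l0 = ?a0 then 1 else 0)"
          by (rule staircase_degree_current[where s=s]) (fact inj RR a(1))+
        then have "(\<Sum>l\<in>{1..d}. if ?R l (a l) = x ?l0 ?a0 then 1 else 0 :: nat) \<le> 1"
          by simp
        then show ?thesis using ne True nth[OF j] by simp
      next
        case False
        then show ?thesis using a(2)[of w] by (simp add: lookup_add lookup_single when_def)
      qed
      then show "m \<in> collapsed_multiples ?\<rho> (staircase_edges d s x)"
        unfolding multiples_iff using a(1) by blast
    }
    {
      assume mem1: "m + single (y (zs ! j)) 1 \<in> collapsed_multiples ?\<rho> (staircase_edges d s x)"
        and mem2: "m + single (zs ! j) 1 \<in> collapsed_multiples ?\<rho> (staircase_edges d s x)"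
      have yz: "y (zs ! j) = x 1 ?a0" unfolding nth[OF j] by (rule y[OF l0 RR(2)])
      obtain a where a: "staircase d s a"
        "\<And>w. (\<Sum>l\<in>{1..d}. if ?R l (a l) = w then 1 else 0) \<le> lookup (m + single (y (zs ! j)) 1) w"
        using mem1 unfolding multiples_iff by blast
      obtain b where b: "staircase d s b"
        "\<And>w. (\<Sum>l\<in>{1..d}. if ?R l (b l) = w then 1 else 0) \<le> lookup (m + single (zs ! j) 1) w"
        using mem2 unfolding multiples_iff by blast
      have "\<exists>c. staircase d s c \<and> (\<forall>w. (\<Sum>l\<in>{1..d}. if ?R l (c l) = w then 1 else 0 :: nat) \<le> lookup m w)"
      proof (rule staircase_exchange[where s=s and ?l0.0="?l0" and ?a0.0="?a0"])
        show "l = l' \<and> a = a'" if "l \<in> {1..d}" "l' \<in> {1..d}" "a < s" "a' < s" "x l a = x l' a'" for l l' a a'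
          using inj[OF that] .
        show "?l0 \<in> {2..d}" "?a0 < s" "staircase d s a" "staircase d s b" by (fact RR a(1) b(1))+
        show "?R l a = x 1 a" if "l \<in> {1..d}" "a < s" "l < ?l0" for l a by (rule RR(3)[OF that])
        show "?R l a = x l a" if "l \<in> {1..d}" "a < s" "?l0 < l" for l a by (rule RR(4)[OF that])
        show "?R ?l0 a = x ?l0 a \<or> ?R ?l0 a = x 1 a" if "a < s" for a by (rule RR(5)[OF that])
        show "?R ?l0 ?a0 = x ?l0 ?a0" by (rule RR(6))
        show "(\<Sum>l\<in>{1..d}. if ?R l (a l) = w then 1 else 0) \<le> lookup m w + (if w = x 1 ?a0 then 1 else 0)" for w
          using a(2)[of w] by (auto simp: yz lookup_add lookup_single when_def split: if_splits)
        show "(\<Sum>l\<in>{1..d}. if ?R l (b l) = w then 1 else 0) \<le> lookup m w + (if w = x ?l0 ?a0 then 1 else 0)" for w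
          using b(2)[of w] by (auto simp: nth[OF j] lookup_add lookup_single when_def split: if_splits)
      qed
      then show "m \<in> collapsed_multiples ?\<rho> (staircase_edges d s x)"
        unfolding multiples_iff by blast
    }
  qed
  then show ?thesis by (simp add: len)
qed

section \<open>Spread hypergraphs on intervals\<close>

lemma spread_edgeI:
  assumes "\<And>l. l \<in> {1..d} \<Longrightarrow> k l \<in> V l" "\<And>l. l \<in> {1..<d} \<Longrightarrow> k l + t l \<le> k (Suc l)"
  shows "k ` {1..d} \<in> spread_edges d t V"
  unfolding spread_edges_def
proof (intro CollectI exI[of _ k] conjI ballI)
  fix j assume j: "j \<in> {2..d}"
  then have "k (j - 1) + t (j - 1) \<le> k (Suc (j - 1))" by (intro assms(2)) auto
  then show "int (k j) - int (k (j - 1)) \<ge> int (t (j - 1))" using j by simp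
qed (use assms(1) in auto)

lemma spread_edgeE:
  assumes "e \<in> spread_edges d t V"
  obtains k where "e = k ` {1..d}" "\<And>l. l \<in> {1..d} \<Longrightarrow> k l \<in> V l" "\<And>l. l \<in> {1..<d} \<Longrightarrow> k l + t l \<le> k (Suc l)"
proof -
  obtain k where k: "e = k ` {1..d}" "\<forall>j\<in>{1..d}. k j \<in> V j"
     "\<forall>j\<in>{2..d}. int (k j) - int (k (j - 1)) \<ge> int (t (j - 1))"
    using assms by (auto simp: spread_edges_def)
  have "k l + t l \<le> k (Suc l)" if "l \<in> {1..<d}" for l
    using bspec[OF k(3), of "Suc l"] that by simp
  with k show ?thesis using that by blast
qed

text \<open>The assumptions \<open>low\<close> and \<open>high\<close> are the form in which the absence of isolated vertices is used: from
  each level to the next, the first and the last elements advance by at least \<open>t l\<close>.\<close>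

locale interval_spread_family =
  fixes d :: nat and t i m :: "nat \<Rightarrow> nat" and V :: "nat \<Rightarrow> nat set" and X :: "nat set" and I :: "(nat, 'k::field) mpoly set"
  assumes d: "1 \<le> d"
    and pos: "\<And>l. l \<in> {1..d} \<Longrightarrow> 1 \<le> m l"
    and V: "\<And>l. l \<in> {1..d} \<Longrightarrow> V l = {i l..i l + m l - 1}"
    and disj: "\<And>l l'. l \<in> {1..d} \<Longrightarrow> l' \<in> {1..d} \<Longrightarrow> l \<noteq> l' \<Longrightarrow> V l \<inter> V l' = {}"
    and order: "\<And>l l' p q. l \<in> {1..d} \<Longrightarrow> l' \<in> {1..d} \<Longrightarrow> l < l' \<Longrightarrow> p \<in> V l \<Longrightarrow> q \<in> V l' \<Longrightarrow> p < q"
    and low: "\<And>l. l \<in> {1..<d} \<Longrightarrow> i l + t l \<le> i (Suc l)"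
    and high: "\<And>l. l \<in> {1..<d} \<Longrightarrow> i l + m l + t l \<le> i (Suc l) + m (Suc l)"
    and X: "X = (\<Union>l\<in>{1..d}. V l)"
    and I: "I = monomial_ideal X (edge_multiples (spread_edges d t V))"
begin

lemma finite_vertices: "finite X"
  by (simp add: X V)

lemma card_level: "l \<in> {1..d} \<Longrightarrow> card (V l) = m l"
  using pos[of l] by (simp add: V)

lemma level_subset: "l \<in> {1..d} \<Longrightarrow> V l \<subseteq> X"
  by (auto simp: X)

lemma ideal_I: "ideal I (mpoly_ring X)"
  unfolding I by (rule edge_multiples_ideal)

lemma transversal_inj:
  assumes "\<And>l. l \<in> {1..d} \<Longrightarrow> k l \<in> V l"
  shows "inj_on k {1..d}"
proof (rule inj_onI)
  fix l l' assume l: "l \<in> {1..d}" "l' \<in> {1..d}" "k l = k l'"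
  show "l = l'"
  proof (rule ccontr)
    assume "l \<noteq> l'"
    then show False using disj[OF l(1,2)] assms[OF l(1)] assms[OF l(2)] l(3) by auto
  qed
qed

lemma spread_edge_facts:
  assumes e: "e \<in> spread_edges d t V"
  shows "finite e \<and> card e = d" "e \<subseteq> X"
proof -
  obtain k where k: "e = k ` {1..d}" "\<And>l. l \<in> {1..d} \<Longrightarrow> k l \<in> V l" using e by (rule spread_edgeE) blast
  show "finite e \<and> card e = d" using k(1) card_image[OF transversal_inj[OF k(2)]] by simp
  show "e \<subseteq> X" using k by (auto simp: X)
qed

text \<open>Taking first elements before level \<open>j\<close> and last elements after it leaves the greatest freedom at level
  \<open>j\<close>.\<close>

abbreviation extremal :: "nat \<Rightarrow> nat \<Rightarrow> nat" where
  "extremal j \<equiv> (\<lambda>l. if l < j then i l else i l + m l - 1)"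

lemma homology_class_of_level:
  assumes j: "j \<in> {1..d}"
  shows "koszul_homology_nonzero X I (m j)"
proof -
  let ?F = "extremal j ` ({1..d} - {j})"
  have ext: "extremal j l \<in> V l" if "l \<in> {1..d}" for l using V[OF that] pos[OF that] by auto
  have "koszul_homology_nonzero X (monomial_ideal X (edge_multiples (spread_edges d t V)) :: (nat, 'k) mpoly set) (card (V j))"
  proof (rule koszul_homology_nonzero_star[OF finite_vertices, of _ d])
    show "finite e \<and> card e = d" if "e \<in> spread_edges d t V" for e by (rule spread_edge_facts(1)[OF that])
    show "V j \<subseteq> X" by (rule level_subset[OF j])
    show "V j \<noteq> {}" using V[OF j] pos[OF j] by auto
    show "?F \<subseteq> X" using ext level_subset by blast
    have "inj_on (extremal j) ({1..d} - {j})" by (rule inj_on_subset[OF transversal_inj[OF ext]]) auto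
    then have "card ?F = card ({1..d} - {j})" by (rule card_image)
    also have "\<dots> = d - 1" using j by simp
    finally show "Suc (card ?F) = d" using d by linarith
    fix v assume v: "v \<in> V j"
    let ?k = "(extremal j)(j := v)"
    have "?k ` {1..d} \<in> spread_edges d t V"
    proof (rule spread_edgeI)
      show "?k l \<in> V l" if "l \<in> {1..d}" for l using ext[OF that] v by simp
      show "?k l + t l \<le> ?k (Suc l)" if l: "l \<in> {1..<d}" for l
      proof -
        have "1 \<le> m l" "1 \<le> m (Suc l)" using pos[of l] pos[of "Suc l"] l by auto
        moreover have "i j \<le> v" "v \<le> i j + m j - 1" using v V[OF j] by auto
        ultimately show ?thesis using low[OF l] high[OF l] by (auto simp: less_Suc_eq)
      qed
    qed
    moreover have "?k ` {1..d} = insert v ?F" using j by (auto simp: image_iff)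
    ultimately show "insert v ?F \<in> spread_edges d t V" by simp
  qed
  then show ?thesis by (simp add: I card_level[OF j])
qed

text \<open>When level \<open>j + 1\<close> starts later than necessary and both levels have the same size, its last two
  elements are both compatible with every element of level \<open>j\<close>.\<close>

lemma homology_class_of_gap:
  assumes j: "j \<in> {1..<d}" and mm: "m j = m (Suc j)" "2 \<le> m (Suc j)" and gap: "i j + t j < i (Suc j)"
  shows "koszul_homology_nonzero X I (Suc (m j))"
proof -
  let ?F = "extremal j ` ({1..d} - {j, Suc j})"
  \<comment> \<open>the last two elements of level \<open>j + 1\<close>\<close>
  let ?b' = "i (Suc j) + m (Suc j) - 1"
  let ?b = "i (Suc j) + m (Suc j) - 2"
  have jd: "j \<in> {1..d}" "Suc j \<in> {1..d}" using j by auto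
  have ext: "extremal j l \<in> V l" if "l \<in> {1..d}" for l using V[OF that] pos[OF that] by auto
  have bV: "?b \<in> V (Suc j)" "?b' \<in> V (Suc j)" using V[OF jd(2)] mm(2) by auto
  have edge: "insert v (insert c ?F) \<in> spread_edges d t V" if v: "v \<in> V j" and c: "c \<in> {?b, ?b'}" for v c
  proof -
    let ?k = "(extremal j)(j := v, Suc j := c)"
    have cV: "c \<in> V (Suc j)" using bV c by auto
    have "?k ` {1..d} \<in> spread_edges d t V"
    proof (rule spread_edgeI)
      show "?k l \<in> V l" if "l \<in> {1..d}" for l using ext[OF that] v cV by simp
      show "?k l + t l \<le> ?k (Suc l)" if l: "l \<in> {1..<d}" for l
      proof -
        have p: "1 \<le> m l" "1 \<le> m (Suc l)" using pos[of l] pos[of "Suc l"] l by auto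
        have vb: "i j \<le> v" "v \<le> i j + m j - 1" using v V[OF jd(1)] by auto
        have cb: "?b \<le> c" "c \<le> ?b'" using c by auto
        consider "Suc l < j" | "Suc l = j" | "l = j" | "l = Suc j" | "l > Suc j" by linarith
        then show ?thesis
        proof cases
          case 3
          then show ?thesis using vb cb gap mm by simp
        qed (use low[OF l] high[OF l] p vb cb in auto)
      qed
    qed
    moreover have "?k ` {1..d} = insert v (insert c ?F)" using jd by (auto simp: image_iff)
    ultimately show ?thesis by simp
  qed
  have "koszul_homology_nonzero X (monomial_ideal X (edge_multiples (spread_edges d t V)) :: (nat, 'k) mpoly set) (Suc (card (V j)))"
  proof (rule koszul_homology_nonzero_double_star[OF finite_vertices, of _ d _ ?b ?b'])
    show "finite e \<and> card e = d" if "e \<in> spread_edges d t V" for e by (rule spread_edge_facts(1)[OF that])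
    show "V j \<subseteq> X" by (rule level_subset[OF jd(1)])
    show "V j \<noteq> {}" using V[OF jd(1)] pos[OF jd(1)] by auto
    show "?b \<in> X" "?b' \<in> X" using bV level_subset[OF jd(2)] by auto
    show "?b < ?b'" using mm(2) by simp
    show "a < ?b" if "a \<in> V j" for a by (rule order[OF jd _ that bV(1)]) simp
    show "?F \<subseteq> X" using ext level_subset by blast
    have "inj_on (extremal j) ({1..d} - {j, Suc j})" by (rule inj_on_subset[OF transversal_inj[OF ext]]) auto
    then have "card ?F = card ({1..d} - {j, Suc j})" by (rule card_image)
    also have "\<dots> = d - 2" using jd by (subst card_Diff_subset) auto
    finally have "card ?F = d - 2" .
    moreover have "2 \<le> d" using j by auto
    ultimately show "Suc (Suc (card ?F)) = d" by linarith
    show "insert v (insert ?b ?F) \<in> spread_edges d t V" "insert v (insert ?b' ?F) \<in> spread_edges d t V"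
      if "v \<in> V j" for v using edge[OF that] by blast+
  qed
  then show ?thesis by (simp add: I card_level[OF jd(1)])
qed

lemma level_dimension_bound:
  assumes j: "j \<in> {1..d}"
  shows "krull_dim (mpoly_ring X Quot I) \<ge> enat (card X - m j)"
proof -
  have "I \<subseteq> variable_prime X (V j)"
    unfolding I variable_prime_def monomial_ideal_def
  proof clarify
    fix p :: "(nat, 'k) mpoly" and q
    assume p: "keys p \<subseteq> edge_multiples (spread_edges d t V)" and q: "q \<in> keys p"
      and e: "keys q \<inter> V j = {}"
    obtain e where e': "e \<in> spread_edges d t V" "e \<subseteq> keys q"
      using p q by (auto simp: edge_multiples_def)
    obtain k where k: "e = k ` {1..d}" "\<And>l. l \<in> {1..d} \<Longrightarrow> k l \<in> V l" using e'(1) by (rule spread_edgeE) blast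
    have "k j \<in> keys q \<inter> V j" using k(2)[OF j] k(1) j e'(2) by blast
    then show False using e by blast
  qed
  then show ?thesis
    using krull_dim_quotient_ge[OF finite_vertices level_subset[OF j] ideal_I] card_level[OF j] by simp
qed

text \<open>The assumption \<open>steps\<close> says that in terms of positions the spread condition is monotonicity. It holds
  if \<open>i (l + 1) - i l = t l\<close>, and also if \<open>s = 1\<close>, where every position is zero.\<close>

lemma staircase_cohen_macaulay:
  assumes s: "\<And>l. l \<in> {1..d} \<Longrightarrow> m l = s"
    and steps: "\<And>a. (\<And>l. l \<in> {1..d} \<Longrightarrow> a l < s) \<Longrightarrow>
      (\<forall>l\<in>{1..<d}. i l + a l + t l \<le> i (Suc l) + a (Suc l)) \<longleftrightarrow> (\<forall>l\<in>{1..<d}. a l \<le> a (Suc l))"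
  shows "cohen_macaulay_quotient X I"
proof -
  let ?x = "\<lambda>l a. i l + a"
  have one: "1 \<in> {1..d}" using d by simp
  have s1: "1 \<le> s" using pos[OF one] s[OF one] by simp
  have Vx: "V l = ?x l ` {..<s}" if l: "l \<in> {1..d}" for l
  proof (rule Set.set_eqI)
    fix v
    have "v \<in> V l \<longleftrightarrow> i l \<le> v \<and> v - i l < s" using V[OF l] s[OF l] s1 by auto
    also have "\<dots> \<longleftrightarrow> v \<in> ?x l ` {..<s}" by (auto simp: image_iff intro!: bexI[of _ "v - i l"])
    finally show "v \<in> V l \<longleftrightarrow> v \<in> ?x l ` {..<s}" .
  qed
  have inj: "l = l' \<and> a = a'"
    if h: "l \<in> {1..d}" "l' \<in> {1..d}" "a < s" "a' < s" "?x l a = ?x l' a'" for l l' a a'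
  proof -
    have "?x l a \<in> V l" unfolding Vx[OF h(1)] by (rule imageI) (use h(3) in simp)
    moreover have "?x l' a' \<in> V l'" unfolding Vx[OF h(2)] by (rule imageI) (use h(4) in simp)
    ultimately have "l = l'" using disj[OF h(1,2)] h(5) by (metis IntI empty_iff)
    then show ?thesis using h(5) by simp
  qed
  have Xx: "X = (\<Union>l\<in>{1..d}. ?x l ` {..<s})" unfolding X using Vx by simp
  have cardX: "card X = d * s" unfolding Xx by (rule card_staircase_vertices) (rule inj)
  have mono: "staircase d s a \<longleftrightarrow> (\<forall>l\<in>{1..<d}. a l \<le> a (Suc l))" if a: "\<And>l. l \<in> {1..d} \<Longrightarrow> a l < s" for a
  proof
    assume "staircase d s a"
    then show "\<forall>l\<in>{1..<d}. a l \<le> a (Suc l)" by (auto simp: staircase_def)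
  next
    assume step: "\<forall>l\<in>{1..<d}. a l \<le> a (Suc l)"
    have "a l \<le> a l'" if l: "l \<in> {1..d}" and l': "l' \<in> {1..d}" and le: "l \<le> l'" for l l'
      using le l'
    proof (induction l' rule: dec_induct)
      case (step n)
      then have "a l \<le> a n" "a n \<le> a (Suc n)" using \<open>\<forall>l\<in>{1..<d}. a l \<le> a (Suc l)\<close> l by auto
      then show ?case by simp
    qed simp
    then show "staircase d s a" using a by (auto simp: staircase_def)
  qed
  have E: "spread_edges d t V = staircase_edges d s ?x"
  proof (intro Set.set_eqI iffI)
    fix e assume "e \<in> spread_edges d t V"
    then obtain k where k: "e = k ` {1..d}" "\<And>l. l \<in> {1..d} \<Longrightarrow> k l \<in> V l" "\<And>l. l \<in> {1..<d} \<Longrightarrow> k l + t l \<le> k (Suc l)"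
      by (rule spread_edgeE) blast
    define a where "a l = k l - i l" for l
    have ka: "k l = i l + a l" "a l < s" if "l \<in> {1..d}" for l
      using k(2)[OF that] Vx[OF that] by (auto simp: a_def)
    have "\<forall>l\<in>{1..<d}. i l + a l + t l \<le> i (Suc l) + a (Suc l)"
      using k(3) ka(1) by simp
    then have "staircase d s a" using steps[of a] mono[of a] ka(2) by blast
    moreover have "e = (\<lambda>l. ?x l (a l)) ` {1..d}" unfolding k(1) by (rule image_cong) (simp_all add: ka(1))
    ultimately show "e \<in> staircase_edges d s ?x" by (auto simp: staircase_edges_def)
  next
    fix e assume "e \<in> staircase_edges d s ?x"
    then obtain a where a: "e = (\<lambda>l. ?x l (a l)) ` {1..d}" "staircase d s a" by (auto simp: staircase_edges_def)
    have as: "a l < s" if "l \<in> {1..d}" for l using a(2) that by (simp add: staircase_def)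
    have "\<forall>l\<in>{1..<d}. i l + a l + t l \<le> i (Suc l) + a (Suc l)" using steps[of a] mono[of a] as a(2) by blast
    then show "e \<in> spread_edges d t V"
      unfolding a(1) using as Vx by (intro spread_edgeI) auto
  qed
  have Ix: "I = monomial_ideal X (edge_multiples (staircase_edges d s ?x))" unfolding I E ..
  let ?depth = "depth (mpoly_ring X Quot I) ((+>\<^bsub>mpoly_ring X\<^esub>) I ` graded_maximal_ideal X)"
  let ?dim = "krull_dim (mpoly_ring X Quot I)"
  have dge: "?depth \<ge> enat (s * (d - 1))"
    by (rule staircase_depth_ge[OF inj Xx d Ix])
  have dle: "?depth \<le> enat (card X - s)"
    using depth_quotient_le[OF finite_vertices ideal_I homology_class_of_level[OF one]] s[OF one] by simp
  have kge: "?dim \<ge> enat (card X - s)"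
    using level_dimension_bound[OF one] s[OF one] by simp
  have kle: "?dim \<le> enat (card X - s)"
  proof (rule krull_dim_quotient_le[OF finite_vertices Ix, where g = "\<lambda>a. (\<lambda>l. ?x l a) ` {1..d}"])
    show "e \<subseteq> X" if "e \<in> staircase_edges d s ?x" for e
      using spread_edge_facts(2)[of e] that E by simp
    show "(\<lambda>l. ?x l a) ` {1..d} \<in> staircase_edges d s ?x" if "a < s" for a
      unfolding staircase_edges_def by (rule CollectI, rule exI[of _ "\<lambda>_. a"]) (use that in \<open>auto simp: staircase_def\<close>)
    show "(\<lambda>l. ?x l a) ` {1..d} \<inter> (\<lambda>l. ?x l b) ` {1..d} = {}" if ab: "a < s" "b < s" "a \<noteq> b" for a b
    proof (rule equals0I)
      fix v assume "v \<in> (\<lambda>l. ?x l a) ` {1..d} \<inter> (\<lambda>l. ?x l b) ` {1..d}"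
      then obtain l l' where "l \<in> {1..d}" "l' \<in> {1..d}" "?x l a = ?x l' b" by auto
      then show False using inj[of l l' a b] ab by blast
    qed
  qed
  have "s * (d - 1) = card X - s" by (simp add: cardX algebra_simps diff_mult_distrib2)
  then have "?depth = ?dim" using dge dle kge kle by (metis order_antisym)
  then show ?thesis by (simp add: cohen_macaulay_quotient_def cohen_macaulay_def)
qed

lemma not_cohen_macaulay:
  assumes j: "j \<in> {1..d}" and H: "koszul_homology_nonzero X I h" and lt: "m j < h"
  shows "\<not> cohen_macaulay_quotient X I"
proof
  assume "cohen_macaulay_quotient X I"
  then have "enat (card X - m j) \<le> depth (mpoly_ring X Quot I) ((+>\<^bsub>mpoly_ring X\<^esub>) I ` graded_maximal_ideal X)"
    using level_dimension_bound[OF j] by (simp add: cohen_macaulay_quotient_def cohen_macaulay_def)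
  also have "\<dots> \<le> enat (card X - h)" by (rule depth_quotient_le[OF finite_vertices ideal_I H])
  finally have "card X - m j \<le> card X - h" by simp
  moreover have "h \<le> card X" by (rule koszul_homology_nonzero_le[OF finite_vertices ideal_I H])
  ultimately show False using lt by simp
qed

end

theorem theorem4p11:
  fixes n d :: nat
    and t :: "nat \<Rightarrow> nat"
    and V :: "nat \<Rightarrow> nat set"
    and i m :: "nat \<Rightarrow> nat"
    and H :: "nat hypergraph"
    and I :: "(nat, 'k::field) mpoly set"
  assumes "n \<ge> 1" and "d \<ge> 1"
    and "\<forall>j \<in> {1..d - 1}. t j \<ge> 1"
    and "ordered_family n d V"
    and "H = complete_spread_hypergraph d t V"
    and "no_isolated_vertices H"
    and "\<forall>j \<in> {1..d}. card (V j) = m j \<and> V j = {i j..i j + m j - 1}"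
    and "I = edge_ideal H"
  shows "cohen_macaulay_quotient (verts H) I \<longleftrightarrow>
    principalideal I (mpoly_ring (verts H)) \<or>
    ((\<exists>s. \<forall>j \<in> {1..d}. m j = s) \<and>
     (\<forall>j \<in> {1..d - 1}. int (i (j + 1)) - int (i j) = int (t j)))"
proof -
  let ?X = "verts H" and ?E = "spread_edges d t V"
  have d: "1 \<le> d" using assms(2) .
  have V: "V l = {i l..i l + m l - 1}" and cardV: "card (V l) = m l" if "l \<in> {1..d}" for l
    using assms(7) that by blast+
  have ne: "V l \<noteq> {}" if "l \<in> {1..d}" for l using assms(4) that by (simp add: ordered_family_def)
  have pos: "1 \<le> m l" if "l \<in> {1..d}" for l
  proof -
    have "finite (V l)" using V[OF that] by simp
    then have "card (V l) \<noteq> 0" using ne[OF that] by simp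
    then show ?thesis using cardV[OF that] by simp
  qed
  have disj: "V l \<inter> V l' = {}" if "l \<in> {1..d}" "l' \<in> {1..d}" "l \<noteq> l'" for l l'
    using assms(4) that by (simp add: ordered_family_def disjoint_family_on_def)
  have order: "p < q" if "l \<in> {1..d}" "l' \<in> {1..d}" "l < l'" "p \<in> V l" "q \<in> V l'" for l l' p q
    using assms(4) that unfolding ordered_family_def by blast
  have X: "?X = (\<Union>l\<in>{1..d}. V l)" and E: "edges H = ?E"
    by (simp_all add: assms(5) complete_spread_hypergraph_def)
  have through: "\<exists>k. (\<forall>l\<in>{1..d}. k l \<in> V l) \<and> (\<forall>l\<in>{1..<d}. k l + t l \<le> k (Suc l)) \<and> k j = v"
    if j: "j \<in> {1..d}" and v: "v \<in> V j" for j v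
  proof -
    have "v \<in> ?X" using j v by (auto simp: X)
    then obtain e where e: "e \<in> ?E" "v \<in> e"
      using assms(6) by (auto simp: no_isolated_vertices_def E)
    obtain k where k: "e = k ` {1..d}" "\<And>l. l \<in> {1..d} \<Longrightarrow> k l \<in> V l" "\<And>l. l \<in> {1..<d} \<Longrightarrow> k l + t l \<le> k (Suc l)"
      using e(1) by (rule spread_edgeE) blast
    obtain l where l: "l \<in> {1..d}" "v = k l" using e(2) k(1) by blast
    have "l = j" using disj[OF l(1) j] k(2)[OF l(1)] v l(2) by blast
    then show ?thesis using k(2,3) l(2) by blast
  qed
  have low: "i l + t l \<le> i (Suc l)" if l: "l \<in> {1..<d}" for l
  proof -
    have ld: "l \<in> {1..d}" "Suc l \<in> {1..d}" using l by auto
    have "i (Suc l) \<in> V (Suc l)" using V[OF ld(2)] pos[OF ld(2)] by simp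
    then obtain k where k: "\<forall>l\<in>{1..d}. k l \<in> V l" "\<forall>l\<in>{1..<d}. k l + t l \<le> k (Suc l)" "k (Suc l) = i (Suc l)"
      using through[OF ld(2)] by blast
    have "i l \<le> k l" using k(1) ld(1) V[OF ld(1)] by auto
    moreover have "k l + t l \<le> k (Suc l)" using k(2) l by blast
    ultimately show ?thesis using k(3) by simp
  qed
  have high: "i l + m l + t l \<le> i (Suc l) + m (Suc l)" if l: "l \<in> {1..<d}" for l
  proof -
    have ld: "l \<in> {1..d}" "Suc l \<in> {1..d}" using l by auto
    have "i l + m l - 1 \<in> V l" using V[OF ld(1)] pos[OF ld(1)] by simp
    then obtain k where k: "\<forall>l\<in>{1..d}. k l \<in> V l" "\<forall>l\<in>{1..<d}. k l + t l \<le> k (Suc l)" "k l = i l + m l - 1"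
      using through[OF ld(1)] by blast
    have "k (Suc l) \<le> i (Suc l) + m (Suc l) - 1" using k(1) ld(2) V[OF ld(2)] by auto
    moreover have "k l + t l \<le> k (Suc l)" using k(2) l by blast
    ultimately show ?thesis using k(3) pos[OF ld(1)] pos[OF ld(2)] by simp
  qed
  interpret F: interval_spread_family d t i m V ?X "monomial_ideal ?X (edge_multiples ?E) :: (nat, 'k) mpoly set"
  proof (rule interval_spread_family.intro)
    show "1 \<le> d" by (rule d)
    show "1 \<le> m l" if "l \<in> {1..d}" for l by (rule pos[OF that])
    show "V l = {i l..i l + m l - 1}" if "l \<in> {1..d}" for l by (rule V[OF that])
    show "V l \<inter> V l' = {}" if "l \<in> {1..d}" "l' \<in> {1..d}" "l \<noteq> l'" for l l' by (rule disj[OF that])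
    show "p < q" if "l \<in> {1..d}" "l' \<in> {1..d}" "l < l'" "p \<in> V l" "q \<in> V l'" for l l' p q
      by (rule order[OF that])
    show "i l + t l \<le> i (Suc l)" if "l \<in> {1..<d}" for l by (rule low[OF that])
    show "i l + m l + t l \<le> i (Suc l) + m (Suc l)" if "l \<in> {1..<d}" for l by (rule high[OF that])
  qed (rule X refl)+
  have edges: "finite e \<and> card e = d \<and> e \<subseteq> ?X" if "e \<in> ?E" for e
    using F.spread_edge_facts[OF that] by blast
  have I: "I = monomial_ideal ?X (edge_multiples ?E)"
    unfolding assms(8) E[symmetric] by (rule edge_ideal_eq) (use edges E in auto)
  note CM_I = F.not_cohen_macaulay[folded I]
  have one: "1 \<in> {1..d}" using d by simp
  show ?thesis
  proof
    assume rhs: "principalideal I (mpoly_ring ?X) \<or>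
      ((\<exists>s. \<forall>j \<in> {1..d}. m j = s) \<and> (\<forall>j \<in> {1..d - 1}. int (i (j + 1)) - int (i j) = int (t j)))"
    show "cohen_macaulay_quotient ?X I"
    proof (cases "principalideal I (mpoly_ring ?X)")
      case True
      have single: "m l = 1" if l: "l \<in> {1..d}" for l
      proof (rule ccontr)
        assume "m l \<noteq> 1"
        then have m2: "i l \<in> V l" "Suc (i l) \<in> V l" using V[OF l] pos[OF l] by auto
        obtain k where k: "\<forall>l\<in>{1..d}. k l \<in> V l" "\<forall>l\<in>{1..<d}. k l + t l \<le> k (Suc l)" "k l = i l"
          using through[OF l m2(1)] by blast
        obtain k' where k': "\<forall>l\<in>{1..d}. k' l \<in> V l" "\<forall>l\<in>{1..<d}. k' l + t l \<le> k' (Suc l)" "k' l = Suc (i l)"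
          using through[OF l m2(2)] by blast
        have kE: "k ` {1..d} \<in> ?E" by (rule spread_edgeI) (use k in blast)+
        have k'E: "k' ` {1..d} \<in> ?E" by (rule spread_edgeI) (use k' in blast)+
        have "k ` {1..d} = k' ` {1..d}"
          by (rule principal_edge_ideal_imp_single_edge[OF I edges True kE k'E])
        then obtain l' where l': "l' \<in> {1..d}" "Suc (i l) = k l'" using k'(3) l by (metis (no_types, lifting) imageE imageI)
        moreover have "k l' \<in> V l'" using k(1) l'(1) by blast
        ultimately have "l' = l" using m2(2) disj[OF l'(1) l] by (metis IntI empty_iff)
        then show False using l'(2) k(3) by simp
      qed
      show ?thesis
      proof (rule F.staircase_cohen_macaulay[folded I, OF single])
        fix a :: "nat \<Rightarrow> nat" assume "\<And>l. l \<in> {1..d} \<Longrightarrow> a l < 1"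
        then have "a l = 0" if "l \<in> {1..d}" for l using that by auto
        then show "(\<forall>l\<in>{1..<d}. i l + a l + t l \<le> i (Suc l) + a (Suc l)) \<longleftrightarrow> (\<forall>l\<in>{1..<d}. a l \<le> a (Suc l))"
          using low by auto
      qed
    next
      case False
      then obtain s where s: "\<forall>j \<in> {1..d}. m j = s" and step: "\<forall>j \<in> {1..d - 1}. int (i (j + 1)) - int (i j) = int (t j)"
        using rhs by blast
      have it: "i (Suc l) = i l + t l" if "l \<in> {1..<d}" for l
      using bspec[OF step, of l] that by (simp add: Suc_le_eq less_diff_conv le_diff_conv2)
      show ?thesis
      proof (rule F.staircase_cohen_macaulay[folded I])
        show "m l = s" if "l \<in> {1..d}" for l using s that by blast
        show "(\<forall>l\<in>{1..<d}. i l + a l + t l \<le> i (Suc l) + a (Suc l)) \<longleftrightarrow> (\<forall>l\<in>{1..<d}. a l \<le> a (Suc l))" for a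
          using it by (intro ball_cong) auto
      qed
    qed
  next
    assume CM: "cohen_macaulay_quotient ?X I"
    show "principalideal I (mpoly_ring ?X) \<or>
      ((\<exists>s. \<forall>j \<in> {1..d}. m j = s) \<and> (\<forall>j \<in> {1..d - 1}. int (i (j + 1)) - int (i j) = int (t j)))"
    proof (rule disj_imp[THEN iffD2], rule impI)
      assume np: "\<not> principalideal I (mpoly_ring ?X)"
      have eq: "m j = m 1" if j: "j \<in> {1..d}" for j
      proof -
        have "\<not> m 1 < m j" "\<not> m j < m 1"
          using CM_I[OF one F.homology_class_of_level[OF j, folded I]]
            CM_I[OF j F.homology_class_of_level[OF one, folded I]] CM by blast+
        then show ?thesis by simp
      qed
      have m2: "2 \<le> m 1"
      proof (rule ccontr)
        assume "\<not> 2 \<le> m 1"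
        then have "m l = 1" if "l \<in> {1..d}" for l using eq[OF that] pos[OF that] by linarith
        then have Vi: "V l = {i l}" if "l \<in> {1..d}" for l using V[OF that] that by simp
        have "e = i ` {1..d}" if "e \<in> ?E" for e
        proof -
          obtain k where k: "e = k ` {1..d}" "\<And>l. l \<in> {1..d} \<Longrightarrow> k l \<in> V l" using \<open>e \<in> ?E\<close> by (rule spread_edgeE) blast
          then show ?thesis using Vi by (auto intro!: image_cong)
        qed
        moreover have ie: "i ` {1..d} \<in> ?E" by (rule spread_edgeI) (use Vi low in auto)
        ultimately have "edges H = {i ` {1..d}}" unfolding E by blast
        then have "I = Idl\<^bsub>mpoly_ring ?X\<^esub> {\<Prod>v\<in>i ` {1..d}. var v}" by (simp add: assms(8) edge_ideal_def)
        moreover have "(\<Prod>v\<in>i ` {1..d}. var v) \<in> carrier (mpoly_ring ?X :: (nat, 'k) mpoly ring)"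
          unfolding prod_var using edges[OF ie] by (intro mpoly_carrier_single) (simp add: keys_sqfree_exponent)
        ultimately have "principalideal I (mpoly_ring ?X)"
          using F.ideal_I[folded I] by (intro principalidealI) blast+
        then show False using np by blast
      qed
      have "int (i (j + 1)) - int (i j) = int (t j)" if "j \<in> {1..d - 1}" for j
      proof (rule ccontr)
        assume neq: "int (i (j + 1)) - int (i j) \<noteq> int (t j)"
        have j: "j \<in> {1..<d}" "j \<in> {1..d}" "Suc j \<in> {1..d}" using that by auto
        have "i j + t j < i (Suc j)" using neq low[OF j(1)] by auto
        then have "koszul_homology_nonzero ?X I (Suc (m j))"
          using F.homology_class_of_gap[folded I, OF j(1)] eq[OF j(2)] eq[OF j(3)] m2 by simp
        then show False using CM_I[OF j(2)] CM by blast
      qed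
      then show "(\<exists>s. \<forall>j \<in> {1..d}. m j = s) \<and> (\<forall>j \<in> {1..d - 1}. int (i (j + 1)) - int (i j) = int (t j))"
        using eq by blast
    qed
  qed
qed

end
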